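(* Let $n$ be a positive integer and $p$ a real number with $n>p>1$. Let $K:(0,\infty)\to(0,\infty)$ be a $C^1$ function such that $(K_1)$ the function $r\mapsto p+\frac{rK'(r)}{K(r)}$ is strictly positive and decreasing on $(0,\infty)$. Let $f:[0,\infty)\to\mathbb R$ satisfy: $(f_1)$ $f(0)=0$, and there exists $u_0>0$ such that $f(u)>0$ for $u>u_0$, and $f(u)\le 0$, $f(u)\not\equiv 0$, for $u\in(0,u_0)$; $(f_2)$ $f$ is continuous on $[0,\infty)$ and locally Lipschitz continuous on $[u_0,\infty)$; and, denoting by $D$ the set of points of $[u_0,\infty)$ at which $f'$ exists, $(f_3)$ $(p-1)f(u)\le f'(u)(u-u_0)$ for all $u\in D$; $(f_4)$ the function $u\mapsto \frac{uf'(u)}{f(u)}$ is decreasing on $D\setminus\{u_0\}$. Let $R>0$. Then the problem $$-(r^{n-1}\phi_p(u'))'=r^{n-1}K(r)f(u),\quad 0<r<R,$$ $$u'(0)=0,\quad u(R)=0,\quad u(r)> 0\ \text{ for } r\in(0,R),$$ has at most one non-trivial solution.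
   Context: $\phi_p(s):=|s|^{p-2}s$ for $s\neq 0$ and $\phi_p(0)=0$. A solution of the equation is a function $u\in C^1[0,R]$ such that $r^{n-1}\phi_p(u')\in C^1[0,R]$ and the equation holds. "Decreasing" means non-increasing (as opposed to "strictly decreasing"). *)

theory Defs
  imports "HOL-Analysis.Analysis"
begin

definition phi :: "real \<Rightarrow> real \<Rightarrow> real" where
  "phi p s = (if s = 0 then 0 else \<bar>s\<bar> powr (p - 2) * s)"

text \<open>Derivatives are taken within \<open>S\<close>, hence are one-sided at the end points of a closed
  interval; the values of the function outside \<open>S\<close> are irrelevant. The library's
  \<open>C1_differentiable_on\<close> would require two-sided derivatives there.\<close>

definition C1_with_deriv :: "real set \<Rightarrow> (real \<Rightarrow> real) \<Rightarrow> (real \<Rightarrow> real) \<Rightarrow> bool" where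
  "C1_with_deriv S g g' \<longleftrightarrow>
     (\<forall>x\<in>S. (g has_real_derivative g' x) (at x within S)) \<and> continuous_on S g'"

text \<open>Here \<open>u'\<close> and \<open>w'\<close> are the derivatives on \<open>[0,R]\<close> of \<open>u\<close> and of
  \<open>r\<^sup>n\<^sup>-\<^sup>1 \<phi>\<^sub>p(u')\<close>; they are uniquely determined there when \<open>R > 0\<close>. The equation is only
  imposed on the open interval, since \<open>K\<close> need not be defined at \<open>0\<close>.\<close>

definition is_solution ::
  "nat \<Rightarrow> real \<Rightarrow> real \<Rightarrow> (real \<Rightarrow> real) \<Rightarrow> (real \<Rightarrow> real) \<Rightarrow> (real \<Rightarrow> real) \<Rightarrow> bool" where
  "is_solution n p R K f u \<longleftrightarrow>
     (\<exists>u' w'.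
        C1_with_deriv {0..R} u u' \<and>
        C1_with_deriv {0..R} (\<lambda>r. r ^ (n - 1) * phi p (u' r)) w' \<and>
        (\<forall>r\<in>{0<..<R}. - w' r = r ^ (n - 1) * K r * f (u r)) \<and>
        u' 0 = 0 \<and> u R = 0 \<and> (\<forall>r\<in>{0<..<R}. u r > 0))"

definition locally_lipschitz_on :: "real set \<Rightarrow> (real \<Rightarrow> real) \<Rightarrow> bool" where
  "locally_lipschitz_on S g \<longleftrightarrow>
     (\<forall>x\<in>S. \<exists>e>0. \<exists>L. L-lipschitz_on (cball x e \<inter> S) g)"

end

theory Submission imports Defs begin

text \<open>In the variable \<open>t = ln r\<close> a solution becomes a decreasing profile \<open>v\<close> with
  \<open>v' = - y\<^sup>1\<^sup>/\<^sup>(\<^sup>p\<^sup>-\<^sup>1\<^sup>)\<close> and \<open>(e\<^sup>m\<^sup>t y)' = e\<^sup>m\<^sup>t\<^sup>+\<^sup>h f(v)\<close>, where \<open>m = n - p\<close> and \<open>e\<^sup>h = r\<^sup>p K\<close>; by \<open>(K\<^sub>1)\<close> the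
  function \<open>h\<close> is increasing and concave. Although \<open>f\<close> is only Lipschitz, \<open>(f\<^sub>3)\<close> and \<open>(f\<^sub>4)\<close> mean that
  \<open>f(u) / (u - u\<^sub>0)\<^sup>p\<^sup>-\<^sup>1\<close> is nondecreasing and that \<open>ln f\<close> is a concave function of \<open>ln u\<close>, because
  Lipschitz functions are differentiable almost everywhere.

  The quantity \<open>e = y / v\<^sup>p\<^sup>-\<^sup>1\<close> satisfies \<open>e' = J - g(e)\<close> with \<open>J = e\<^sup>h f(v) / v\<^sup>p\<^sup>-\<^sup>1\<close>, and \<open>ln J\<close> is concave in
  \<open>(t, ln v)\<close>. Parametrise arcs of profiles by \<open>e\<close>. If at equal \<open>e\<close> one arc is earlier and higher
  than another one, then the inequality \<open>J\<^sub>1 \<ge> J\<^sub>2\<close> is preserved as \<open>e\<close> grows, and it in turn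
  preserves the order of the arcs. Comparing two arcs of the same profile shows that \<open>e\<close> increases
  strictly until \<open>v = u\<^sub>0\<close>; this uses that \<open>v\<close> reaches \<open>0\<close>, which forces \<open>e\<close> to be large at \<open>u\<^sub>0\<close>.
  Comparing two profiles of different heights shows that at every common level \<open>\<ge> u\<^sub>0\<close> the taller
  one is steeper. A Sturm comparison of the functions \<open>v - u\<^sub>0\<close> makes the taller profile reach
  \<open>u\<^sub>0\<close> no later than the other one, and since \<open>f \<le> 0\<close> below \<open>u\<^sub>0\<close>, it stays steeper and reaches \<open>0\<close>
  strictly earlier. So two solutions have the same height. Such solutions agree near the centre by
  a contraction argument, and then everywhere by Gronwall's inequality with the level of \<open>u\<close> as
  independent variable, in which no Lipschitz bound for \<open>f\<close> is needed.\<close>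

section \<open>Lipschitz functions on the line\<close>

text \<open>At equal \<open>e\<close> the term \<open>g(e)\<close> cancels, so two arcs differ in
  speed only by \<open>J\<^sub>1 - J\<^sub>2\<close>. Were \<open>f\<close> differentiable,
  \<open>ln J\<close> would have the derivative
  \<open>(\<theta> - (v f'(v) / f(v) - (p - 1)) e^q) / V\<close> with respect to \<open>e\<close>,
  where \<open>V = J - g(e)\<close> and \<open>\<theta> = h'\<close>. The earlier arc has the larger
  \<open>\<theta>\<close>, the higher arc the smaller elasticity \<open>v f'(v) / f(v)\<close>, and
  \<open>J\<^sub>1 = J\<^sub>2\<close> forces \<open>V\<^sub>1 = V\<^sub>2\<close>; hence the
  derivatives are ordered the right way exactly where the inequality could break. Two obstacles
  shape the argument. The elasticity need not exist at the levels that an arc passes, so chord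
  slopes of \<open>ln f\<close> and one-sided minorants replace derivatives. And \<open>V\<close>
  tends to \<open>0\<close> at the centre, so the comparison has to start at small \<open>e\<close>
  with a small error that must not be amplified by a factor depending on the start; there
  \<open>\<theta> > 0\<close> dominates the term with \<open>e^q\<close>, and no loss
  occurs.\<close>

lemma isCont_at_left: "isCont f x \<Longrightarrow> (f \<longlongrightarrow> f x) (at_left x)"
  and isCont_at_right: "isCont f x \<Longrightarrow> (f \<longlongrightarrow> f x) (at_right x)"
  for f :: "real \<Rightarrow> real"
  by (auto simp: isCont_def intro: filterlim_mono[OF _ order.refl at_le])

lemma last_crossing:
  fixes F :: "real \<Rightarrow> real"
  assumes "a \<le> b" and cont: "continuous_on {a..b} F" and "F a \<le> c" "c < F b"
  obtains x where "a \<le> x" "x < b" "F x = c" "\<And>y. x < y \<Longrightarrow> y \<le> b \<Longrightarrow> c < F y"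
proof -
  define S where "S = {a..b} \<inter> F -` {..c}"
  have "closed S" unfolding S_def by (rule continuous_closed_preimage[OF cont]) auto
  moreover have "bounded S" by (rule bounded_subset[of "{a..b}"]) (auto simp: S_def)
  ultimately have "compact S" by (simp add: compact_eq_bounded_closed)
  moreover have "a \<in> S" using assms by (simp add: S_def)
  ultimately obtain x where x: "x \<in> S" "\<And>y. y \<in> S \<Longrightarrow> y \<le> x" using compact_attains_sup[of S] by blast
  have xab: "a \<le> x" "x \<le> b" "F x \<le> c" using x(1) by (auto simp: S_def)
  have after: "c < F y" if "x < y" "y \<le> b" for y using x(2)[of y] that xab by (force simp: S_def)
  have "F x = c"
  proof (rule ccontr)
    assume "F x \<noteq> c"
    then obtain y where "x \<le> y" "y \<le> b" "F y = c"
      using IVT'[of F x c b] xab assms continuous_on_subset[OF cont, of "{x..b}"] by force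
    then show False using after[of y] \<open>F x \<noteq> c\<close> by (cases "y = x") auto
  qed
  then show thesis using that[of x] xab after assms(4) by (cases "x = b") auto
qed

lemma first_crossing:
  fixes F :: "real \<Rightarrow> real"
  assumes "a \<le> b" and cont: "continuous_on {a..b} F" and "c < F a" "F b \<le> c"
  obtains x where "a < x" "x \<le> b" "F x = c" "\<And>y. a \<le> y \<Longrightarrow> y < x \<Longrightarrow> c < F y"
proof -
  have cont': "continuous_on {- b..- a} (\<lambda>x. F (- x))"
    by (rule continuous_on_compose2[OF cont]) (auto intro!: continuous_intros)
  obtain x where x: "- b \<le> x" "x < - a" "F (- x) = c" "\<And>y. x < y \<Longrightarrow> y \<le> - a \<Longrightarrow> c < F (- y)"
    using last_crossing[OF _ cont', of c] assms by auto
  show thesis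
  proof (rule that[of "- x"])
    fix y assume "a \<le> y" "y < - x"
    then show "c < F y" using x(4)[of "- y"] by simp
  qed (use x in auto)
qed

section \<open>Vitali covers and differentiability almost everywhere\<close>

lemma Vitali_intervals:
  fixes S U :: "real set"
  assumes "open U" "S \<subseteq> U"
    and fine: "\<And>x d. x \<in> S \<Longrightarrow> 0 < d \<Longrightarrow> \<exists>y z. y < x \<and> x < z \<and> z - y < d \<and> P y z"
  obtains C where "countable C" "\<And>i. i \<in> C \<Longrightarrow> fst i < snd i \<and> P (fst i) (snd i)"
    "(\<Union>i\<in>C. {fst i<..<snd i}) \<subseteq> U" "disjoint_family_on (\<lambda>i. {fst i<..<snd i}) C"
    "negligible (S - (\<Union>i\<in>C. {fst i<..<snd i}))"
proof -
  define K where "K = {i::real\<times>real. fst i < snd i \<and> P (fst i) (snd i) \<and> {fst i<..<snd i} \<subseteq> U}"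
  have ball: "ball ((fst i + snd i) / 2) ((snd i - fst i) / 2) = {fst i<..<snd i}" for i :: "real\<times>real"
    by (auto simp: dist_real_def abs_if field_simps split: if_splits)
  obtain C where C: "countable C" "C \<subseteq> K"
     "pairwise (\<lambda>i j. disjnt {fst i<..<snd i} {fst j<..<snd j}) C"
     "negligible (S - (\<Union>i\<in>C. {fst i<..<snd i}))"
  proof (rule Vitali_covering_theorem_balls
      [of S K "\<lambda>i. (fst i + snd i) / 2" "\<lambda>i. (snd i - fst i) / 2", unfolded ball])
    fix x d :: real assume x: "x \<in> S" and d: "0 < d"
    obtain e where e: "e > 0" "ball x e \<subseteq> U"
      using assms(1,2) x openE by blast
    obtain y z where yz: "y < x" "x < z" "z - y < min d e" "P y z"
      using fine[OF x, of "min d e"] d e(1) by auto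
    have "{y<..<z} \<subseteq> U"
      using e(2) yz(1,2,3) by (force simp: dist_real_def ball_def)
    then have "(y, z) \<in> K" using yz unfolding K_def by auto
    then show "\<exists>i. i \<in> K \<and> x \<in> {fst i<..<snd i} \<and> (snd i - fst i) / 2 < d"
      using yz d by (intro exI[of _ "(y, z)"]) auto
  qed blast
  show thesis
  proof
    show "disjoint_family_on (\<lambda>i. {fst i<..<snd i}) C"
      using C(3) unfolding disjoint_family_on_def pairwise_def disjnt_def by blast
    show "\<And>i. i \<in> C \<Longrightarrow> fst i < snd i \<and> P (fst i) (snd i)" using C(2) K_def by auto
    show "(\<Union>i\<in>C. {fst i<..<snd i}) \<subseteq> U" using C(2) K_def by auto
  qed (fact C(1,4))+
qed

text \<open>The Lebesgue--Stieltjes measure of \<open>F\<close> is compared with Lebesgue measure on two nested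
  Vitali covers, one by intervals of slope \<open>< p\<close> and one by intervals of slope \<open>> q\<close>.\<close>

lemma oscillating_slopes_negligible:
  fixes F :: "real \<Rightarrow> real"
  assumes mono: "mono F" and cont: "continuous_on UNIV F"
    and pq: "0 < p" "p < q" and bdd: "bounded S"
    and low: "\<And>x d. x \<in> S \<Longrightarrow> 0 < d \<Longrightarrow> \<exists>y z. y < x \<and> x < z \<and> z - y < d \<and> F z - F y < p * (z - y)"
    and high: "\<And>x d. x \<in> S \<Longrightarrow> 0 < d \<Longrightarrow> \<exists>y z. y < x \<and> x < z \<and> z - y < d \<and> F z - F y > q * (z - y)"
  shows "negligible S"
proof -
  define \<mu> where "\<mu> = interval_measure F"
  have Icc: "emeasure \<mu> {a..b} = F b - F a" if "a \<le> b" for a b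
    unfolding \<mu>_def using emeasure_interval_measure_Icc[OF that _ cont] mono by (auto simp: mono_def)
  have Ioo: "emeasure \<mu> {a<..<b} = F b - F a" if "a < b" for a b
  proof -
    have "emeasure \<mu> {a..b} = emeasure \<mu> ({a<..<b} \<union> ({a..a} \<union> {b..b}))"
      using that by (intro arg_cong[where f="emeasure \<mu>"]) auto
    also have "\<dots> = emeasure \<mu> {a<..<b} + emeasure \<mu> ({a..a} \<union> {b..b})"
      by (intro plus_emeasure[symmetric]) (auto simp: \<mu>_def)
    also have "emeasure \<mu> ({a..a} \<union> {b..b}) = emeasure \<mu> {a..a} + emeasure \<mu> {b..b}"
      using that by (intro plus_emeasure[symmetric]) (auto simp: \<mu>_def)
    finally show ?thesis using Icc[of a b] Icc[of a a] Icc[of b b] that by simp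
  qed
  have lIoo: "emeasure lborel {a<..<b} = ennreal (b - a)" if "a < b" for a b :: real
    using that by simp
  have sum: "emeasure M (\<Union>i\<in>C. {fst i<..<snd i}) = (\<integral>\<^sup>+i. emeasure M {fst i<..<snd i} \<partial>count_space C)"
    if "countable C" "disjoint_family_on (\<lambda>i. {fst i<..<snd i}) C" "sets M = sets borel"
    for C :: "(real\<times>real) set" and M
    using that by (intro emeasure_UN_countable) auto
  \<comment> \<open>The cover \<open>W1\<close> by low slopes and, inside it, the cover
    \<open>W2\<close> by high slopes satisfy \<open>q |W2| \<le> \<mu>(W2) \<le> \<mu>(W1) \<le> p
    |W1| \<le> p |U|\<close>, and each contains almost all of \<open>S\<close>. The null part of
    \<open>S\<close> that is missed goes into an open set of measure at most
    \<open>e\<close>.\<close>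
  have step: "\<exists>U'. open U' \<and> S \<subseteq> U' \<and> emeasure lborel U' \<le> ennreal (p / q) * emeasure lborel U + ennreal e"
    if U: "open U" "S \<subseteq> U" and e: "e > 0" for U and e :: real
  proof -
    obtain C1 where C1: "countable C1" "\<And>i. i \<in> C1 \<Longrightarrow> fst i < snd i \<and> F (snd i) - F (fst i) < p * (snd i - fst i)"
      "(\<Union>i\<in>C1. {fst i<..<snd i}) \<subseteq> U" "disjoint_family_on (\<lambda>i. {fst i<..<snd i}) C1"
      "negligible (S - (\<Union>i\<in>C1. {fst i<..<snd i}))"
    proof (rule Vitali_intervals[OF U, of "\<lambda>y z. F z - F y < p * (z - y)"])
      fix x d :: real assume "x \<in> S" "0 < d"
      then show "\<exists>y z. y < x \<and> x < z \<and> z - y < d \<and> F z - F y < p * (z - y)"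
        using low by blast
    qed auto
    define W1 where "W1 = (\<Union>i\<in>C1. {fst i<..<snd i})"
    have oW1: "open W1" unfolding W1_def by auto
    obtain C2 where C2: "countable C2" "\<And>i. i \<in> C2 \<Longrightarrow> fst i < snd i \<and> F (snd i) - F (fst i) > q * (snd i - fst i)"
      "(\<Union>i\<in>C2. {fst i<..<snd i}) \<subseteq> W1" "disjoint_family_on (\<lambda>i. {fst i<..<snd i}) C2"
      "negligible (S \<inter> W1 - (\<Union>i\<in>C2. {fst i<..<snd i}))"
    proof (rule Vitali_intervals[OF oW1, of "S \<inter> W1" "\<lambda>y z. F z - F y > q * (z - y)"])
      fix x d :: real assume "x \<in> S \<inter> W1" "0 < d"
      then show "\<exists>y z. y < x \<and> x < z \<and> z - y < d \<and> q * (z - y) < F z - F y"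
        using high by blast
    qed auto
    define W2 where "W2 = (\<Union>i\<in>C2. {fst i<..<snd i})"
    have oW2: "open W2" unfolding W2_def by auto
    have "emeasure \<mu> W1 = (\<integral>\<^sup>+i. emeasure \<mu> {fst i<..<snd i} \<partial>count_space C1)"
      unfolding W1_def using C1 by (intro sum) (auto simp: \<mu>_def)
    also have "\<dots> \<le> (\<integral>\<^sup>+i. ennreal p * emeasure lborel {fst i<..<snd i} \<partial>count_space C1)"
    proof (rule nn_integral_mono)
      fix i assume "i \<in> space (count_space C1)"
      then have i: "fst i < snd i" "F (snd i) - F (fst i) \<le> p * (snd i - fst i)" using C1(2)[of i] by auto
      show "emeasure \<mu> {fst i<..<snd i} \<le> ennreal p * emeasure lborel {fst i<..<snd i}"
        unfolding Ioo[OF i(1)] lIoo[OF i(1)] using i pq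
        by (subst ennreal_mult[symmetric]) (auto intro: ennreal_leI)
    qed
    also have "\<dots> = ennreal p * (\<integral>\<^sup>+i. emeasure lborel {fst i<..<snd i} \<partial>count_space C1)"
      by (rule nn_integral_cmult) auto
    also have "\<dots> = ennreal p * emeasure lborel W1"
      unfolding W1_def using C1 by (subst sum) auto
    finally have 1: "emeasure \<mu> W1 \<le> ennreal p * emeasure lborel W1" .
    have "ennreal q * emeasure lborel W2 = ennreal q * (\<integral>\<^sup>+i. emeasure lborel {fst i<..<snd i} \<partial>count_space C2)"
      unfolding W2_def using C2 by (subst sum) auto
    also have "\<dots> = (\<integral>\<^sup>+i. ennreal q * emeasure lborel {fst i<..<snd i} \<partial>count_space C2)"
      by (rule nn_integral_cmult[symmetric]) auto
    also have "\<dots> \<le> (\<integral>\<^sup>+i. emeasure \<mu> {fst i<..<snd i} \<partial>count_space C2)"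
    proof (rule nn_integral_mono)
      fix i assume "i \<in> space (count_space C2)"
      then have i: "fst i < snd i" "F (snd i) - F (fst i) \<ge> q * (snd i - fst i)" using C2(2)[of i] by auto
      show "ennreal q * emeasure lborel {fst i<..<snd i} \<le> emeasure \<mu> {fst i<..<snd i}"
        unfolding Ioo[OF i(1)] lIoo[OF i(1)] using i pq
        by (subst ennreal_mult[symmetric]) (auto intro: ennreal_leI)
    qed
    also have "\<dots> = emeasure \<mu> W2"
      unfolding W2_def using C2 by (intro sum[symmetric]) (auto simp: \<mu>_def)
    also have "\<dots> \<le> emeasure \<mu> W1"
      using C2(3) oW1 by (intro emeasure_mono) (auto simp: W2_def \<mu>_def)
    also note 1
    also have "ennreal p * emeasure lborel W1 \<le> ennreal p * emeasure lborel U"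
      using C1(3) U(1) by (intro mult_left_mono emeasure_mono) (auto simp: W1_def)
    finally have "ennreal (1/q) * (ennreal q * emeasure lborel W2) \<le> ennreal (1/q) * (ennreal p * emeasure lborel U)"
      by (rule mult_left_mono) auto
    then have 2: "emeasure lborel W2 \<le> ennreal (p / q) * emeasure lborel U"
      using pq by (simp add: mult.assoc[symmetric] ennreal_mult[symmetric])
    have "negligible (S - W2)"
      using negligible_Un[OF C1(5) C2(5)] by (rule negligible_subset) (auto simp: W1_def W2_def)
    then have neg: "S - W2 \<in> sets lebesgue" "emeasure lebesgue (S - W2) = 0"
      using negligible_iff_null_sets by (blast intro: null_setsD1)+
    obtain T where T: "open T" "S - W2 \<subseteq> T" "emeasure lebesgue (T - (S - W2)) < ennreal e" "T - (S - W2) \<in> lmeasurable"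
      using sets_lebesgue_outer_open[OF neg(1) e] by metis
    have "emeasure lebesgue T = emeasure lebesgue ((S - W2) \<union> (T - (S - W2)))"
      using T(2) by (intro arg_cong[where f="emeasure lebesgue"]) auto
    also have "\<dots> \<le> emeasure lebesgue (S - W2) + emeasure lebesgue (T - (S - W2))"
      using neg T(1,4) by (intro emeasure_subadditive) auto
    also have "\<dots> \<le> ennreal e" using neg T(3) by auto
    finally have 3: "emeasure lborel T \<le> ennreal e" using T(1) by auto
    have "emeasure lborel (W2 \<union> T) \<le> emeasure lborel W2 + emeasure lborel T"
      using oW2 T(1) by (intro emeasure_subadditive) auto
    also have "\<dots> \<le> ennreal (p / q) * emeasure lborel U + ennreal e" using 2 3 by (rule add_mono)
    finally show ?thesis using oW2 T(1,2) by (intro exI[of _ "W2 \<union> T"]) auto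
  qed
  \<comment> \<open>\<open>A\<close> consists of upper bounds for the outer measure of
    \<open>S\<close>; boundedness of \<open>S\<close> makes it nonempty. Its infimum cannot be
    positive, because \<open>step\<close> contracts it by the factor
    \<open>p / q < 1\<close>.\<close>
  define A where "A = {c. c \<ge> 0 \<and> (\<exists>U. open U \<and> S \<subseteq> U \<and> emeasure lborel U \<le> ennreal c)}"
  obtain c0 where "c0 > 0" "S \<subseteq> ball 0 c0" using bdd bounded_subset_ballD by blast
  then have "2 * c0 \<in> A" unfolding A_def using lIoo[of "-c0" "c0"]
    by (auto intro!: exI[of _ "ball 0 c0"] simp: ball_eq_greaterThanLessThan)
  then have ne: "A \<noteq> {}" by auto
  have bb: "bdd_below A" unfolding A_def by (auto intro: bdd_belowI[of _ 0])
  have "Inf A \<ge> 0" using ne by (intro cInf_greatest) (auto simp: A_def)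
  have Inf0: "Inf A = 0"
  proof (rule ccontr)
    assume "Inf A \<noteq> 0"
    then have pos: "Inf A > 0" using \<open>Inf A \<ge> 0\<close> by auto
    define c where "c = Inf A"
    have c: "c > 0" using pos c_def by simp
    define r where "r = p / q"
    have r: "0 < r" "r < 1" using pq r_def by auto
    \<comment> \<open>With this \<open>d\<close> and the \<open>e\<close> below,
      \<open>r * d = e\<close> and \<open>r * (c + d) + e = c\<close>: the two errors use up exactly
      the gain \<open>c * (1 - r)\<close>.\<close>
    define d where "d = c * (1 - r) / (2 * r)"
    have "d > 0" using c r unfolding d_def by auto
    then obtain b where b: "b \<in> A" "b < c + d" using cInf_lessD[OF ne, of "c + d"] c_def by auto
    then obtain U where U: "open U" "S \<subseteq> U" "emeasure lborel U \<le> ennreal b" "b \<ge> 0" unfolding A_def by auto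
    define e where "e = c * (1 - r) / 2"
    have e: "e > 0" using c r unfolding e_def by auto
    obtain U' where U': "open U'" "S \<subseteq> U'" "emeasure lborel U' \<le> ennreal r * emeasure lborel U + ennreal e"
      using step[OF U(1,2) e] r_def by auto
    have "emeasure lborel U' \<le> ennreal r * ennreal b + ennreal e"
      using U'(3) U(3) by (meson add_mono mult_left_mono order.refl order.trans zero_le)
    also have "\<dots> = ennreal (r * b + e)" using r U(4) e by (simp add: ennreal_mult ennreal_plus)
    finally have "r * b + e \<in> A" using U' r U(4) e unfolding A_def by auto
    then have "c \<le> r * b + e" unfolding c_def by (rule cInf_lower[OF _ bb])
    also have "\<dots> < r * (c + d) + e" using b r by auto
    also have "r * d = e" using r by (auto simp: d_def e_def)
    then have "r * (c + d) + e = c" by (simp add: distrib_left) (simp add: e_def field_simps)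
    finally show False by simp
  qed
  show ?thesis unfolding negligible_outer_le
  proof (intro allI impI)
    fix e :: real assume e: "e > 0"
    obtain b where b: "b \<in> A" "b < e" using cInf_lessD[OF ne, of e] Inf0 e by auto
    then obtain U where U: "open U" "S \<subseteq> U" "emeasure lborel U \<le> ennreal b" "b \<ge> 0" unfolding A_def by auto
    have fin: "emeasure lborel U < \<infinity>" using U(3) by (simp add: order_le_less_trans)
    then have "U \<in> lmeasurable" using U(1) by (auto simp: fmeasurable_def)
    moreover have "measure lebesgue U \<le> e"
      using U(1) enn2real_leI[OF U(4,3)] b(2) by (simp add: measure_def)
    ultimately show "\<exists>T. S \<subseteq> T \<and> T \<in> lmeasurable \<and> measure lebesgue T \<le> e" using U(2) by auto
  qed
qed

text \<open>Outside the countable union of the null sets \<open>E p q k\<close> with rational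
  \<open>p < q\<close>, the upper and lower limits of the slopes of chords straddling
  \<open>x\<close> coincide, and continuity passes from straddling chords to chords ending at
  \<open>x\<close>. The lower bound on the slopes makes \<open>F\<close> monotone, as its Stieltjes
  measure requires, and keeps the limits positive.\<close>

lemma bilipschitz_real_differentiable_ae:
  fixes F :: "real \<Rightarrow> real"
  assumes lo: "\<And>x y. x \<le> y \<Longrightarrow> y - x \<le> F y - F x"
    and hi: "\<And>x y. x \<le> y \<Longrightarrow> F y - F x \<le> L * (y - x)"
  shows "negligible {x. \<not> F differentiable (at x)}"
proof -
  have mono: "mono F" by (rule monoI) (use lo in \<open>smt (verit)\<close>)
  have L1: "L \<ge> 1" using lo[of 0 1] hi[of 0 1] by auto
  have Lip: "\<bar>F y - F x\<bar> \<le> L * \<bar>y - x\<bar>" for x y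
    using hi[of x y] hi[of y x] lo[of x y] lo[of y x] by (cases "x \<le> y") auto
  have "L-lipschitz_on UNIV F"
    using Lip L1 by (intro lipschitz_onI) (auto simp: dist_real_def abs_minus_commute)
  then have cont: "continuous_on UNIV F" by (rule lipschitz_on_continuous_on)
  have isc: "isCont F x" for x using cont by (simp add: continuous_on_eq_continuous_at)
  define P where "P q x \<longleftrightarrow> (\<forall>d>0. \<exists>y z. y < x \<and> x < z \<and> z - y < d \<and> F z - F y > q * (z - y))" for q x
  define Q where "Q p x \<longleftrightarrow> (\<forall>d>0. \<exists>y z. y < x \<and> x < z \<and> z - y < d \<and> F z - F y < p * (z - y))" for p x
  define E where "E p q k = {x. \<bar>x\<bar> \<le> real k \<and> Q p x \<and> P q x}" for p q k
  have negE: "negligible (E p q k)" if "0 < p" "p < q" for p q k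
  proof (rule oscillating_slopes_negligible[OF mono cont that])
    show "bounded (E p q k)" by (auto simp: E_def bounded_iff intro: exI[of _ "real k"])
  qed (auto simp: E_def P_def Q_def)
  define B where "B = (\<Union>(p,q,k)\<in>{(p,q,k). p \<in> \<rat> \<and> q \<in> \<rat> \<and> 0 < p \<and> p < q}. E p q k)"
  have cnt: "countable {(p::real,q::real,k::nat). p \<in> \<rat> \<and> q \<in> \<rat> \<and> 0 < p \<and> p < q}"
    by (rule countable_subset[of _ "\<rat> \<times> \<rat> \<times> UNIV"]) (auto simp: countable_rat)
  have "negligible B" unfolding B_def
    by (rule negligible_countable_Union) (use cnt negE in auto)
  moreover have "F differentiable (at x)" if x: "x \<notin> B" for x
  proof -
    have noPQ: "\<not> (Q p x \<and> P q x)" if "p \<in> \<rat>" "q \<in> \<rat>" "0 < p" "p < q" for p q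
    proof
      assume "Q p x \<and> P q x"
      moreover obtain k :: nat where "\<bar>x\<bar> \<le> real k" using real_arch_simple by blast
      ultimately show False using x that unfolding B_def E_def by auto
    qed
    define A where "A = {q. P q x}"
    have P12: "1/2 \<in> A" unfolding A_def P_def
    proof (intro CollectI allI impI)
      fix d :: real assume "d > 0"
      then show "\<exists>y z. y < x \<and> x < z \<and> z - y < d \<and> 1 / 2 * (z - y) < F z - F y"
        using lo[of "x - d/4" "x + d/4"]
        by (intro exI[of _ "x - d/4"] exI[of _ "x + d/4"]) auto
    qed
    have ub: "q \<le> L" if "q \<in> A" for q
    proof -
      have "\<forall>d>0. \<exists>y z. y < x \<and> x < z \<and> z - y < d \<and> F z - F y > q * (z - y)"
        using that unfolding A_def P_def by simp
      from this[rule_format, of 1] obtain y z where "y < x" "x < z" "F z - F y > q * (z - y)"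
        by auto
      then have "q * (z - y) < L * (z - y)" "z - y > 0" using hi[of y z] by linarith+
      then show ?thesis by (auto dest: mult_right_less_imp_less)
    qed
    have bA: "bdd_above A" by (rule bdd_aboveI[OF ub])
    define s where "s = Sup A"
    have s12: "s \<ge> 1/2" unfolding s_def using P12 bA by (rule cSup_upper)
    have down: "q' \<in> A" if q: "q \<in> A" "q' \<le> q" for q q'
      unfolding A_def P_def
    proof (intro CollectI allI impI)
      fix d :: real assume "d > 0"
      then obtain y z where yz: "y < x" "x < z" "z - y < d" "F z - F y > q * (z - y)"
        using q(1) unfolding A_def P_def by blast
      have "q' * (z - y) \<le> q * (z - y)" using q(2) yz by (intro mult_right_mono) auto
      then have "q' * (z - y) < F z - F y" using yz(4) by linarith
      then show "\<exists>y z. y < x \<and> x < z \<and> z - y < d \<and> q' * (z - y) < F z - F y"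
        using yz by blast
    qed
    have straddle: "\<exists>d>0. \<forall>y z. y < x \<and> x < z \<and> z - y < d \<longrightarrow> (s - e) * (z - y) \<le> F z - F y \<and> F z - F y \<le> (s + e) * (z - y)"
      if e: "e > 0" for e
    proof -
      have "s + e \<notin> A" 
      proof
        assume "s + e \<in> A"
        from cSup_upper[OF this bA] show False using e unfolding s_def by simp
      qed
      then have "\<exists>d>0. \<forall>y z. \<not> (y < x \<and> x < z \<and> z - y < d \<and> F z - F y > (s + e) * (z - y))"
        unfolding A_def P_def by blast
      then obtain d1 where d1: "d1 > 0" "\<And>y z. y < x \<Longrightarrow> x < z \<Longrightarrow> z - y < d1 \<Longrightarrow> F z - F y \<le> (s + e) * (z - y)"
        by (metis linorder_not_less)
      \<comment> \<open>The bound \<open>1/4\<close> keeps \<open>p > s - e' \<ge> 1/4\<close>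
        positive, as \<open>noPQ\<close> requires.\<close>
      define e' where "e' = min e (1/4)"
      have e': "e' > 0" "e' \<le> e" "e' \<le> 1/4" using e by (auto simp: e'_def)
      obtain p where p: "p \<in> \<rat>" "s - e' < p" "p < s - e'/2" using Rats_dense_in_real[of "s - e'" "s - e'/2"] e' by auto
      obtain q where q: "q \<in> \<rat>" "p < q" "q < s - e'/4" using Rats_dense_in_real[of "p" "s - e'/4"] p e' by auto
      have "p > 0" using p e' s12 by auto
      have "q < Sup A" using q e' unfolding s_def by simp
      then obtain q0 where "q0 \<in> A" "q < q0" using less_cSupD[of A q] P12 by blast
      then have "P q x" using down[of q0 q] A_def by auto
      then have "\<not> Q p x" using noPQ[OF p(1) q(1) \<open>p > 0\<close> q(2)] by auto
      then have "\<exists>d>0. \<forall>y z. \<not> (y < x \<and> x < z \<and> z - y < d \<and> F z - F y < p * (z - y))"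
        unfolding Q_def by blast
      then obtain d2 where d2: "d2 > 0" "\<And>y z. y < x \<Longrightarrow> x < z \<Longrightarrow> z - y < d2 \<Longrightarrow> F z - F y \<ge> p * (z - y)"
        by (metis linorder_not_less)
      have "(s - e) * (z - y) \<le> F z - F y" if "y < x" "x < z" "z - y < d2" for y z
      proof -
        have "(s - e) * (z - y) \<le> p * (z - y)" using p e' that by (intro mult_right_mono) auto
        also have "\<dots> \<le> F z - F y" using d2(2) that by auto
        finally show ?thesis .
      qed
      then show ?thesis using d1 d2 by (intro exI[of _ "min d1 d2"]) auto
    qed
    \<comment> \<open>Letting one end of a straddling chord tend to \<open>x\<close> turns its slope
      into a one-sided difference quotient.\<close>
    have quot: "\<exists>d>0. \<forall>h. 0 < \<bar>h\<bar> \<and> \<bar>h\<bar> < d \<longrightarrow> \<bar>(F (x + h) - F x) / h - s\<bar> \<le> e" if e: "e > 0" for e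
    proof -
      obtain d where d: "d > 0" "\<And>y z. y < x \<Longrightarrow> x < z \<Longrightarrow> z - y < d \<Longrightarrow> (s - e) * (z - y) \<le> F z - F y \<and> F z - F y \<le> (s + e) * (z - y)"
        using straddle[OF e] by blast
      have pos: "(s - e) * h \<le> F (x + h) - F x \<and> F (x + h) - F x \<le> (s + e) * h" if h: "0 < h" "h < d" for h
      proof -
        have ev: "\<forall>\<^sub>F y in at_left x. y < x \<and> (x + h) - y < d"
          using h eventually_at_left_real[of "x + h - d" x] by (auto elim!: eventually_mono)
        have lim: "((\<lambda>y. F (x + h) - F y) \<longlongrightarrow> F (x + h) - F x) (at_left x)"
          by (intro tendsto_intros isCont_at_left isc)
        have lim2: "((\<lambda>y. c * (x + h - y)) \<longlongrightarrow> c * (x + h - x)) (at_left x)" for c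
          by (intro tendsto_intros)
        have "(s - e) * (x + h - x) \<le> F (x + h) - F x"
          by (rule tendsto_le[OF _ lim lim2]) (use ev d(2) h in \<open>auto elim!: eventually_mono\<close>)
        moreover have "F (x + h) - F x \<le> (s + e) * (x + h - x)"
          by (rule tendsto_le[OF _ lim2 lim]) (use ev d(2) h in \<open>auto elim!: eventually_mono\<close>)
        ultimately show ?thesis by simp
      qed
      have neg: "(s - e) * h \<le> F x - F (x - h) \<and> F x - F (x - h) \<le> (s + e) * h" if h: "0 < h" "h < d" for h
      proof -
        have ev: "\<forall>\<^sub>F z in at_right x. x < z \<and> z - (x - h) < d"
          using h eventually_at_right_real[of x "x - h + d"] by (auto elim!: eventually_mono)
        have lim: "((\<lambda>y. F y - F (x - h)) \<longlongrightarrow> F x - F (x - h)) (at_right x)"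
          by (intro tendsto_intros isCont_at_right isc)
        have lim2: "((\<lambda>y. c * (y - (x - h))) \<longlongrightarrow> c * (x - (x - h))) (at_right x)" for c
          by (intro tendsto_intros)
        have "(s - e) * (x - (x - h)) \<le> F x - F (x - h)"
          by (rule tendsto_le[OF _ lim lim2]) (use ev d(2) h in \<open>auto elim!: eventually_mono\<close>)
        moreover have "F x - F (x - h) \<le> (s + e) * (x - (x - h))"
          by (rule tendsto_le[OF _ lim2 lim]) (use ev d(2) h in \<open>auto elim!: eventually_mono\<close>)
        ultimately show ?thesis by simp
      qed
      show ?thesis
      proof (intro exI[of _ d] conjI allI impI d(1))
        fix h assume h: "0 < \<bar>h\<bar> \<and> \<bar>h\<bar> < d"
        show "\<bar>(F (x + h) - F x) / h - s\<bar> \<le> e"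
        proof (cases "h > 0")
          case True
          then have "(F (x + h) - F x) / h \<le> s + e" "s - e \<le> (F (x + h) - F x) / h"
            using pos[of h] h by (auto simp: field_simps)
          then show ?thesis by linarith
        next
          case False
          define k where "k = - h"
          have k: "k > 0" "k < d" using False h k_def by auto
          have "(F (x + h) - F x) / h = (F x - F (x - k)) / k" using k by (simp add: k_def field_simps)
          moreover have "(F x - F (x - k)) / k \<le> s + e" "s - e \<le> (F x - F (x - k)) / k"
            using neg[of k] k by (auto simp: field_simps)
          ultimately show ?thesis by linarith
        qed
      qed
    qed
    have "(F has_real_derivative s) (at x)"
      unfolding DERIV_def LIM_eq
    proof (intro allI impI)
      fix r :: real assume "0 < r"
      then obtain d where "d > 0" "\<forall>h. 0 < \<bar>h\<bar> \<and> \<bar>h\<bar> < d \<longrightarrow> \<bar>(F (x + h) - F x) / h - s\<bar> \<le> r/2"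
        using quot[of "r/2"] by auto
      then show "\<exists>sa>0. \<forall>xa. xa \<noteq> 0 \<and> norm (xa - 0) < sa \<longrightarrow> norm ((F (x + xa) - F x) / xa - s) < r"
        using \<open>0 < r\<close> by (intro exI[of _ d]) (auto intro: le_less_trans)
    qed
    then show ?thesis unfolding real_differentiable_def by blast
  qed
  ultimately show ?thesis by (auto intro: negligible_subset)
qed

text \<open>The linear term \<open>(L + 1) * x\<close> moves slopes from \<open>[-L, L]\<close> to
  \<open>[1, 2 * L + 1]\<close> and leaves differentiability unchanged.\<close>

lemma lipschitz_real_differentiable_ae:
  fixes F :: "real \<Rightarrow> real"
  assumes "L-lipschitz_on UNIV F"
  shows "negligible {x. \<not> F differentiable (at x)}"
proof -
  have Lip: "\<bar>F y - F x\<bar> \<le> L * \<bar>y - x\<bar>" for x y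
    using lipschitz_onD[OF assms, of y x] by (simp add: dist_real_def)
  define G where "G x = F x + (L + 1) * x" for x
  have "negligible {x. \<not> G differentiable (at x)}"
  proof (rule bilipschitz_real_differentiable_ae[of _ "2 * L + 1"])
    fix x y :: real assume "x \<le> y"
    then show "y - x \<le> G y - G x" "G y - G x \<le> (2 * L + 1) * (y - x)"
      using Lip[of y x] by (auto simp: G_def algebra_simps)
  qed
  moreover have "F differentiable (at x)" if "G differentiable (at x)" for x
  proof -
    have "(\<lambda>x. G x - (L + 1) * x) differentiable (at x)"
      using that by (intro derivative_intros) auto
    then show ?thesis by (simp add: G_def)
  qed
  ultimately show ?thesis by (auto intro: negligible_subset)
qed

lemma lipschitz_on_real_differentiable_ae:
  fixes f :: "real \<Rightarrow> real"
  assumes "L-lipschitz_on {a..b} f"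
  shows "negligible {x \<in> {a<..<b}. \<not> f differentiable (at x)}"
proof (cases "a < b")
  case True
  define F where "F x = f (max a (min b x))" for x
  have "L-lipschitz_on UNIV F"
  proof (rule lipschitz_onI)
    fix x y :: real
    have "dist (F x) (F y) \<le> L * dist (max a (min b x)) (max a (min b y))"
      unfolding F_def using True by (intro lipschitz_onD[OF assms]) auto
    also have "\<dots> \<le> L * dist x y"
      using lipschitz_on_nonneg[OF assms] by (intro mult_left_mono) (auto simp: dist_real_def max_def min_def)
    finally show "dist (F x) (F y) \<le> L * dist x y" .
  qed (use lipschitz_on_nonneg[OF assms] in auto)
  then have "negligible {x. \<not> F differentiable (at x)}" by (rule lipschitz_real_differentiable_ae)
  moreover have "f differentiable (at x)" if x: "F differentiable (at x)" "x \<in> {a<..<b}" for x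
  proof -
    obtain D where D: "(F has_real_derivative D) (at x)"
      using x(1) by (rule real_differentiableE)
    have "(f has_real_derivative D) (at x)"
      by (rule has_field_derivative_transform_within_open[OF D, of "{a<..<b}"]) (use x in \<open>auto simp: F_def\<close>)
    then show ?thesis unfolding real_differentiable_def by blast
  qed
  ultimately show ?thesis by (auto intro: negligible_subset)
qed auto

text \<open>If \<open>G a > G b\<close>, then \<open>F\<close>, which is \<open>G\<close> plus a
  small linear term, still falls from \<open>a\<close> to \<open>b\<close>. The pointwise Lipschitz
  bounds make the image of \<open>N\<close> under \<open>F\<close> null, so some value
  \<open>c\<close> between \<open>F b\<close> and \<open>F a\<close> is not attained on
  \<open>N\<close>. At the last point where \<open>F = c\<close> the derivative of \<open>F\<close>
  exists and is positive, although \<open>F < c\<close> afterwards.\<close>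

lemma nondecreasing_if_ae_deriv_nonneg:
  fixes G :: "real \<Rightarrow> real"
  assumes ab: "a \<le> b" and cont: "continuous_on {a..b} G" and N: "negligible N"
    and lip: "\<And>x. x \<in> {a<..<b} \<Longrightarrow> \<exists>d>0. \<exists>B. \<forall>y. \<bar>y - x\<bar> < d \<longrightarrow> \<bar>G y - G x\<bar> \<le> B * \<bar>y - x\<bar>"
    and der: "\<And>x. x \<in> {a<..<b} - N \<Longrightarrow> \<exists>D\<ge>0. (G has_real_derivative D) (at x)"
  shows "G a \<le> G b"
proof (rule ccontr)
  assume neg: "\<not> G a \<le> G b"
  then have ab': "a < b" using ab by (cases "a = b") auto
  define e where "e = (G a - G b) / (2 * (b - a))"
  have e: "e > 0" using neg ab' by (auto simp: e_def)
  define F where "F x = G x + e * x" for x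
  have "F b < F a"
  proof -
    have "e * (b - a) = (G a - G b) / 2" using ab' by (simp add: e_def field_simps)
    then show ?thesis using neg by (simp add: F_def algebra_simps)
  qed
  have contF: "continuous_on {a..b} F" unfolding F_def by (intro continuous_intros cont)
  have "negligible (F ` (N \<inter> {a<..<b}))"
  proof (rule negligible_locally_Lipschitz_image)
    fix x assume x: "x \<in> N \<inter> {a<..<b}"
    then obtain d B where d: "d > 0" "\<And>y. \<bar>y - x\<bar> < d \<Longrightarrow> \<bar>G y - G x\<bar> \<le> B * \<bar>y - x\<bar>" using lip by blast
    have "\<bar>F y - F x\<bar> \<le> (B + e) * \<bar>y - x\<bar>" if "\<bar>y - x\<bar> < d" for y
    proof -
      have "F y - F x = (G y - G x) + e * (y - x)" by (simp add: F_def algebra_simps)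
      then have "\<bar>F y - F x\<bar> \<le> \<bar>G y - G x\<bar> + e * \<bar>y - x\<bar>" using e by (metis abs_mult abs_of_pos abs_triangle_ineq)
      then show ?thesis using d(2)[OF that] by (simp add: algebra_simps)
    qed
    then show "\<exists>T B. open T \<and> x \<in> T \<and> (\<forall>y\<in>N \<inter> {a<..<b} \<inter> T. norm (F y - F x) \<le> B * norm (y - x))"
      using d(1) by (intro exI[of _ "ball x d"] exI[of _ "B + e"]) (auto simp: dist_real_def abs_minus_commute)
  qed (use N in \<open>auto intro: negligible_subset\<close>)
  moreover have "\<not> negligible {F b<..<F a}"
    using \<open>F b < F a\<close> open_not_negligible[of "{F b<..<F a}"] by auto
  ultimately obtain c where c: "F b < c" "c < F a" "c \<notin> F ` (N \<inter> {a<..<b})"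
    by (meson greaterThanLessThan_iff negligible_subset subsetI)
  have "continuous_on {a..b} (\<lambda>x. - F x)" by (intro continuous_intros contF)
  from last_crossing[OF ab this, of "- c"] c
  obtain x where "a \<le> x" and xb: "x < b" and Fx: "F x = c" and lt: "\<And>y. x < y \<Longrightarrow> y \<le> b \<Longrightarrow> F y < c"
    by (auto simp: less_imp_le)
  have xa: "a < x" using c Fx \<open>a \<le> x\<close> by (cases "a = x") auto
  have "x \<notin> N" using c(3) Fx xa xb by auto
  then obtain D where D: "D \<ge> 0" "(G has_real_derivative D) (at x)" using der[of x] xa xb by auto
  have "(F has_real_derivative D + e) (at x)" unfolding F_def by (auto intro!: derivative_eq_intros D(2))
  then have "\<exists>d>0. \<forall>h>0. h < d \<longrightarrow> F x < F (x + h)"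
    by (rule DERIV_pos_inc_right) (use D(1) e in linarith)
  then obtain d where d: "d > 0" "\<forall>h>0. h < d \<longrightarrow> F x < F (x + h)" by blast
  define h where "h = min (d/2) (b - x)"
  have "h > 0" "h < d" "x + h \<le> b" using d(1) xb by (auto simp: h_def)
  then show False using d(2)[rule_format, of h] lt[of "x + h"] Fx by auto
qed

text \<open>Only differences with the centre \<open>x\<close> are bounded, so that a derivative at
  \<open>x\<close> suffices. This is the form in which the monotonicity criterion above asks for its
  bound.\<close>

definition lipschitz_at :: "(real \<Rightarrow> real) \<Rightarrow> real \<Rightarrow> bool" where
  "lipschitz_at G x \<longleftrightarrow> (\<exists>d>0. \<exists>B. \<forall>y. \<bar>y - x\<bar> < d \<longrightarrow> \<bar>G y - G x\<bar> \<le> B * \<bar>y - x\<bar>)"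

lemma lipschitz_atI_deriv:
  assumes "(G has_real_derivative D) (at x)"
  shows "lipschitz_at G x"
proof -
  have "((\<lambda>h. (G (x + h) - G x) / h) \<longlongrightarrow> D) (at 0)" using assms by (simp add: DERIV_def)
  then have "\<forall>r>0. \<exists>s>0. \<forall>h. h \<noteq> 0 \<and> norm (h - 0) < s \<longrightarrow> norm ((G (x + h) - G x) / h - D) < r"
    unfolding LIM_eq .
  from this[rule_format, of 1] obtain d where d: "d > 0"
    "\<And>h. h \<noteq> 0 \<Longrightarrow> \<bar>h\<bar> < d \<Longrightarrow> \<bar>(G (x + h) - G x) / h - D\<bar> < 1" by auto
  have "\<bar>G y - G x\<bar> \<le> (\<bar>D\<bar> + 1) * \<bar>y - x\<bar>" if "\<bar>y - x\<bar> < d" for y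
  proof (cases "y = x")
    case False
    then have "\<bar>(G y - G x) / (y - x) - D\<bar> < 1" using d(2)[of "y - x"] that by simp
    then have "\<bar>(G y - G x) / (y - x)\<bar> \<le> \<bar>D\<bar> + 1" by linarith
    then show ?thesis using False by (simp add: abs_divide pos_divide_le_eq)
  qed auto
  then show ?thesis using d(1) unfolding lipschitz_at_def by blast
qed

lemma lipschitz_at_add:
  assumes "lipschitz_at F x" "lipschitz_at G x"
  shows "lipschitz_at (\<lambda>u. F u + G u) x"
proof -
  obtain d B where 1: "d > 0" "\<And>y. \<bar>y - x\<bar> < d \<Longrightarrow> \<bar>F y - F x\<bar> \<le> B * \<bar>y - x\<bar>"
    using assms(1) unfolding lipschitz_at_def by blast
  obtain e C where 2: "e > 0" "\<And>y. \<bar>y - x\<bar> < e \<Longrightarrow> \<bar>G y - G x\<bar> \<le> C * \<bar>y - x\<bar>"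
    using assms(2) unfolding lipschitz_at_def by blast
  have "\<bar>(F y + G y) - (F x + G x)\<bar> \<le> (B + C) * \<bar>y - x\<bar>" if "\<bar>y - x\<bar> < min d e" for y
    using 1(2)[of y] 2(2)[of y] that by (simp add: distrib_right)
  then show ?thesis using 1(1) 2(1) unfolding lipschitz_at_def
    by (intro exI[of _ "min d e"] conjI exI[of _ "B + C"]) auto
qed

lemma lipschitz_at_cmult:
  assumes "lipschitz_at F x"
  shows "lipschitz_at (\<lambda>u. c * F u) x"
proof -
  obtain d B where 1: "d > 0" "\<And>y. \<bar>y - x\<bar> < d \<Longrightarrow> \<bar>F y - F x\<bar> \<le> B * \<bar>y - x\<bar>"
    using assms(1) unfolding lipschitz_at_def by blast
  have "\<bar>c * F y - c * F x\<bar> \<le> (\<bar>c\<bar> * B) * \<bar>y - x\<bar>" if "\<bar>y - x\<bar> < d" for y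
  proof -
    have "\<bar>c * F y - c * F x\<bar> = \<bar>c\<bar> * \<bar>F y - F x\<bar>" by (simp add: abs_mult[symmetric] right_diff_distrib)
    also have "\<dots> \<le> \<bar>c\<bar> * (B * \<bar>y - x\<bar>)" using 1(2)[OF that] by (intro mult_left_mono) auto
    finally show ?thesis by (simp add: mult.assoc)
  qed
  then show ?thesis using 1(1) unfolding lipschitz_at_def by blast
qed

lemma lipschitz_at_compose:
  assumes "lipschitz_at F x" "lipschitz_at G (F x)"
  shows "lipschitz_at (\<lambda>u. G (F u)) x"
proof -
  obtain d B where 1: "d > 0" "\<And>y. \<bar>y - x\<bar> < d \<Longrightarrow> \<bar>F y - F x\<bar> \<le> B * \<bar>y - x\<bar>"
    using assms(1) unfolding lipschitz_at_def by blast
  obtain e C where 2: "e > 0" "\<And>y. \<bar>y - F x\<bar> < e \<Longrightarrow> \<bar>G y - G (F x)\<bar> \<le> C * \<bar>y - F x\<bar>"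
    using assms(2) unfolding lipschitz_at_def by blast
  define r where "r = min d (e / (\<bar>B\<bar> + 1))"
  have r: "r > 0" using 1(1) 2(1) by (simp add: r_def)
  have "\<bar>G (F y) - G (F x)\<bar> \<le> (\<bar>C\<bar> * \<bar>B\<bar>) * \<bar>y - x\<bar>" if y: "\<bar>y - x\<bar> < r" for y
  proof -
    have "\<bar>F y - F x\<bar> \<le> B * \<bar>y - x\<bar>" using 1(2) y by (simp add: r_def)
    also have "\<dots> \<le> \<bar>B\<bar> * \<bar>y - x\<bar>" by (intro mult_right_mono) auto
    finally have F: "\<bar>F y - F x\<bar> \<le> \<bar>B\<bar> * \<bar>y - x\<bar>" .
    also have "\<dots> \<le> (\<bar>B\<bar> + 1) * \<bar>y - x\<bar>" by (intro mult_right_mono) auto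
    also have "\<dots> < (\<bar>B\<bar> + 1) * (e / (\<bar>B\<bar> + 1))" using y by (intro mult_strict_left_mono) (auto simp: r_def)
    also have "\<dots> = e" by simp
    finally have "\<bar>G (F y) - G (F x)\<bar> \<le> C * \<bar>F y - F x\<bar>" by (rule 2(2))
    also have "\<dots> \<le> \<bar>C\<bar> * \<bar>F y - F x\<bar>" by (intro mult_right_mono) auto
    also have "\<dots> \<le> \<bar>C\<bar> * (\<bar>B\<bar> * \<bar>y - x\<bar>)" using F by (intro mult_left_mono) auto
    finally show ?thesis by (simp add: mult.assoc)
  qed
  then show ?thesis using r unfolding lipschitz_at_def by blast
qed

section \<open>The nonlinearity\<close>

locale nonlinearity =
  fixes f :: "real \<Rightarrow> real" and u0 :: real
  assumes u0: "u0 > 0" and f_pos: "\<And>u. u > u0 \<Longrightarrow> f u > 0"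
    and f_lip: "locally_lipschitz_on {u0..} f"
begin

lemma f_lipschitz_cball:
  assumes "x > u0"
  obtains e L where "e > 0" "cball x e \<subseteq> {u0<..}" "L-lipschitz_on (cball x e) f"
proof -
  obtain e L where e: "e > 0" "L-lipschitz_on (cball x e \<inter> {u0..}) f"
    using f_lip assms unfolding locally_lipschitz_on_def by (metis atLeast_iff less_imp_le)
  define e' where "e' = min e ((x - u0) / 2)"
  have "e' > 0" using e(1) assms by (simp add: e'_def)
  moreover have sub: "cball x e' \<subseteq> {u0<..}"
  proof
    fix y assume "y \<in> cball x e'"
    then have "\<bar>x - y\<bar> \<le> (x - u0) / 2" by (simp add: e'_def dist_real_def)
    then have "x - y \<le> (x - u0) / 2" by linarith
    moreover have "(x - u0) / 2 < x - u0" using assms by simp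
    ultimately show "y \<in> {u0<..}" by simp
  qed
  moreover have "L-lipschitz_on (cball x e') f"
    by (rule lipschitz_on_subset[OF e(2)]) (use sub in \<open>auto simp: e'_def less_imp_le\<close>)
  ultimately show thesis using that by blast
qed

lemma lipschitz_at_f:
  assumes "x > u0"
  shows "lipschitz_at f x"
proof -
  obtain e L where e: "e > 0" "L-lipschitz_on (cball x e) f"
    using f_lipschitz_cball[OF assms] by metis
  have "\<bar>f y - f x\<bar> \<le> L * \<bar>y - x\<bar>" if "\<bar>y - x\<bar> < e" for y
    using lipschitz_onD[OF e(2), of y x] that e(1) by (auto simp: dist_real_def abs_minus_commute)
  then show ?thesis using e(1) unfolding lipschitz_at_def by blast
qed

text \<open>Every point above \<open>u0\<close> lies inside an interval with rational end points on
  which \<open>f\<close> is Lipschitz, and there are countably many of these.\<close>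

lemma f_not_differentiable_negligible: "negligible {x. x > u0 \<and> \<not> f differentiable (at x)}"
proof -
  define I where "I = {(p::real, q::real). p \<in> \<rat> \<and> q \<in> \<rat> \<and> (\<exists>L. L-lipschitz_on {p..q} f)}"
  have "countable I" by (rule countable_subset[of _ "\<rat> \<times> \<rat>"]) (auto simp: countable_rat I_def)
  then have "negligible (\<Union>i\<in>I. {x \<in> {fst i<..<snd i}. \<not> f differentiable (at x)})"
  proof (rule negligible_countable_Union[OF countable_image], safe)
    fix p q assume "(p, q) \<in> I"
    then obtain L where "L-lipschitz_on {p..q} f" unfolding I_def by auto
    then show "negligible {x \<in> {fst (p, q)<..<snd (p, q)}. \<not> f differentiable (at x)}"
      unfolding fst_conv snd_conv by (rule lipschitz_on_real_differentiable_ae)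
  qed
  then show ?thesis
  proof (rule negligible_subset, clarsimp)
    fix x assume x: "u0 < x" "\<not> f differentiable (at x)"
    obtain e L where e: "e > 0" "L-lipschitz_on (cball x e) f"
      using f_lipschitz_cball[OF x(1)] by metis
    obtain p where p: "p \<in> \<rat>" "x - e < p" "p < x" using Rats_dense_in_real[of "x - e" x] e by auto
    obtain q where q: "q \<in> \<rat>" "x < q" "q < x + e" using Rats_dense_in_real[of x "x + e"] e by auto
    have "L-lipschitz_on {p..q} f"
      by (rule lipschitz_on_subset[OF e(2)]) (use p q in \<open>auto simp: dist_real_def\<close>)
    then have "(p, q) \<in> I" using p q by (auto simp: I_def)
    then show "\<exists>i\<in>I. fst i < x \<and> x < snd i" using p q by (intro bexI[of _ "(p, q)"]) auto
  qed
qed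

text \<open>Where it exists, the derivative of \<open>ln f - k * ln (u - \<gamma>)\<close> has the
  sign of \<open>f' * (u - \<gamma>) - k * f\<close>. The factor \<open>s\<close> is
  \<open>1\<close> or \<open>-1\<close> in use, which covers both directions of monotonicity;
  \<open>\<gamma> = u0\<close> and \<open>\<gamma> = 0\<close> serve the two hypotheses on
  \<open>f'\<close>.\<close>

lemma ln_ratio_mono:
  assumes ab: "u0 < a" "a \<le> b" and \<gamma>: "\<gamma> \<le> u0"
    and le: "\<And>u. a < u \<Longrightarrow> u < b \<Longrightarrow> f differentiable (at u) \<Longrightarrow> s * (k * f u) \<le> s * (deriv f u * (u - \<gamma>))"
  shows "s * (ln (f a) - k * ln (a - \<gamma>)) \<le> s * (ln (f b) - k * ln (b - \<gamma>))"
proof -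
  define G where "G u = s * ln (f u) + (- s * k) * ln (u - \<gamma>)" for u
  have lipG: "lipschitz_at G u" if u: "u > u0" for u
    unfolding G_def
  proof (intro lipschitz_at_add lipschitz_at_cmult)
    show "lipschitz_at (\<lambda>u. ln (f u)) u"
      by (rule lipschitz_at_compose[OF lipschitz_at_f[OF u] lipschitz_atI_deriv[OF DERIV_ln]]) (rule f_pos[OF u])
    show "lipschitz_at (\<lambda>u. ln (u - \<gamma>)) u"
      by (rule lipschitz_atI_deriv) (use u \<gamma> in \<open>auto intro!: derivative_eq_intros\<close>)
  qed
  have "isCont f u" if u: "u > u0" for u
  proof -
    obtain e L where e: "e > 0" "L-lipschitz_on (cball u e) f"
      using f_lipschitz_cball[OF u] by metis
    then have "continuous_on (ball u e) f"
      using lipschitz_on_continuous_on continuous_on_subset ball_subset_cball by metis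
    then show ?thesis using e(1) continuous_on_eq_continuous_at[of "ball u e" f] by simp
  qed
  then have cf: "continuous_on {a..b} f" using ab(1) by (auto intro!: continuous_at_imp_continuous_on)
  have "G a \<le> G b"
  proof (rule nondecreasing_if_ae_deriv_nonneg[OF ab(2) _ f_not_differentiable_negligible])
    show "continuous_on {a..b} G" unfolding G_def
      using ab \<gamma> f_pos by (intro continuous_intros cf) (auto simp: less_imp_neq[symmetric])
    fix x assume x: "x \<in> {a<..<b}"
    show "\<exists>d>0. \<exists>B. \<forall>y. \<bar>y - x\<bar> < d \<longrightarrow> \<bar>G y - G x\<bar> \<le> B * \<bar>y - x\<bar>"
      using lipG[of x] x ab unfolding lipschitz_at_def by auto
  next
    fix x assume x: "x \<in> {a<..<b} - {x. x > u0 \<and> \<not> f differentiable (at x)}"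
    then have d: "f differentiable (at x)" and xu: "x > u0" using ab by auto
    have fx: "f x > 0" using f_pos xu by auto
    have D: "(f has_real_derivative deriv f x) (at x)"
      using d DERIV_deriv_iff_real_differentiable by blast
    have "(G has_real_derivative (s * (deriv f x / f x) + (- s * k) * (1 / (x - \<gamma>)))) (at x)"
      unfolding G_def using fx xu \<gamma> by (auto intro!: derivative_eq_intros D simp: divide_inverse)
    moreover have "s * (deriv f x / f x) + (- s * k) * (1 / (x - \<gamma>))
        = (s * (deriv f x * (x - \<gamma>)) - s * (k * f x)) / (f x * (x - \<gamma>))"
      using fx xu \<gamma> by (simp add: field_simps)
    moreover have "\<dots> \<ge> 0" using le[of x] x d fx xu \<gamma> by (intro divide_nonneg_pos mult_pos_pos) auto
    ultimately show "\<exists>D\<ge>0. (G has_real_derivative D) (at x)" by metis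
  qed
  then show ?thesis by (simp add: G_def algebra_simps)
qed

lemma f_differentiable_dense:
  assumes "u0 \<le> a" "a < b"
  obtains x where "a < x" "x < b" "f differentiable (at x)"
proof -
  have "\<not> negligible {a<..<b}"
    using assms open_not_negligible[of "{a<..<b}"] by auto
  then have "\<not> {a<..<b} \<subseteq> {x. x > u0 \<and> \<not> f differentiable (at x)}"
    using f_not_differentiable_negligible negligible_subset by blast
  then show thesis using that assms by auto
qed

text \<open>The number \<open>k\<close>, the infimum of the elasticities \<open>u f' / f\<close> at
  differentiability points of \<open>(a, b)\<close>, bounds from above all elasticities beyond
  \<open>c\<close>. So \<open>f(u) / u^k\<close> is nondecreasing on \<open>[a, b]\<close> and
  nonincreasing on \<open>[c, d]\<close>, which puts \<open>k\<close> between the two chord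
  slopes.\<close>

lemma ln_f_chord:
  assumes anti: "\<And>u w. u0 < u \<Longrightarrow> u \<le> w \<Longrightarrow> f differentiable (at u) \<Longrightarrow> f differentiable (at w) \<Longrightarrow>
      w * deriv f w / f w \<le> u * deriv f u / f u"
    and "u0 < a" "a < b" "b \<le> c" "c < d"
  shows "(ln (f d) - ln (f c)) / (ln d - ln c) \<le> (ln (f b) - ln (f a)) / (ln b - ln a)"
proof -
  define S where "S = {u * deriv f u / f u |u. a < u \<and> u < b \<and> f differentiable (at u)}"
  define k where "k = Inf S"
  obtain x where "a < x" "x < b" "f differentiable (at x)" using f_differentiable_dense[of a b] assms by force
  then have ne: "S \<noteq> {}" unfolding S_def by auto
  obtain w where "c < w" "w < d" "f differentiable (at w)" using f_differentiable_dense[of c d] assms by force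
  have low: "v * deriv f v / f v \<le> s" if "s \<in> S" "c < v" "f differentiable (at v)" for s v
    using anti that assms unfolding S_def by force
  have bb: "bdd_below S" using low[of _ w] \<open>c < w\<close> \<open>f differentiable (at w)\<close> by (intro bdd_belowI) auto
  have up: "k * f u \<le> deriv f u * (u - 0)" if "a < u" "u < b" "f differentiable (at u)" for u
  proof -
    have "k \<le> u * deriv f u / f u" unfolding k_def by (rule cInf_lower[OF _ bb]) (use that in \<open>auto simp: S_def\<close>)
    then show ?thesis using f_pos[of u] that assms by (simp add: field_simps)
  qed
  have dn: "k * f v \<ge> deriv f v * (v - 0)" if "c < v" "v < d" "f differentiable (at v)" for v
  proof -
    have "k \<ge> v * deriv f v / f v" unfolding k_def by (rule cInf_greatest[OF ne]) (use that low in auto)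
    then show ?thesis using f_pos[of v] that assms by (simp add: field_simps)
  qed
  have "ln (f a) - k * ln a \<le> ln (f b) - k * ln b"
    using ln_ratio_mono[of a b 0 1 k] up assms u0 by auto
  moreover have "ln b - ln a > 0" using assms u0 by auto
  ultimately have 1: "k \<le> (ln (f b) - ln (f a)) / (ln b - ln a)" by (simp add: field_simps)
  have "ln (f c) - k * ln c \<ge> ln (f d) - k * ln d"
    using ln_ratio_mono[of c d 0 "-1" k] dn assms u0 by auto
  moreover have "ln d - ln c > 0" using assms u0 by auto
  ultimately have "(ln (f d) - ln (f c)) / (ln d - ln c) \<le> k" by (simp add: field_simps)
  with 1 show ?thesis by linarith
qed

end

section \<open>Differential inequalities\<close>

text \<open>Made for a \<open>\<psi>\<close> without derivatives: a function \<open>M\<close> with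
  nonnegative derivative at \<open>x\<close> whose increments stay below those of
  \<open>\<psi>\<close> to the right is enough. After the last return of the tilted
  \<open>\<psi>\<close> to its initial value, \<open>M\<close> would force a further
  increase.\<close>

lemma right_minorant_mono:
  fixes \<psi> :: "real \<Rightarrow> real"
  assumes ab: "a \<le> b" and cont: "continuous_on {a..b} \<psi>"
    and minor: "\<And>x. a \<le> x \<Longrightarrow> x < b \<Longrightarrow> \<exists>M k. (M has_real_derivative k) (at x) \<and> k \<ge> 0 \<and>
      (\<forall>\<^sub>F y in at_right x. M y - M x \<le> \<psi> y - \<psi> x)"
  shows "\<psi> a \<le> \<psi> b"
proof (rule ccontr)
  assume neg: "\<not> \<psi> a \<le> \<psi> b"
  then have ab': "a < b" using ab by (cases "a = b") auto
  define e where "e = (\<psi> a - \<psi> b) / (2 * (b - a))"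
  have e: "e > 0" using neg ab' by (auto simp: e_def)
  define F where "F x = \<psi> x + e * x" for x
  have Fab: "F b < F a"
  proof -
    have "e * (b - a) = (\<psi> a - \<psi> b) / 2" using ab' by (simp add: e_def field_simps)
    then show ?thesis using neg by (simp add: F_def algebra_simps)
  qed
  have contF: "continuous_on {a..b} F" unfolding F_def by (intro continuous_intros cont)
  have "continuous_on {a..b} (\<lambda>x. - F x)" by (intro continuous_intros contF)
  from last_crossing[OF ab this, of "- F a"] Fab
  obtain x where x: "a \<le> x" "x < b" "F x = F a" and lt: "\<And>y. x < y \<Longrightarrow> y \<le> b \<Longrightarrow> F y < F a" by auto
  obtain M k where M: "(M has_real_derivative k) (at x)" "k \<ge> 0" "\<forall>\<^sub>F y in at_right x. M y - M x \<le> \<psi> y - \<psi> x"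
    using minor[OF x(1,2)] by blast
  have "((\<lambda>y. M y + e * y) has_real_derivative k + e) (at x)" by (auto intro!: derivative_eq_intros M(1))
  from DERIV_pos_inc_right[OF this] obtain d where
    d: "d > 0" "\<forall>h>0. h < d \<longrightarrow> M x + e * x < M (x + h) + e * (x + h)" using M(2) e by auto
  have "\<forall>\<^sub>F y in at_right x. y < x + d \<and> y < b \<and> x < y"
    using eventually_at_right_real[of x "min (x + d) b"] x(2) d(1) by (auto elim!: eventually_mono)
  with M(3) have "\<forall>\<^sub>F y in at_right x. M y - M x \<le> \<psi> y - \<psi> x \<and> y < x + d \<and> y < b \<and> x < y"
    by (rule eventually_conj)
  then obtain y where y: "M y - M x \<le> \<psi> y - \<psi> x" "y < x + d" "y < b" "x < y"
    using eventually_happens[of _ "at_right x"] by (auto simp: trivial_limit_at_right_real)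
  have "M x + e * x < M y + e * y" using d(2)[rule_format, of "y - x"] y by simp
  then have "F x < F y" using y(1) by (simp add: F_def)
  moreover have "F y < F a" using lt y by simp
  ultimately show False using x(3) by simp
qed

text \<open>The weight \<open>exp (- C * x)\<close> reduces the claim to the preceding criterion on
  intervals where \<open>\<phi> < 0\<close>. If \<open>\<phi> b < 0\<close>, then
  \<open>\<phi>\<close> is negative on all of \<open>[a, b]\<close>, since the weighted function
  cannot fall to a negative value after a last zero. The number \<open>\<epsilon>\<close> admits a
  start that is only approximately nonnegative.\<close>

lemma right_minorant_gronwall:
  fixes \<phi> :: "real \<Rightarrow> real"
  assumes ab: "a \<le> b" and cont: "continuous_on {a..b} \<phi>" and eps: "\<phi> a \<ge> - \<epsilon>" "\<epsilon> \<ge> 0"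
    and minor: "\<And>x. a \<le> x \<Longrightarrow> x < b \<Longrightarrow> \<phi> x < 0 \<Longrightarrow> \<exists>M k. (M has_real_derivative k) (at x) \<and> k \<ge> C * \<phi> x \<and>
      (\<forall>\<^sub>F y in at_right x. M y - M x \<le> \<phi> y - \<phi> x)"
  shows "\<phi> b \<ge> - \<epsilon> * exp (C * (b - a))"
proof (cases "\<phi> b \<ge> 0")
  case True
  moreover have "0 \<le> \<epsilon> * exp (C * (b - a))" using eps(2) by simp
  ultimately show ?thesis by linarith
next
  case False
  define \<psi> where "\<psi> x = exp (- C * x) * \<phi> x" for x
  have cont\<psi>: "continuous_on {a..b} \<psi>" unfolding \<psi>_def by (intro continuous_intros cont)
  have mono: "\<psi> c \<le> \<psi> b" if c: "a \<le> c" "c \<le> b" and neg: "\<And>x. c \<le> x \<Longrightarrow> x \<le> b \<Longrightarrow> \<phi> x < 0" for c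
  proof (rule right_minorant_mono[OF c(2)])
    show "continuous_on {c..b} \<psi>" by (rule continuous_on_subset[OF cont\<psi>]) (use c in auto)
    fix x assume x: "c \<le> x" "x < b"
    obtain M k where M: "(M has_real_derivative k) (at x)" "k \<ge> C * \<phi> x" "\<forall>\<^sub>F y in at_right x. M y - M x \<le> \<phi> y - \<phi> x"
      using minor[of x] x c neg[of x] by auto
    define N where "N y = exp (- C * y) * (\<phi> x + M y - M x)" for y
    have "(N has_real_derivative exp (- C * x) * (k - C * \<phi> x)) (at x)"
      unfolding N_def by (auto intro!: derivative_eq_intros M(1) simp: algebra_simps)
    moreover have "\<forall>\<^sub>F y in at_right x. N y - N x \<le> \<psi> y - \<psi> x"
      using M(3)
    proof (rule eventually_mono)
      fix y assume "M y - M x \<le> \<phi> y - \<phi> x"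
      then have "exp (- C * y) * (\<phi> x + M y - M x) \<le> exp (- C * y) * \<phi> y"
        by (intro mult_left_mono) auto
      then show "N y - N x \<le> \<psi> y - \<psi> x" by (simp add: N_def \<psi>_def)
    qed
    moreover have "exp (- C * x) * (k - C * \<phi> x) \<ge> 0" using M(2) by simp
    ultimately show "\<exists>M k. (M has_real_derivative k) (at x) \<and> 0 \<le> k \<and> (\<forall>\<^sub>F y in at_right x. M y - M x \<le> \<psi> y - \<psi> x)"
      by blast
  qed
  have "\<psi> b < 0" using False by (simp add: \<psi>_def mult_less_0_iff)
  have neg: "\<phi> x0 < 0" if x0: "a \<le> x0" "x0 \<le> b" for x0
  proof (rule ccontr)
    assume "\<not> \<phi> x0 < 0"
    moreover have cont0: "continuous_on {x0..b} (\<lambda>x. - \<phi> x)"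
      by (intro continuous_intros continuous_on_subset[OF cont]) (use x0 in auto)
    ultimately obtain x where x: "x0 \<le> x" "x < b" "\<phi> x = 0" "\<And>y. x < y \<Longrightarrow> y \<le> b \<Longrightarrow> \<phi> y < 0"
      using last_crossing[OF x0(2) cont0, of 0] False by auto
    have "\<psi> c \<le> \<psi> b" if "x < c" "c \<le> b" for c
      by (rule mono) (use that x x0 in auto)
    then have ev: "\<forall>\<^sub>F c in at_right x. \<psi> c \<le> \<psi> b"
      using eventually_at_right_real[OF x(2)] by (auto elim!: eventually_mono)
    have "continuous (at x within {x..b}) \<psi>"
      using cont\<psi> x x0 continuous_within_subset[of x "{a..b}" \<psi> "{x..b}"]
      by (auto simp: continuous_on_eq_continuous_within)
    then have "(\<psi> \<longlongrightarrow> \<psi> x) (at_right x)"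
      using x(2) by (simp add: continuous_within at_within_Icc_at_right)
    then have "\<psi> x \<le> \<psi> b" by (rule tendsto_upperbound[OF _ ev]) simp
    then show False using \<open>\<psi> b < 0\<close> x(3) by (simp add: \<psi>_def)
  qed
  then have "\<psi> a \<le> \<psi> b" using ab by (intro mono) auto
  then have "exp (C * b) * (exp (- C * a) * \<phi> a) \<le> exp (C * b) * (exp (- C * b) * \<phi> b)"
    unfolding \<psi>_def by (intro mult_left_mono) auto
  moreover have "exp (C * b) * exp (- C * a) = exp (C * (b - a))" "exp (C * b) * exp (- C * b) = 1"
    unfolding exp_add[symmetric] by (simp_all add: right_diff_distrib)
  ultimately have "exp (C * (b - a)) * \<phi> a \<le> \<phi> b" by (metis mult.assoc mult_1)
  moreover have "exp (C * (b - a)) * (- \<epsilon>) \<le> exp (C * (b - a)) * \<phi> a"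
    using eps by (intro mult_left_mono) auto
  ultimately show ?thesis by (simp add: mult.commute)
qed

lemma deriv_gronwall:
  fixes \<phi> :: "real \<Rightarrow> real"
  assumes "a \<le> b" "continuous_on {a..b} \<phi>" "\<phi> a \<ge> - \<epsilon>" "\<epsilon> \<ge> 0"
    and "\<And>x. a \<le> x \<Longrightarrow> x < b \<Longrightarrow> \<phi> x < 0 \<Longrightarrow> \<exists>k. (\<phi> has_real_derivative k) (at x) \<and> k \<ge> C * \<phi> x"
  shows "\<phi> b \<ge> - \<epsilon> * exp (C * (b - a))"
  using assms(1-4)
proof (rule right_minorant_gronwall)
  fix x assume "a \<le> x" "x < b" "\<phi> x < 0"
  then show "\<exists>M k. (M has_real_derivative k) (at x) \<and> C * \<phi> x \<le> k \<and> (\<forall>\<^sub>F y in at_right x. M y - M x \<le> \<phi> y - \<phi> x)"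
    using assms(5)[of x] by (intro exI[of _ \<phi>]) auto
qed

section \<open>The equation in logarithmic variables\<close>

text \<open>Here \<open>t = ln r\<close>, \<open>m = n - p\<close> and \<open>exp (h t) = r\<^sup>p K(r)\<close>. The value \<open>lnJ t w\<close> is meant for \<open>w > u0\<close>
  only, since \<open>ln (f w)\<close> is junk where \<open>f w \<le> 0\<close>.\<close>

locale radial_ode =
  fixes f h \<theta> :: "real \<Rightarrow> real" and u0 m p :: real
  assumes p1: "p > 1" and m0: "m > 0" and u0: "u0 > 0"
    and f_cont: "continuous_on {0..} f"
    and f_pos: "\<And>u. u > u0 \<Longrightarrow> f u > 0"
    and f_nonpos: "\<And>u. 0 \<le> u \<Longrightarrow> u \<le> u0 \<Longrightarrow> f u \<le> 0"
    and f_lip: "\<And>u. u > u0 \<Longrightarrow> \<exists>e>0. \<exists>L. L-lipschitz_on (cball u e) f"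
    and f_ratio: "\<And>b c. u0 < b \<Longrightarrow> b \<le> c \<Longrightarrow>
      ln (f b) - (p - 1) * ln (b - u0) \<le> ln (f c) - (p - 1) * ln (c - u0)"
    and f_chord: "\<And>a b c d. u0 < a \<Longrightarrow> a < b \<Longrightarrow> b \<le> c \<Longrightarrow> c < d \<Longrightarrow>
      (ln (f d) - ln (f c)) / (ln d - ln c) \<le> (ln (f b) - ln (f a)) / (ln b - ln a)"
    and h_deriv: "\<And>t. (h has_real_derivative \<theta> t) (at t)"
    and \<theta>_pos: "\<And>t. \<theta> t > 0"
    and \<theta>_anti: "\<And>s t. s \<le> t \<Longrightarrow> \<theta> t \<le> \<theta> s"
begin

definition "q = 1 / (p - 1)"

definition lnJ where "lnJ t w = h t + ln (f w) - (p - 1) * ln w"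

text \<open>Differentiating \<open>y * v powr (1 - p)\<close> gives \<open>- m * e\<close> from the
  drift of \<open>y\<close> and \<open>(p - 1) * e powr (1 + q)\<close> from the decrease of
  \<open>v\<close>; \<open>g\<close> is minus their sum, and the remaining term is
  \<open>J\<close>.\<close>

definition g where "g e = m * e - (p - 1) * e powr (1 + q)"

text \<open>A mean of the elasticity \<open>u f'(u) / f(u)\<close> over \<open>[b, c]\<close> with
  respect to \<open>ln u\<close>.\<close>

definition slope where "slope b c = (ln (f c) - ln (f b)) / (ln c - ln b)"

lemma q_pos: "q > 0" using p1 by (simp add: q_def)

lemma slope_anti: "u0 < a \<Longrightarrow> a < b \<Longrightarrow> b \<le> c \<Longrightarrow> c < d \<Longrightarrow> slope c d \<le> slope a b"
  unfolding slope_def by (rule f_chord)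

text \<open>Since \<open>u0 > 0\<close>, the quotient \<open>(c - u0) / (b - u0)\<close> exceeds
  \<open>c / b\<close>; growth at the rate \<open>p - 1\<close> in \<open>ln (u - u0)\<close>
  therefore implies growth at least at that rate in \<open>ln u\<close>.\<close>

lemma slope_ge:
  assumes "u0 < b" "b < c"
  shows "slope b c \<ge> p - 1"
proof -
  have "c / b \<le> (c - u0) / (b - u0)" using assms u0 by (simp add: field_simps)
  then have "ln (c / b) \<le> ln ((c - u0) / (b - u0))" using assms u0 by (subst ln_le_cancel_iff) auto
  then have "(p - 1) * (ln c - ln b) \<le> (p - 1) * (ln (c - u0) - ln (b - u0))"
    using assms u0 p1 by (intro mult_left_mono) (auto simp: ln_div)
  also have "\<dots> \<le> ln (f c) - ln (f b)" using f_ratio[of b c] assms by (simp add: algebra_simps)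
  finally show ?thesis unfolding slope_def using assms u0 by (subst pos_le_divide_eq) auto
qed

lemma isCont_f: "u > 0 \<Longrightarrow> isCont f u"
  using continuous_on_interior[OF f_cont, of u] by simp

lemma h_mono:
  assumes "s \<le> t"
  shows "h s \<le> h t"
proof (rule DERIV_nonneg_imp_nondecreasing[of s t h, OF assms])
  fix x
  show "\<exists>y. (h has_real_derivative y) (at x) \<and> 0 \<le> y"
    using h_deriv[of x] \<theta>_pos[of x] by (intro exI[of _ "\<theta> x"]) auto
qed

lemma isCont_h: "isCont h t" using h_deriv by (rule DERIV_isCont)

text \<open>Two arcs parametrised by the same slope variable \<open>e\<close>. A chord of \<open>ln f\<close> between the two
  levels replaces the missing derivative of \<open>f\<close>.\<close>

lemma arcs_compare:
  assumes e12: "0 < e1" "e1 \<le> e2"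
    and V: "\<And>e. V1 e = exp (lnJ (T1 e) (W1 e)) - g e" "\<And>e. V2 e = exp (lnJ (T2 e) (W2 e)) - g e"
    and dT: "\<And>e. e1 \<le> e \<Longrightarrow> e \<le> e2 \<Longrightarrow> (T1 has_real_derivative 1 / V1 e) (at e)"
      "\<And>e. e1 \<le> e \<Longrightarrow> e \<le> e2 \<Longrightarrow> (T2 has_real_derivative 1 / V2 e) (at e)"
    and dW: "\<And>e. e1 \<le> e \<Longrightarrow> e \<le> e2 \<Longrightarrow> (W1 has_real_derivative - (e powr q) * W1 e / V1 e) (at e)"
      "\<And>e. e1 \<le> e \<Longrightarrow> e \<le> e2 \<Longrightarrow> (W2 has_real_derivative - (e powr q) * W2 e / V2 e) (at e)"
    and Vpos: "\<And>e. e1 \<le> e \<Longrightarrow> e \<le> e2 \<Longrightarrow> V1 e > 0" "\<And>e. e1 \<le> e \<Longrightarrow> e \<le> e2 \<Longrightarrow> V2 e > 0"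
    and T12: "\<And>e. e1 \<le> e \<Longrightarrow> e \<le> e2 \<Longrightarrow> T1 e \<le> T2 e"
    and W12: "\<And>e. e1 \<le> e \<Longrightarrow> e \<le> e2 \<Longrightarrow> W2 e < W1 e"
    and wb: "u0 < wb" "wb < wc" "\<And>e. e1 \<le> e \<Longrightarrow> e \<le> e2 \<Longrightarrow> wc \<le> W2 e"
    and \<kappa>: "\<kappa> = slope wb wc - (p - 1)" and C: "C \<ge> 0"
    and bound: "\<And>e. e1 \<le> e \<Longrightarrow> e < e2 \<Longrightarrow> \<kappa> * e powr q \<le> \<theta> (T2 e) \<or>
       \<kappa> * e powr q * exp (lnJ (T2 e) (W2 e)) \<le> C * (V1 e * V2 e)"
    and start: "lnJ (T1 e1) (W1 e1) - lnJ (T2 e1) (W2 e1) \<ge> - \<epsilon>" "\<epsilon> \<ge> 0"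
  shows "lnJ (T1 e2) (W1 e2) - lnJ (T2 e2) (W2 e2) \<ge> - \<epsilon> * exp (C * (e2 - e1))"
proof (rule right_minorant_gronwall[where \<phi> = "\<lambda>e. lnJ (T1 e) (W1 e) - lnJ (T2 e) (W2 e)", OF e12(2) _ start])
  have W: "W2 e > u0" "W1 e > u0" if "e1 \<le> e" "e \<le> e2" for e
    using wb(1,2) wb(3)[OF that] W12[OF that] by auto
  have cont: "isCont (\<lambda>e. lnJ (T1 e) (W1 e)) e" "isCont (\<lambda>e. lnJ (T2 e) (W2 e)) e" if "e1 \<le> e" "e \<le> e2" for e
    unfolding lnJ_def using W[OF that] u0 f_pos[OF W(1)[OF that]] f_pos[OF W(2)[OF that]]
    by (auto intro!: continuous_intros isCont_o2[OF _ isCont_h] isCont_o2[OF _ isCont_f] DERIV_isCont[OF dT(1)[OF that]] 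
         DERIV_isCont[OF dT(2)[OF that]] DERIV_isCont[OF dW(1)[OF that]] DERIV_isCont[OF dW(2)[OF that]])
  show "continuous_on {e1..e2} (\<lambda>e. lnJ (T1 e) (W1 e) - lnJ (T2 e) (W2 e))"
    using cont by (auto intro!: continuous_at_imp_continuous_on continuous_intros)
  fix e assume e: "e1 \<le> e" "e < e2" and neg: "lnJ (T1 e) (W1 e) - lnJ (T2 e) (W2 e) < 0"
  then have e': "e1 \<le> e" "e \<le> e2" by auto
  have e0: "e > 0" using e12 e by auto
  note We = W[OF e'] and W12e = W12[OF e'] and V1e = Vpos(1)[OF e'] and V2e = Vpos(2)[OF e']
  \<comment> \<open>The middle third of \<open>[W2 e, W1 e]\<close> separates the arcs. Both levels
    fall as the parameter grows, so just after \<open>e\<close> the piece passed by the upper arc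
    lies above \<open>c\<close> and the piece passed by the lower arc below \<open>b\<close>;
    concavity compares both with \<open>slope b c\<close>.\<close>
  define b where "b = W2 e + (W1 e - W2 e) / 3"
  define c where "c = W2 e + 2 * (W1 e - W2 e) / 3"
  have bc: "W2 e < b" "b < c" "c < W1 e" using W12e unfolding b_def c_def by (auto simp: field_simps)
  define k where "k = slope b c - (p - 1)"
  have k0: "k \<ge> 0" unfolding k_def using slope_ge[of b c] bc We by auto
  have k\<kappa>: "k \<le> \<kappa>" unfolding k_def \<kappa> using slope_anti[of wb wc b c] wb(1,2) wb(3)[OF e'] bc by auto
  \<comment> \<open>The difference of the two \<open>lnJ\<close> with \<open>ln f\<close> replaced
    by \<open>slope b c * ln\<close> on both arcs. To the right of \<open>e\<close> its increments
    bound the true ones from below.\<close>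
  define M where "M s = h (T1 s) - h (T2 s) + k * (ln (W1 s) - ln (W2 s))" for s
  define z where "z = e powr q"
  have z: "z > 0" using e0 by (simp add: z_def)
  define D where "D = \<theta> (T1 e) * (1 / V1 e) - \<theta> (T2 e) * (1 / V2 e) - k * z * (1 / V1 e - 1 / V2 e)"
  have hT: "((\<lambda>s. h (T1 s)) has_real_derivative \<theta> (T1 e) * (1 / V1 e)) (at e)"
       "((\<lambda>s. h (T2 s)) has_real_derivative \<theta> (T2 e) * (1 / V2 e)) (at e)"
    using DERIV_chain2[OF h_deriv dT(1)[OF e']] DERIV_chain2[OF h_deriv dT(2)[OF e']] by auto
  have lW: "((\<lambda>s. ln (W1 s)) has_real_derivative - z / V1 e) (at e)"
       "((\<lambda>s. ln (W2 s)) has_real_derivative - z / V2 e) (at e)"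
    using We u0 by (auto intro!: derivative_eq_intros dW[OF e'] simp: z_def)
  have MD: "(M has_real_derivative D) (at e)"
  proof -
    have "(M has_real_derivative (\<theta> (T1 e) * (1 / V1 e) - \<theta> (T2 e) * (1 / V2 e)) + k * (- z / V1 e - - z / V2 e)) (at e)"
      unfolding M_def by (intro DERIV_add DERIV_diff DERIV_cmult hT lW)
    moreover have "k * (- z / V1 e - - z / V2 e) = - (k * z * (1 / V1 e - 1 / V2 e))"
      by (simp add: algebra_simps)
    ultimately show ?thesis unfolding D_def by simp
  qed
  define J1 where "J1 = exp (lnJ (T1 e) (W1 e))"
  define J2 where "J2 = exp (lnJ (T2 e) (W2 e))"
  define \<phi> where "\<phi> = lnJ (T1 e) (W1 e) - lnJ (T2 e) (W2 e)"
  have neg': "\<phi> < 0" using neg \<phi>_def by simp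
  have J12: "J2 - J1 \<le> J2 * (- \<phi>)"
  proof -
    have "J1 = J2 * exp \<phi>" unfolding J1_def J2_def exp_add[symmetric] by (simp add: \<phi>_def)
    moreover have "J2 * (1 + \<phi>) \<le> J2 * exp \<phi>" using exp_ge_add_one_self[of \<phi>] by (intro mult_left_mono) (auto simp: J2_def)
    ultimately show ?thesis by (simp add: algebra_simps)
  qed
  have "J1 < J2" using neg by (simp add: J1_def J2_def)
  have V12: "V2 e - V1 e = J2 - J1" by (simp add: V J1_def J2_def)
  define \<Delta> where "\<Delta> = 1 / V1 e - 1 / V2 e"
  have \<Delta>: "\<Delta> = (J2 - J1) / (V1 e * V2 e)" unfolding \<Delta>_def V12[symmetric] using V1e V2e by (simp add: field_simps)
  have \<Delta>0: "\<Delta> \<ge> 0" unfolding \<Delta> using \<open>J1 < J2\<close> V1e V2e by simp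
  have "\<theta> (T2 e) * (1 / V1 e) \<le> \<theta> (T1 e) * (1 / V1 e)"
    using V1e \<theta>_anti[OF T12[OF e']] by (intro mult_right_mono) auto
  then have D1: "D \<ge> (\<theta> (T2 e) - k * z) * \<Delta>" by (simp add: D_def \<Delta>_def algebra_simps)
  \<comment> \<open>A negative difference means \<open>J1 < J2\<close>, hence \<open>V1 < V2\<close>
    and \<open>\<Delta> > 0\<close>. If \<open>\<theta>\<close> dominates
    \<open>\<kappa> * z\<close>, the derivative \<open>D\<close> is nonnegative; otherwise the loss
    \<open>k * z * \<Delta>\<close> is at most \<open>C\<close> times the deficit
    \<open>- \<phi>\<close>.\<close>
  have CD: "C * \<phi> \<le> D"
  proof (cases "\<kappa> * z \<le> \<theta> (T2 e)")
    case True
    have "k * z \<le> \<kappa> * z" using k\<kappa> z by (intro mult_right_mono) auto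
    then have "(\<theta> (T2 e) - k * z) * \<Delta> \<ge> 0" using \<Delta>0 True by simp
    moreover have "C * \<phi> \<le> 0" using C neg' by (simp add: mult_le_0_iff)
    ultimately show ?thesis using D1 by linarith
  next
    case False
    then have 2: "\<kappa> * z * J2 \<le> C * (V1 e * V2 e)" using bound[OF e] by (simp add: z_def J2_def)
    have "k * z * \<Delta> \<le> \<kappa> * z * \<Delta>" using k\<kappa> z \<Delta>0 by (intro mult_right_mono) auto
    also have "\<dots> \<le> \<kappa> * z * (J2 * (- \<phi>) / (V1 e * V2 e))"
      unfolding \<Delta> using J12 V1e V2e k0 k\<kappa> z by (intro mult_left_mono divide_right_mono) auto
    also have "\<dots> = (\<kappa> * z * J2 / (V1 e * V2 e)) * (- \<phi>)" by simp
    also have "\<dots> \<le> C * (- \<phi>)"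
      using 2 V1e V2e neg' by (intro mult_right_mono) (auto simp: pos_divide_le_eq)
    finally have "k * z * \<Delta> \<le> C * (- \<phi>)" .
    moreover have "(\<theta> (T2 e) - k * z) * \<Delta> \<ge> - (k * z * \<Delta>)"
      using \<theta>_pos[of "T2 e"] \<Delta>0 by (simp add: left_diff_distrib)
    ultimately show ?thesis using D1 by linarith
  qed
  have ev: "\<forall>\<^sub>F s in at_right e. M s - M e \<le> (lnJ (T1 s) (W1 s) - lnJ (T2 s) (W2 s)) - (lnJ (T1 e) (W1 e) - lnJ (T2 e) (W2 e))"
  proof -
    have dec: "\<forall>\<^sub>F s in at_right e. X s < X e" if X: "(X has_real_derivative d) (at e)" "d < 0" for X d
    proof -
      obtain r where r: "r > 0" "\<forall>h>0. h < r \<longrightarrow> X (e + h) < X e" using DERIV_neg_dec_right[OF X] by blast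
      have "\<forall>\<^sub>F s in at_right e. s \<in> {e<..<e + r}" by (rule eventually_at_right_real) (use r in auto)
      then show ?thesis
      proof (rule eventually_mono)
        fix s assume "s \<in> {e<..<e + r}"
        then show "X s < X e" using r(2)[rule_format, of "s - e"] by simp
      qed
    qed
    have 1: "\<forall>\<^sub>F s in at_right e. W1 s < W1 e"
      by (rule dec[OF dW(1)[OF e']]) (use z We u0 V1e in \<open>auto simp: z_def divide_neg_pos\<close>)
    have 2: "\<forall>\<^sub>F s in at_right e. W2 s < W2 e"
      by (rule dec[OF dW(2)[OF e']]) (use z We u0 V2e in \<open>auto simp: z_def divide_neg_pos\<close>)
    have t: "(W1 \<longlongrightarrow> W1 e) (at_right e)" "(W2 \<longlongrightarrow> W2 e) (at_right e)"
      by (intro isCont_at_right DERIV_isCont[OF dW(1)[OF e']] DERIV_isCont[OF dW(2)[OF e']])+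
    have 3: "\<forall>\<^sub>F s in at_right e. c < W1 s" using order_tendstoD(1)[OF t(1) bc(3)] .
    have 4: "\<forall>\<^sub>F s in at_right e. u0 < W2 s" using order_tendstoD(1)[OF t(2) We(1)] .
    show ?thesis using 1 2 3 4
    proof eventually_elim
      case (elim s)
      have "slope (W1 s) (W1 e) \<le> slope b c" using slope_anti[of b c "W1 s" "W1 e"] bc We elim by auto
      moreover have "ln (W1 e) - ln (W1 s) > 0" using elim bc We u0 by auto
      ultimately have "ln (f (W1 e)) - ln (f (W1 s)) \<le> slope b c * (ln (W1 e) - ln (W1 s))"
        unfolding slope_def[of "W1 s"] by (simp add: pos_divide_le_eq)
      moreover have "slope b c \<le> slope (W2 s) (W2 e)" using slope_anti[of "W2 s" "W2 e" b c] bc We elim by auto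
      moreover have "ln (W2 e) - ln (W2 s) > 0" using elim We u0 by auto
      ultimately have "ln (f (W1 e)) - ln (f (W1 s)) \<le> slope b c * (ln (W1 e) - ln (W1 s))"
        "slope b c * (ln (W2 e) - ln (W2 s)) \<le> ln (f (W2 e)) - ln (f (W2 s))"
        unfolding slope_def[of "W2 s"] by (simp_all add: pos_le_divide_eq)
      then show ?case unfolding lnJ_def M_def k_def by (simp add: algebra_simps)
    qed
  qed
  show "\<exists>M k. (M has_real_derivative k) (at e) \<and> C * (lnJ (T1 e) (W1 e) - lnJ (T2 e) (W2 e)) \<le> k \<and>
       (\<forall>\<^sub>F s in at_right e. M s - M e \<le> (lnJ (T1 s) (W1 s) - lnJ (T2 s) (W2 s)) - (lnJ (T1 e) (W1 e) - lnJ (T2 e) (W2 e)))"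
    using MD CD[unfolded \<phi>_def] ev by (intro exI[of _ M] exI[of _ D] conjI)
qed

end

lemma continuous_bounded_above:
  fixes F :: "real \<Rightarrow> real"
  assumes "\<And>x. a \<le> x \<Longrightarrow> x \<le> b \<Longrightarrow> isCont F x"
  shows "\<exists>C\<ge>0. \<forall>x\<in>{a..b}. F x \<le> C"
proof -
  have "continuous_on {a..b} F" using assms by (auto intro!: continuous_at_imp_continuous_on)
  then have "compact (F ` {a..b})" by (intro compact_continuous_image) auto
  then have "bounded (F ` {a..b})" by (rule compact_imp_bounded)
  then obtain C where C: "\<forall>x\<in>{a..b}. \<bar>F x\<bar> \<le> C"
    unfolding bounded_iff by auto
  show ?thesis by (rule exI[of _ "\<bar>C\<bar>"]) (use C in force)
qed

lemma real_inverse_deriv: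
  fixes f :: "real \<Rightarrow> real"
  assumes "open S" "x \<in> S" "continuous_on S f" "\<And>x. x \<in> S \<Longrightarrow> g (f x) = x"
    and "(f has_real_derivative D) (at x)" "D \<noteq> 0"
  shows "(g has_real_derivative inverse D) (at (f x))"
  unfolding has_field_derivative_def
  by (rule has_derivative_inverse_strong[OF assms(1-4) assms(5)[unfolded has_field_derivative_def]])
     (use assms(6) in \<open>auto simp: fun_eq_iff\<close>)

text \<open>\<open>v t = u(r)\<close> and \<open>y t = (r |u'(r)|)\<^sup>p\<^sup>-\<^sup>1\<close>, so that \<open>exp (m t) y t = r\<^sup>n\<^sup>-\<^sup>1 |u'(r)|\<^sup>p\<^sup>-\<^sup>1\<close>. Later
  \<open>eta\<close> stands for \<open>(y / v\<^sup>p\<^sup>-\<^sup>1)\<close>, a power of the slope of \<open>ln v\<close>, and \<open>Vt\<close> for its velocity.\<close>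

locale radial_profile = radial_ode +
  fixes v y :: "real \<Rightarrow> real" and \<tau> \<alpha> :: real
  assumes dv: "\<And>t. t < \<tau> \<Longrightarrow> (v has_real_derivative - (y t powr q)) (at t)"
    and dy: "\<And>t. t < \<tau> \<Longrightarrow> (y has_real_derivative exp (h t) * f (v t) - m * y t) (at t)"
    and y_pos: "\<And>t. t < \<tau> \<Longrightarrow> y t > 0"
    and v_pos: "\<And>t. t < \<tau> \<Longrightarrow> v t > 0"
    and v_bot: "(v \<longlongrightarrow> \<alpha>) at_bot"
    and y_bot: "(y \<longlongrightarrow> 0) at_bot"
    and v_end: "(v \<longlongrightarrow> 0) (at_left \<tau>)"
    and \<alpha>: "\<alpha> > u0"
begin

lemma v_strict_decr:
  assumes "s < t" "t < \<tau>"
  shows "v t < v s"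
proof (rule DERIV_neg_imp_decreasing[OF assms(1)])
  fix x assume "s \<le> x" "x \<le> t"
  then have "x < \<tau>" using assms by auto
  then show "\<exists>y. (v has_real_derivative y) (at x) \<and> y < 0" using dv[of x] y_pos[of x]
    by (intro exI[of _ "- (y x powr q)"]) auto
qed

lemma v_decr: "s \<le> t \<Longrightarrow> t < \<tau> \<Longrightarrow> v t \<le> v s"
  using v_strict_decr[of s t] by (cases "s = t") auto

lemma v_less_iff: "s < \<tau> \<Longrightarrow> t < \<tau> \<Longrightarrow> v s < v t \<longleftrightarrow> t < s"
  using v_strict_decr[of s t] v_strict_decr[of t s] by (cases s t rule: linorder_cases) auto

lemma v_less_\<alpha>:
  assumes "t < \<tau>"
  shows "v t < \<alpha>"
proof -
  have "\<forall>\<^sub>F s in at_bot. v (t - 1) \<le> v s"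
    using eventually_le_at_bot[of "t - 1"] by (rule eventually_mono) (use assms in \<open>auto intro: v_decr\<close>)
  then have "v (t - 1) \<le> \<alpha>" by (rule tendsto_lowerbound[OF v_bot]) simp
  moreover have "v t < v (t - 1)" using assms by (intro v_strict_decr) auto
  ultimately show ?thesis by simp
qed

lemma isCont_v: "t < \<tau> \<Longrightarrow> isCont v t" using dv by (rule DERIV_isCont)

lemma v_attains:
  assumes "0 < x" "x < \<alpha>"
  obtains t where "t < \<tau>" "v t = x"
proof -
  have "\<forall>\<^sub>F t in at_bot. x < v t \<and> t < \<tau>"
    using order_tendstoD(1)[OF v_bot assms(2)] eventually_gt_at_bot[of \<tau>] by eventually_elim auto
  then obtain a where a: "x < v a" "a < \<tau>" using eventually_happens[of _ "at_bot :: real filter"] by auto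
  have "\<forall>\<^sub>F t in at_left \<tau>. t \<in> {a<..<\<tau>}" by (rule eventually_at_left_real[OF a(2)])
  then have "\<forall>\<^sub>F t in at_left \<tau>. v t < x \<and> a < t \<and> t < \<tau>"
    using order_tendstoD(2)[OF v_end assms(1)] by eventually_elim auto
  then obtain b where b: "v b < x" "a < b" "b < \<tau>" using eventually_happens[of _ "at_left \<tau>"] by auto
  have "\<exists>t\<ge>a. t \<le> b \<and> v t = x"
    by (rule IVT2) (use a b isCont_v in auto)
  then obtain t where "t \<le> b" "v t = x" by blast
  then show thesis using that[of t] b by auto
qed

text \<open>As \<open>v\<close> decreases strictly, its level can replace time as the independent
  variable; \<open>lev x\<close> is the time at which the level \<open>x\<close> is passed.\<close>

definition "lev = the_inv_into {..<\<tau>} v"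

lemma inj_v: "inj_on v {..<\<tau>}"
  by (rule inj_onI) (metis lessThan_iff linorder_neqE v_strict_decr order_less_irrefl)

lemma lev_v: "t < \<tau> \<Longrightarrow> lev (v t) = t"
  unfolding lev_def by (rule the_inv_into_f_f[OF inj_v]) simp

lemma lev:
  assumes "0 < x" "x < \<alpha>"
  shows "lev x < \<tau>" "v (lev x) = x"
  using v_attains[OF assms] lev_v by metis+

lemma lev_less: "0 < x \<Longrightarrow> x < \<alpha> \<Longrightarrow> t < \<tau> \<Longrightarrow> lev x < t \<longleftrightarrow> v t < x"
  using lev[of x] v_less_iff[of t "lev x"] by auto

lemma lev_deriv:
  assumes "0 < x" "x < \<alpha>"
  shows "(lev has_real_derivative - (y (lev x) powr - q)) (at x)"
proof -
  have "(lev has_real_derivative inverse (- (y (lev x) powr q))) (at (v (lev x)))"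
  proof (rule real_inverse_deriv[where S = "{..<\<tau>}" and f = v and x = "lev x"])
    show "(v has_real_derivative - (y (lev x) powr q)) (at (lev x))" using lev[OF assms] by (intro dv)
    show "continuous_on {..<\<tau>} v" using isCont_v by (auto intro!: continuous_at_imp_continuous_on)
    show "lev x \<in> {..<\<tau>}" using lev[OF assms] by simp
    show "- (y (lev x) powr q) \<noteq> 0" using y_pos[OF lev(1)[OF assms]] by simp
  qed (auto intro: lev_v)
  then show ?thesis using lev[OF assms] by (simp add: powr_minus inverse_eq_divide)
qed

definition "T0 = lev u0"

lemma T0: "T0 < \<tau>" "v T0 = u0"
  unfolding T0_def using lev[of u0] u0 \<alpha> by auto

lemma v_gt_u0: "t < T0 \<Longrightarrow> v t > u0"
  using v_strict_decr[of t T0] T0 by auto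

lemma v_ge_u0: "t \<le> T0 \<Longrightarrow> v t \<ge> u0"
  using v_decr[of t T0] T0 by auto

lemma omega_deriv:
  assumes "t < \<tau>"
  shows "((\<lambda>t. exp (m * t) * y t) has_real_derivative exp (m * t) * (exp (h t) * f (v t))) (at t)"
  by (auto intro!: derivative_eq_intros dy[OF assms] simp: algebra_simps)

definition "eta t = y t * v t powr (1 - p)"
definition "Vt t = exp (h t) * f (v t) * v t powr (1 - p) - g (eta t)"

lemma eta_pos: "t < \<tau> \<Longrightarrow> eta t > 0"
  unfolding eta_def using y_pos[of t] v_pos[of t] by simp

lemma eta_powr_q:
  assumes "t < \<tau>"
  shows "eta t powr q = y t powr q / v t"
proof -
  have "(1 - p) * q = -1" using p1 by (simp add: q_def field_simps)
  then show ?thesis using y_pos[OF assms] v_pos[OF assms]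
    by (simp add: eta_def powr_mult powr_powr powr_minus_divide)
qed

lemma eta_deriv:
  assumes "t < \<tau>"
  shows "(eta has_real_derivative Vt t) (at t)"
proof -
  note [simp] = v_pos[OF assms] y_pos[OF assms] less_imp_le[OF v_pos[OF assms]]
  have "((\<lambda>t. v t powr (1 - p)) has_real_derivative (1 - p) * v t powr (1 - p - of_nat 1) * (- (y t powr q))) (at t)"
    by (rule DERIV_fun_powr[OF dv[OF assms]]) simp
  then have "(eta has_real_derivative (exp (h t) * f (v t) - m * y t) * v t powr (1 - p)
      + ((1 - p) * v t powr (1 - p - of_nat 1) * (- (y t powr q))) * y t) (at t)"
    unfolding eta_def[abs_def] by (rule DERIV_mult[OF dy[OF assms]])
  moreover have "v t powr (1 - p - of_nat 1) = v t powr (1 - p) / v t"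
    by (subst powr_diff) simp
  moreover have "eta t powr (1 + q) = eta t * (y t powr q / v t)"
    using eta_powr_q[OF assms] eta_pos[OF assms] by (simp add: powr_add)
  ultimately show ?thesis
    by (simp add: Vt_def g_def eta_def algebra_simps diff_divide_distrib)
qed

lemma isCont_eta: "t < \<tau> \<Longrightarrow> isCont eta t" using eta_deriv by (rule DERIV_isCont)

lemma eta_bot: "(eta \<longlongrightarrow> 0) at_bot"
proof -
  have "((\<lambda>t. y t * v t powr (1 - p)) \<longlongrightarrow> 0 * \<alpha> powr (1 - p)) at_bot"
    by (intro tendsto_intros y_bot v_bot) (use \<alpha> u0 in auto)
  then show ?thesis by (simp add: eta_def[abs_def])
qed

lemma exp_lnJ:
  assumes "t < T0"
  shows "exp (lnJ t (v t)) = exp (h t) * f (v t) * v t powr (1 - p)"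
proof -
  have "v t > 0" "f (v t) > 0" using v_gt_u0[OF assms] u0 f_pos by auto
  moreover have "lnJ t (v t) = h t + ln (f (v t)) + (1 - p) * ln (v t)"
    by (simp add: lnJ_def algebra_simps)
  ultimately show ?thesis by (simp add: exp_add powr_def)
qed

lemma Vt_eq: "t < T0 \<Longrightarrow> Vt t = exp (lnJ t (v t)) - g (eta t)"
  by (simp add: Vt_def exp_lnJ)

lemma isCont_g: "e > 0 \<Longrightarrow> isCont g e"
  unfolding g_def[abs_def] by (auto intro!: continuous_intros)

lemma isCont_Vt: "t < \<tau> \<Longrightarrow> isCont Vt t"
  unfolding Vt_def[abs_def] using v_pos[of t] eta_pos[of t]
  by (auto intro!: continuous_intros isCont_h isCont_o2[OF isCont_v isCont_f] isCont_v
      isCont_o2[OF isCont_eta isCont_g])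

lemma isCont_lnJ:
  assumes "t < T0"
  shows "isCont (\<lambda>t. lnJ t (v t)) t"
  unfolding lnJ_def using v_gt_u0[OF assms] u0 f_pos[OF v_gt_u0[OF assms]] assms T0(1)
  by (auto intro!: continuous_intros isCont_h isCont_o2[OF isCont_v isCont_f] isCont_v)

lemma g_neg_iff: "e > 0 \<Longrightarrow> g e < 0 \<longleftrightarrow> e powr q > m * q"
proof -
  assume e: "e > 0"
  have "(p - 1) * q = 1" using p1 by (simp add: q_def)
  moreover have "e * (p - 1) * (m * q - e powr q) = e * m * ((p - 1) * q) - (p - 1) * (e * e powr q)"
    by (simp add: algebra_simps)
  ultimately have "g e = e * (p - 1) * (m * q - e powr q)" using e
    by (simp add: g_def powr_add)
  moreover have "c * d < 0 \<longleftrightarrow> d < 0" if "c > 0" for c d :: real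
    using that by (simp add: mult_less_0_iff)
  from this[of "e * (p - 1)" "m * q - e powr q"] have "e * (p - 1) * (m * q - e powr q) < 0 \<longleftrightarrow> e powr q > m * q"
    using e p1 by simp
  ultimately show ?thesis by simp
qed

text \<open>Below the level \<open>u0\<close> the flux can only lose mass, so reaching \<open>0\<close> in finite time forces a
  large slope at \<open>u0\<close>.\<close>

lemma eta_T0: "eta T0 powr q > m * q"
proof -
  define c where "c = y T0 powr q"
  have c: "c > 0" using y_pos[OF T0(1)] by (simp add: c_def)
  have yle: "y t powr q \<le> c * exp (- (m * q) * (t - T0))" if t: "T0 \<le> t" "t < \<tau>" for t
  proof -
    have "exp (m * t) * y t \<le> exp (m * T0) * y T0"
    proof (rule DERIV_nonpos_imp_nonincreasing[OF t(1), of "\<lambda>t. exp (m * t) * y t"])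
      fix x assume x: "T0 \<le> x" "x \<le> t"
      then have "x < \<tau>" using t by simp
      moreover have "f (v x) \<le> 0" using v_decr[of T0 x] T0 v_pos[of x] x t f_nonpos[of "v x"] by auto
      ultimately show "\<exists>d. ((\<lambda>t. exp (m * t) * y t) has_real_derivative d) (at x) \<and> d \<le> 0"
        by (intro exI[of _ "exp (m * x) * (exp (h x) * f (v x))"] conjI omega_deriv)
           (auto simp: mult_le_0_iff)
    qed
    then have "exp (- (m * t)) * (exp (m * t) * y t) \<le> exp (- (m * t)) * (exp (m * T0) * y T0)"
      by (rule mult_left_mono) simp
    moreover have "exp (- (m * t)) * exp (m * t) = 1" "exp (- (m * t)) * exp (m * T0) = exp (- m * (t - T0))"
      unfolding exp_add[symmetric] by (simp_all add: right_diff_distrib)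
    ultimately have "y t \<le> exp (- m * (t - T0)) * y T0" by (metis mult.assoc mult_1)
    then have "y t powr q \<le> (exp (- m * (t - T0)) * y T0) powr q"
      using y_pos[OF t(2)] q_pos by (intro powr_mono2) auto
    also have "\<dots> = exp (- m * (t - T0)) powr q * c"
      using y_pos[OF T0(1)] by (simp add: powr_mult c_def)
    also have "exp (- m * (t - T0)) powr q = exp (- (m * q) * (t - T0))"
      by (simp add: exp_powr_real algebra_simps)
    finally show ?thesis by (simp add: mult.commute)
  qed
  \<comment> \<open>\<open>B t\<close> is the integral over \<open>[t, \<infinity>)\<close> of the
    bound \<open>yle\<close> for \<open>- v'\<close>, so \<open>v - B\<close> is nondecreasing. Its
    limit at \<open>\<tau>\<close> is negative, which gives \<open>u0 < c / (m * q)\<close>.\<close>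
  define B where "B t = c * exp (- (m * q) * (t - T0)) / (m * q)" for t
  have mq: "m * q > 0" using m0 q_pos by simp
  have low: "u0 - c / (m * q) \<le> v t - B t" if t: "T0 \<le> t" "t < \<tau>" for t
  proof -
    have "v T0 - B T0 \<le> v t - B t"
    proof (rule DERIV_nonneg_imp_nondecreasing[OF t(1), of "\<lambda>t. v t - B t"])
      fix x assume x: "T0 \<le> x" "x \<le> t"
      have "(B has_real_derivative - (c * exp (- (m * q) * (x - T0)))) (at x)"
        unfolding B_def using mq by (auto intro!: derivative_eq_intros)
      then have "((\<lambda>t. v t - B t) has_real_derivative - (y x powr q) - - (c * exp (- (m * q) * (x - T0)))) (at x)"
        using x t by (intro DERIV_diff dv) auto
      then show "\<exists>d. ((\<lambda>t. v t - B t) has_real_derivative d) (at x) \<and> 0 \<le> d"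
        using yle[of x] x t by (intro exI conjI) auto
    qed
    then show ?thesis by (simp add: T0 B_def)
  qed
  have "((\<lambda>t. v t - B t) \<longlongrightarrow> 0 - B \<tau>) (at_left \<tau>)"
    unfolding B_def by (intro tendsto_intros v_end) (use mq in auto)
  moreover have "\<forall>\<^sub>F t in at_left \<tau>. u0 - c / (m * q) \<le> v t - B t"
    using eventually_at_left_real[OF T0(1)] by (rule eventually_mono) (use low in auto)
  ultimately have "u0 - c / (m * q) \<le> 0 - B \<tau>" by (rule tendsto_lowerbound) simp
  moreover have "B \<tau> > 0" unfolding B_def using c mq by simp
  ultimately have "u0 < c / (m * q)" by linarith
  then have "u0 * (m * q) < c" using mq by (simp add: pos_less_divide_eq)
  then show ?thesis using eta_powr_q[OF T0(1)] T0(2) u0 by (simp add: c_def pos_less_divide_eq mult.commute)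
qed

text \<open>Continuity gives \<open>f u0 = 0\<close>, so the velocity at \<open>T0\<close> is just
  \<open>- g (eta T0)\<close>, and \<open>eta T0\<close> lies beyond the positive zero of
  \<open>g\<close>.\<close>

lemma Vt_T0: "Vt T0 > 0"
proof -
  have "f u0 = 0"
  proof (rule antisym)
    show "f u0 \<le> 0" using f_nonpos[of u0] u0 by simp
    have "(f \<longlongrightarrow> f u0) (at_right u0)"
      by (rule isCont_at_right[OF isCont_f[OF u0]])
    moreover have "\<forall>\<^sub>F u in at_right u0. f u \<ge> 0"
      using eventually_at_right_real[of u0 "u0 + 1"] by (auto elim!: eventually_mono intro: less_imp_le f_pos)
    ultimately show "f u0 \<ge> 0" by (rule tendsto_lowerbound) simp
  qed
  then show ?thesis using eta_T0 g_neg_iff[OF eta_pos[OF T0(1)]] by (simp add: Vt_def T0)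
qed

text \<open>Otherwise \<open>J \<le> g (eta t2)\<close> at all times up to \<open>t2\<close>.
  Followed backwards from \<open>t2\<close>, \<open>eta\<close> cannot fall below
  \<open>eta t2\<close>: its velocity there would be at most \<open>g (eta t2) - g (eta s)\<close>,
  which is at most \<open>m\<close> times the deficit, so Gronwall's inequality applies. But
  \<open>eta\<close> tends to \<open>0\<close> at the centre.\<close>

lemma Vt_pos_if_J_max:
  assumes t2: "t2 < T0" and J: "\<And>s. s \<le> t2 \<Longrightarrow> lnJ s (v s) \<le> lnJ t2 (v t2)"
  shows "Vt t2 > 0"
proof (rule ccontr)
  assume "\<not> Vt t2 > 0"
  then have Jg: "exp (lnJ t2 (v t2)) \<le> g (eta t2)" using Vt_eq[OF t2] by simp
  have "t2 < \<tau>" using t2 T0(1) by simp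
  have "\<forall>\<^sub>F t in at_bot. eta t < eta t2 \<and> t < t2"
    using order_tendstoD(2)[OF eta_bot eta_pos[OF \<open>t2 < \<tau>\<close>]] eventually_gt_at_bot[of t2]
    by eventually_elim auto
  then obtain t3 where t3: "eta t3 < eta t2" "t3 < t2" using eventually_happens[of _ "at_bot :: real filter"] by auto
  define \<phi> where "\<phi> s = eta (- s) - eta t2" for s
  have d\<phi>: "(\<phi> has_real_derivative - Vt (- s)) (at s)" if "- s < \<tau>" for s
  proof -
    have "((\<lambda>s. eta (- s)) has_real_derivative Vt (- s) * (- 1)) (at s)"
      by (rule DERIV_chain2[where f = eta and g = uminus, OF eta_deriv[OF that]])
         (auto intro!: derivative_eq_intros)
    then show ?thesis unfolding \<phi>_def by (auto intro!: derivative_eq_intros)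
  qed
  have "\<phi> (- t3) \<ge> - 0 * exp (m * (- t3 - (- t2)))"
  proof (rule deriv_gronwall)
    show "continuous_on {- t2..- t3} \<phi>"
      using t3 \<open>t2 < \<tau>\<close> by (intro continuous_at_imp_continuous_on ballI DERIV_isCont[OF d\<phi>]) auto
    fix x assume x: "- t2 \<le> x" "x < - t3" "\<phi> x < 0"
    define s where "s = - x"
    have s: "s \<le> t2" "s < \<tau>" "s < T0" "eta s < eta t2" using x t2 \<open>t2 < \<tau>\<close> by (auto simp: s_def \<phi>_def)
    have "Vt s = exp (lnJ s (v s)) - g (eta s)" using Vt_eq s by simp
    also have "\<dots> \<le> g (eta t2) - g (eta s)" using J[OF s(1)] Jg by (smt (verit) exp_le_cancel_iff)
    also have "\<dots> \<le> m * (eta t2 - eta s)"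
    proof -
      have "eta s powr (1 + q) \<le> eta t2 powr (1 + q)"
        using s eta_pos[OF s(2)] q_pos by (intro powr_mono2) auto
      then have "(p - 1) * eta s powr (1 + q) \<le> (p - 1) * eta t2 powr (1 + q)"
        using p1 by (intro mult_left_mono) auto
      then show ?thesis by (simp add: g_def algebra_simps)
    qed
    finally have "m * \<phi> x \<le> - Vt (- x)" by (simp add: \<phi>_def s_def algebra_simps)
    then show "\<exists>k. (\<phi> has_real_derivative k) (at x) \<and> m * \<phi> x \<le> k"
      using d\<phi>[of x] s by (auto simp: s_def)
  qed (use t3 in \<open>auto simp: \<phi>_def\<close>)
  then show False using t3 by (simp add: \<phi>_def)
qed

text \<open>The set \<open>S\<close> is left general because \<open>eta\<close> is inverted on two
  disjoint time intervals of one profile while its monotonicity is being proved, and afterwards on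
  the whole half-line before \<open>T0\<close>.\<close>

lemma arc:
  assumes S: "open S" "convex S" "S \<subseteq> {..<T0}" and V: "\<forall>t\<in>S. Vt t > 0"
    and I: "I = the_inv_into S eta" and e: "e \<in> eta ` S"
  shows "I e \<in> S" "eta (I e) = e" "(I has_real_derivative 1 / Vt (I e)) (at e)"
    "((\<lambda>e. v (I e)) has_real_derivative - (e powr q) * v (I e) / Vt (I e)) (at e)"
    "Vt (I e) = exp (lnJ (I e) (v (I e))) - g e"
proof -
  have mono: "eta s < eta t" if st: "s \<in> S" "t \<in> S" "s < t" for s t
  proof (rule DERIV_pos_imp_increasing[OF st(3)])
    fix x assume x: "s \<le> x" "x \<le> t"
    have "x \<in> closed_segment s t" using x by (simp add: closed_segment_eq_real_ivl)
    then have "x \<in> S" using S(2) st(1,2) by (meson convex_contains_segment subsetD)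
    then show "\<exists>y. (eta has_real_derivative y) (at x) \<and> 0 < y"
      using bspec[OF V, of x] eta_deriv[of x] S(3) T0(1) by (intro exI[of _ "Vt x"]) auto
  qed
  have inj: "inj_on eta S" by (rule inj_onI) (metis linorder_neqE mono order_less_irrefl)
  obtain t where t: "t \<in> S" "e = eta t" using e by auto
  have It: "I (eta s) = s" if "s \<in> S" for s unfolding I by (rule the_inv_into_f_f[OF inj that])
  show 1: "I e \<in> S" and 2: "eta (I e) = e" using t It by auto
  have less: "I e < T0" "I e < \<tau>" using 1 S(3) T0(1) by auto
  have "(I has_real_derivative inverse (Vt (I e))) (at (eta (I e)))"
  proof (rule real_inverse_deriv[where S = S and f = eta and x = "I e"])
    show "(eta has_real_derivative Vt (I e)) (at (I e))" using less by (intro eta_deriv)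
    show "continuous_on S eta" using isCont_eta S(3) T0(1)
      by (intro continuous_at_imp_continuous_on ballI isCont_eta) auto
    show "Vt (I e) \<noteq> 0" using bspec[OF V 1] by simp
  qed (use S 1 It in auto)
  then show 3: "(I has_real_derivative 1 / Vt (I e)) (at e)" using 2 by (simp add: inverse_eq_divide)
  have "((\<lambda>e. v (I e)) has_real_derivative - (y (I e) powr q) * (1 / Vt (I e))) (at e)"
    by (rule DERIV_chain2[where f = v and g = I, OF dv[OF less(2)] 3])
  moreover have "y (I e) powr q = e powr q * v (I e)" using eta_powr_q[OF less(2)] 2 v_pos[OF less(2)] by simp
  ultimately show "((\<lambda>e. v (I e)) has_real_derivative - (e powr q) * v (I e) / Vt (I e)) (at e)" by simp
  show "Vt (I e) = exp (lnJ (I e) (v (I e))) - g e" using Vt_eq[OF less(1)] 2 by simp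
qed

end

section \<open>Monotonicity of the slope\<close>

lemma negative_right_of_zero:
  fixes F :: "real \<Rightarrow> real"
  assumes "(F has_real_derivative D) (at x)" "D < 0" "F x = 0" "x < b"
  obtains y where "x < y" "y < b" "F y < 0"
proof -
  obtain d where d: "d > 0" "\<forall>h>0. h < d \<longrightarrow> F (x + h) < F x"
    using DERIV_neg_dec_right[OF assms(1,2)] by blast
  define h where "h = min (d / 2) ((b - x) / 2)"
  have "h > 0" "h < d" "x + h < b" using d(1) assms(4) by (auto simp: h_def min_def field_simps)
  then show thesis using that[of "x + h"] d(2) assms(3) by auto
qed

context radial_profile
begin

lemma ln_v_deriv:
  assumes "t < \<tau>"
  shows "((\<lambda>t. ln (v t)) has_real_derivative - (eta t powr q)) (at t)"
  using v_pos[OF assms] by (auto intro!: derivative_eq_intros dv[OF assms] simp: eta_powr_q[OF assms])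

lemma h_diff_ge:
  assumes "s \<le> t" "t \<le> r"
  shows "\<theta> r * (t - s) \<le> h t - h s"
proof -
  have "h s - \<theta> r * s \<le> h t - \<theta> r * t"
  proof (rule DERIV_nonneg_imp_nondecreasing[OF assms(1), of "\<lambda>t. h t - \<theta> r * t"])
    fix x assume "s \<le> x" "x \<le> t"
    then show "\<exists>y. ((\<lambda>t. h t - \<theta> r * t) has_real_derivative y) (at x) \<and> 0 \<le> y"
      using \<theta>_anti[of x r] assms by (intro exI[of _ "\<theta> x - \<theta> r"]) (auto intro!: derivative_eq_intros h_deriv)
  qed
  then show ?thesis by (simp add: algebra_simps)
qed

lemma lnJ_diff:
  assumes st: "s < t" "t < T0" and w: "u0 < w1" "w1 < w2" "w2 \<le> v t"
  shows "lnJ s (v s) - lnJ t (v t) \<le> - (h t - h s) + (slope w1 w2 - (p - 1)) * (ln (v s) - ln (v t))"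
proof -
  have v: "v t < v s" using v_strict_decr[of s t] st T0(1) by auto
  have "slope (v t) (v s) \<le> slope w1 w2" using slope_anti[OF w v] .
  moreover have "ln (v s) - ln (v t) > 0" using v w u0 by auto
  ultimately have "ln (f (v s)) - ln (f (v t)) \<le> slope w1 w2 * (ln (v s) - ln (v t))"
    unfolding slope_def[of "v t"] by (simp add: pos_divide_le_eq)
  then show ?thesis by (simp add: lnJ_def algebra_simps)
qed

text \<open>A decrease of \<open>lnJ\<close> before \<open>r0\<close> would recur at
  \<open>ts\<close>. Earlier the levels were higher, \<open>\<theta>\<close> was at least as large
  and the slope at most \<open>eta ts\<close>, so a mean loss at the rate \<open>\<epsilon>\<close>
  forces elasticities at levels up to \<open>v ts\<close> that make \<open>lnJ\<close> fall right
  after \<open>ts\<close>. As \<open>Vt ts = 0\<close>, the term \<open>g (eta t)\<close> is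
  stationary at \<open>ts\<close>, and \<open>Vt\<close> would become negative just after
  \<open>ts\<close>.\<close>

lemma lnJ_mono_before:
  assumes ts: "ts < T0" "Vt ts = 0" "\<And>t. ts < t \<Longrightarrow> t < T0 \<Longrightarrow> Vt t > 0"
    and r0: "r0 \<le> ts" "\<And>t. t < r0 \<Longrightarrow> eta t \<le> eta ts"
    and st: "s \<le> t" "t \<le> r0"
  shows "lnJ s (v s) \<le> lnJ t (v t)"
proof (rule ccontr)
  assume neg: "\<not> lnJ s (v s) \<le> lnJ t (v t)"
  then have st': "s < t" using st by (cases "s = t") auto
  have ts\<tau>: "ts < \<tau>" using ts(1) T0(1) by simp
  define z where "z = eta ts powr q"
  have z: "z > 0" using eta_pos[OF ts\<tau>] by (simp add: z_def)
  define \<epsilon> where "\<epsilon> = (lnJ s (v s) - lnJ t (v t)) / (t - s)"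
  have \<epsilon>: "\<epsilon> > 0" using neg st' by (simp add: \<epsilon>_def)
  have lnv: "ln (v s) - ln (v t) \<le> z * (t - s)"
  proof -
    have "ln (v s) + z * s \<le> ln (v t) + z * t"
    proof (rule DERIV_nonneg_imp_nondecreasing[OF st(1), of "\<lambda>t. ln (v t) + z * t"])
      fix x assume x: "s \<le> x" "x \<le> t"
      have "x < \<tau>" using x st r0 ts\<tau> by auto
      have "eta x \<le> eta ts"
      proof (cases "x < r0")
        case True then show ?thesis by (rule r0)
      next
        case False
        then have "x = r0" using x st by auto
        have "(eta \<longlongrightarrow> eta r0) (at_left r0)"
          using \<open>x < \<tau>\<close> \<open>x = r0\<close> by (intro isCont_at_left isCont_eta) simp
        moreover have "\<forall>\<^sub>F t in at_left r0. eta t \<le> eta ts"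
          using eventually_at_left_real[of "r0 - 1" r0] by (auto elim!: eventually_mono intro: r0(2))
        ultimately show ?thesis unfolding \<open>x = r0\<close> by (rule tendsto_upperbound) simp
      qed
      then have "eta x powr q \<le> z" unfolding z_def using eta_pos[OF \<open>x < \<tau>\<close>] q_pos by (intro powr_mono2) auto
      then show "\<exists>y. ((\<lambda>t. ln (v t) + z * t) has_real_derivative y) (at x) \<and> 0 \<le> y"
        by (intro exI[of _ "- (eta x powr q) + z"] conjI DERIV_add ln_v_deriv \<open>x < \<tau>\<close>)
           (auto intro!: derivative_eq_intros)
    qed
    then show ?thesis by (simp add: algebra_simps)
  qed
  have key: "\<theta> ts + \<epsilon> \<le> (slope w1 w2 - (p - 1)) * z" if w: "u0 < w1" "w1 < w2" "w2 \<le> v ts" for w1 w2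
  proof -
    define k where "k = slope w1 w2 - (p - 1)"
    have k: "k \<ge> 0" using slope_ge[OF w(1,2)] by (simp add: k_def)
    have "w2 \<le> v t" using w(3) v_decr[of t ts] st r0 ts\<tau> by auto
    then have "lnJ s (v s) - lnJ t (v t) \<le> - (h t - h s) + k * (ln (v s) - ln (v t))"
      unfolding k_def using st' st r0 ts w by (intro lnJ_diff) auto
    also have "\<dots> \<le> - (\<theta> ts * (t - s)) + k * (z * (t - s))"
      using h_diff_ge[of s t ts] st r0 lnv k by (intro add_mono mult_left_mono) auto
    finally have "lnJ s (v s) - lnJ t (v t) \<le> - (\<theta> ts * (t - s)) + k * (z * (t - s))" .
    then have "\<epsilon> * (t - s) \<le> (k * z - \<theta> ts) * (t - s)"
    proof -
      have "\<epsilon> * (t - s) = lnJ s (v s) - lnJ t (v t)" using st' by (simp add: \<epsilon>_def)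
      then show ?thesis using \<open>lnJ s (v s) - lnJ t (v t) \<le> - (\<theta> ts * (t - s)) + k * (z * (t - s))\<close>
        by (simp add: algebra_simps)
    qed
    then have "\<epsilon> \<le> k * z - \<theta> ts" using st' by simp
    then show ?thesis by (simp add: k_def)
  qed
  \<comment> \<open>\<open>k\<close> is the excess elasticity for which \<open>N\<close>, the model
    of \<open>lnJ\<close> with constant elasticity, has derivative \<open>- \<epsilon>\<close> at
    \<open>ts\<close>. By \<open>key\<close> the excess on chords below \<open>v ts\<close> is at
    least \<open>k\<close>, so \<open>F\<close> bounds \<open>Vt\<close> from above to the right of
    \<open>ts\<close>.\<close>
  define k where "k = (\<theta> ts + \<epsilon>) / z"
  define N where "N t = h t + k * ln (v t)" for t
  define F where "F t = exp (lnJ ts (v ts) + (N t - N ts)) - g (eta t)" for t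
  have dN: "(N has_real_derivative - \<epsilon>) (at ts)"
  proof -
    have "(N has_real_derivative \<theta> ts + k * (- (eta ts powr q))) (at ts)"
      unfolding N_def by (intro DERIV_add DERIV_cmult h_deriv ln_v_deriv ts\<tau>)
    moreover have "\<theta> ts + k * (- (eta ts powr q)) = - \<epsilon>" using z by (simp add: k_def z_def[symmetric])
    ultimately show ?thesis by simp
  qed
  have dg: "((\<lambda>t. g (eta t)) has_real_derivative 0) (at ts)"
  proof -
    have "(g has_real_derivative m - (p - 1) * ((1 + q) * eta ts powr (1 + q - of_nat 1) * 1)) (at (eta ts))"
      unfolding g_def[abs_def] using eta_pos[OF ts\<tau>]
      by (auto intro!: derivative_eq_intros DERIV_fun_powr)
    from DERIV_chain2[where f = g and g = eta, OF this eta_deriv[OF ts\<tau>]] show ?thesis by (simp add: ts(2))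
  qed
  have "((\<lambda>t. exp (lnJ ts (v ts) + (N t - N ts))) has_real_derivative exp (lnJ ts (v ts)) * (- \<epsilon>)) (at ts)"
    by (auto intro!: derivative_eq_intros dN)
  from DERIV_diff[OF this dg]
  have dF: "(F has_real_derivative exp (lnJ ts (v ts)) * (- \<epsilon>) - 0) (at ts)" unfolding F_def .
  have "F ts = 0" using Vt_eq[OF ts(1)] ts(2) by (simp add: F_def)
  then obtain t1 where t1: "ts < t1" "t1 < T0" "F t1 < 0"
    using negative_right_of_zero[OF dF _ _ ts(1)] \<epsilon> by auto
  have "v t1 > u0" "v t1 < v ts" using v_gt_u0 t1 v_strict_decr[of ts t1] T0(1) by auto
  then have s1: "\<theta> ts + \<epsilon> \<le> (slope (v t1) (v ts) - (p - 1)) * z" and L: "ln (v ts) - ln (v t1) > 0"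
    using key u0 by auto
  have "k \<le> slope (v t1) (v ts) - (p - 1)" unfolding k_def using s1 z by (simp add: pos_divide_le_eq)
  then have "k * (ln (v ts) - ln (v t1)) \<le> (slope (v t1) (v ts) - (p - 1)) * (ln (v ts) - ln (v t1))"
    using L by (intro mult_right_mono) auto
  also have "\<dots> = ln (f (v ts)) - ln (f (v t1)) - (p - 1) * (ln (v ts) - ln (v t1))"
  proof -
    have "slope (v t1) (v ts) * (ln (v ts) - ln (v t1)) = ln (f (v ts)) - ln (f (v t1))"
      unfolding slope_def using L by simp
    then show ?thesis by (simp only: left_diff_distrib)
  qed
  finally have "lnJ t1 (v t1) \<le> lnJ ts (v ts) + (N t1 - N ts)"
    by (simp add: lnJ_def N_def algebra_simps)
  then have "Vt t1 \<le> F t1" unfolding F_def Vt_eq[OF t1(2)] by simp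
  then show False using ts(3)[OF t1(1,2)] t1(3) by simp
qed

text \<open>Otherwise let \<open>ts\<close> be the last zero of \<open>Vt\<close> before
  \<open>T0\<close>. The slope \<open>eta ts\<close> is first attained at a time \<open>r0\<close>,
  where \<open>Vt\<close> is positive because \<open>J\<close> has been nondecreasing until then.
  Hence \<open>eta\<close> rises after \<open>r0\<close>, stops at some \<open>r1 \<le> ts\<close>,
  and passes the same slopes again after \<open>ts\<close>.\<close>

lemma Vt_pos: 
  assumes "t \<le> T0"
  shows "Vt t > 0"
proof (rule ccontr)
  assume "\<not> Vt t > 0"
  have less\<tau>: "s < \<tau>" if "s \<le> T0" for s using that T0(1) by simp
  have cont: "continuous_on {a..b} Vt" "continuous_on {a..b} (\<lambda>s. - eta s)" if "b \<le> T0" for a b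
    using less\<tau> that by (auto intro!: continuous_at_imp_continuous_on continuous_intros isCont_Vt isCont_eta)
  obtain ts where ts1: "ts < T0" and ts2: "Vt ts = 0" and ts3: "\<And>s. ts < s \<Longrightarrow> s \<le> T0 \<Longrightarrow> Vt s > 0"
    using last_crossing[OF assms cont(1)[OF order.refl], of 0] \<open>\<not> Vt t > 0\<close> Vt_T0 by (auto simp: not_less)
  have ts\<tau>: "ts < \<tau>" using ts1 T0(1) by simp
  define e0 where "e0 = eta ts"
  have e0: "e0 > 0" using eta_pos[OF ts\<tau>] by (simp add: e0_def)
  have "\<forall>\<^sub>F s in at_bot. eta s < e0" using order_tendstoD(2)[OF eta_bot e0] .
  then obtain tb0 where tb0: "\<And>s. s \<le> tb0 \<Longrightarrow> eta s < e0" unfolding eventually_at_bot_linorder by blast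
  define tb where "tb = min tb0 ts"
  have tb: "tb \<le> ts" "\<And>s. s \<le> tb \<Longrightarrow> eta s < e0" using tb0 by (auto simp: tb_def)
  obtain r0 where "tb < r0" and r0ts: "r0 \<le> ts" and etar0: "eta r0 = e0" and "\<And>s. tb \<le> s \<Longrightarrow> s < r0 \<Longrightarrow> eta s < e0"
    using first_crossing[OF tb(1) cont(2), of "- e0"] tb(2)[of tb] ts1 by (auto simp: e0_def)
  then have before: "eta s < e0" if "s < r0" for s using tb(2)[of s] that by (cases "s \<le> tb") auto
  have Vr0: "Vt r0 > 0"
  proof (rule Vt_pos_if_J_max)
    show "r0 < T0" using r0ts ts1 by simp
    fix s assume "s \<le> r0"
    show "lnJ s (v s) \<le> lnJ r0 (v r0)"
      by (rule lnJ_mono_before[OF ts1 ts2 _ r0ts _ \<open>s \<le> r0\<close> order.refl])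
         (use ts3 before in \<open>auto simp: e0_def intro: less_imp_le\<close>)
  qed
  have "ts \<le> T0" "Vt ts \<le> 0" using ts1 ts2 by auto
  then obtain r1 where r01: "r0 < r1" and "r1 \<le> ts" "Vt r1 = 0" and Vpos1: "\<And>s. r0 \<le> s \<Longrightarrow> s < r1 \<Longrightarrow> Vt s > 0"
    using first_crossing[OF r0ts cont(1) Vr0] by blast
  then have r1ts: "r1 \<le> ts" "Vt r1 \<le> 0" by auto
  have mono1: "eta s < eta t" if st: "r0 \<le> s" "s < t" "t \<le> r1" for s t
  proof (rule DERIV_pos_imp_increasing_open[OF st(2)])
    show "\<exists>y. (eta has_real_derivative y) (at x) \<and> 0 < y" if "s < x" "x < t" for x
      using eta_deriv[of x] Vpos1[of x] that st r1ts ts\<tau> by (intro exI[of _ "Vt x"]) auto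
    show "continuous_on {s..t} eta"
      using st r1ts ts\<tau> by (auto intro!: continuous_at_imp_continuous_on isCont_eta)
  qed
  have mono2: "eta s < eta t" if st: "ts \<le> s" "s < t" "t \<le> T0" for s t
  proof (rule DERIV_pos_imp_increasing_open[OF st(2)])
    show "\<exists>y. (eta has_real_derivative y) (at x) \<and> 0 < y" if "s < x" "x < t" for x
      using eta_deriv[of x] ts3[of x] that st T0(1) by (intro exI[of _ "Vt x"]) auto
    show "continuous_on {s..t} eta"
      using st T0(1) by (auto intro!: continuous_at_imp_continuous_on isCont_eta)
  qed
  define e1 where "e1 = eta r1"
  have e01: "e0 < e1" using mono1[of r0 r1] r01 etar0 by (simp add: e1_def)
  have J1: "exp (lnJ r1 (v r1)) \<le> g e1" using Vt_eq[of r1] r1ts ts1 by (simp add: e1_def)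
  \<comment> \<open>When the first passage stops, \<open>J \<le> g e1\<close>, so
    \<open>g e1 > 0\<close> and \<open>e1\<close> lies below the positive zero of \<open>g\<close>,
    whereas \<open>eta T0\<close> lies above it. Hence the second passage covers all of
    \<open>(e0, e1]\<close>.\<close>
  have e1T: "e1 < eta T0"
  proof -
    have "g e1 > 0" using J1 exp_gt_zero[of "lnJ r1 (v r1)"] by linarith
    then have "\<not> e1 powr q > m * q" using g_neg_iff[of e1] e0 e01 by auto
    then have "e1 powr q < eta T0 powr q" using eta_T0 by simp
    then show ?thesis using q_pos eta_pos[OF T0(1)] powr_mono2[of q "eta T0" e1] by (force simp: not_le[symmetric])
  qed
  define SA where "SA = {r0<..<r1}"
  define SB where "SB = {ts<..<T0}"
  define IA where "IA = the_inv_into SA eta"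
  define IB where "IB = the_inv_into SB eta"
  have imgA: "e \<in> eta ` SA" if "e0 < e" "e < e1" for e
  proof -
    have "\<exists>t\<ge>r0. t \<le> r1 \<and> eta t = e"
      by (rule IVT) (use that r01 etar0 r1ts ts\<tau> in \<open>auto simp: e1_def intro: isCont_eta\<close>)
    then obtain t where "r0 \<le> t" "t \<le> r1" "eta t = e" by blast
    moreover have "t \<noteq> r0" "t \<noteq> r1" using that calculation etar0 by (auto simp: e1_def)
    ultimately show ?thesis by (auto simp: SA_def)
  qed
  have imgB: "e \<in> eta ` SB" if "e0 < e" "e \<le> e1" for e
  proof -
    have "\<exists>t\<ge>ts. t \<le> T0 \<and> eta t = e"
      by (rule IVT) (use that e1T ts1 T0(1) in \<open>auto simp: e0_def intro: isCont_eta\<close>)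
    then obtain t where "ts \<le> t" "t \<le> T0" "eta t = e" by blast
    moreover have "t \<noteq> ts" "t \<noteq> T0" using that calculation e1T by (auto simp: e0_def)
    ultimately show ?thesis by (auto simp: SB_def)
  qed
  have VA: "\<forall>t\<in>SA. Vt t > 0" and VB: "\<forall>t\<in>SB. Vt t > 0"
    using Vpos1 ts3 by (auto simp: SA_def SB_def)
  have subA: "open SA" "convex SA" "SA \<subseteq> {..<T0}" and subB: "open SB" "convex SB" "SB \<subseteq> {..<T0}"
    using r1ts ts1 by (auto simp: SA_def SB_def)
  note A = arc[OF subA VA IA_def imgA] and B = arc[OF subB VB IB_def imgB]
  have AB: "IA e < IB e" if "e0 < e" "e < e1" for e
    using A(1)[OF that] B(1)[of e] that r1ts by (auto simp: SA_def SB_def)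
  have WAB: "v (IB e) < v (IA e)" if "e0 < e" "e < e1" for e
    using AB[OF that] B(1)[of e] that T0(1) by (intro v_strict_decr) (auto simp: SB_def)
  text \<open>The first passage through the slopes in \<open>(e0, e1)\<close> starts with the larger \<open>J\<close> and ends with
    the smaller one, contradicting the comparison of arcs.\<close>
  obtain ea where ea: "e0 < ea" "ea < e1" "lnJ (IB ea) (v (IB ea)) < lnJ (IA ea) (v (IA ea))"
  proof -
    have "exp (lnJ ts (v ts)) < exp (lnJ r0 (v r0))"
      using Vr0 Vt_eq[of r0] Vt_eq[OF ts1] ts2 r0ts ts1 etar0 by (simp add: e0_def)
    then obtain c where c: "lnJ ts (v ts) < c" "c < lnJ r0 (v r0)" using dense by auto
    have "\<forall>\<^sub>F s in at_right ts. lnJ s (v s) < c \<and> s < T0"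
      using order_tendstoD(2)[OF isCont_lnJ[OF ts1, unfolded isCont_def] c(1)]
        eventually_at_right_real[OF ts1]
      by (auto simp: eventually_at_filter elim: eventually_elim2)
    then obtain b where b: "b > ts" "\<And>s. ts < s \<Longrightarrow> s < b \<Longrightarrow> lnJ s (v s) < c \<and> s < T0"
      unfolding eventually_at_right_field by blast
    have "r0 < T0" using r0ts ts1 by simp
    have "\<forall>\<^sub>F s in at_right r0. lnJ s (v s) > c \<and> s < r1"
      using order_tendstoD(1)[OF isCont_lnJ[OF \<open>r0 < T0\<close>, unfolded isCont_def] c(2)]
        eventually_at_right_real[OF r01]
      by (auto simp: eventually_at_filter elim: eventually_elim2)
    then obtain a where a: "a > r0" "\<And>s. r0 < s \<Longrightarrow> s < a \<Longrightarrow> lnJ s (v s) > c \<and> s < r1"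
      unfolding eventually_at_right_field by blast
    define sb where "sb = (ts + b) / 2"
    define sa where "sa = (r0 + a) / 2"
    have sb: "ts < sb" "sb < b" "sb < T0" and sa: "r0 < sa" "sa < a" "sa < r1"
      using a(1) b(1) b(2)[of sb] a(2)[of sa] by (auto simp: sb_def sa_def field_simps)
    have "e0 < min (eta sa) (eta sb)" using mono1[of r0 sa] mono2[of ts sb] sa sb etar0 by (auto simp: e0_def)
    then obtain e where e: "e0 < e" "e < eta sa" "e < eta sb" using dense by (metis min_less_iff_conj)
    have ee: "e < e1" using e(2) mono1[of sa r1] sa by (simp add: e1_def)
    have "IA e < sa"
      using A(1,2)[OF e(1) ee] e(2) mono1[of sa "IA e"] sa by (cases "IA e = sa"; force simp: SA_def not_less)
    moreover have "IB e < sb"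
      using B(1,2)[of e] ee e(1,3) mono2[of sb "IB e"] sb by (cases "IB e = sb"; force simp: SB_def not_less)
    ultimately have "lnJ (IB e) (v (IB e)) < c" "c < lnJ (IA e) (v (IA e))"
      using a(2)[of "IA e"] b(2)[of "IB e"] A(1)[OF e(1) ee] B(1)[of e] e(1) ee sa sb by (auto simp: SA_def SB_def)
    then show thesis using that[of e] e(1) ee by simp
  qed
  obtain eb where eb: "ea < eb" "eb < e1" "lnJ (IA eb) (v (IA eb)) < lnJ (IB eb) (v (IB eb))"
  proof -
    have e01': "e0 < e1" "e1 \<le> e1" using e01 by auto
    have IB1: "IB e1 \<in> SB" using B(1)[OF e01'] .
    have "exp (lnJ r1 (v r1)) < exp (lnJ (IB e1) (v (IB e1)))"
      using J1 bspec[OF VB IB1] B(5)[OF e01'] by linarith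
    then obtain c where c: "lnJ r1 (v r1) < c" "c < lnJ (IB e1) (v (IB e1))" using dense by auto
    have "isCont (\<lambda>e. lnJ (IB e) (v (IB e))) e1"
      by (rule isCont_o2[OF DERIV_isCont[OF B(3)[OF e01']], of "\<lambda>t. lnJ t (v t)"])
         (use IB1 in \<open>auto intro: isCont_lnJ simp: SB_def\<close>)
    from order_tendstoD(1)[OF isCont_at_left[OF this] c(2)]
    have 1: "\<forall>\<^sub>F e in at_left e1. c < lnJ (IB e) (v (IB e))" .
    have "r1 < T0" using r1ts ts1 by simp
    from order_tendstoD(2)[OF isCont_at_left[OF isCont_lnJ[OF this]] c(1)] obtain a where a: "a < r1" "\<And>s. a < s \<Longrightarrow> s < r1 \<Longrightarrow> lnJ s (v s) < c"
      unfolding eventually_at_left_field by blast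
    define sa where "sa = max (IA ea) (max a ((r0 + r1) / 2))"
    have sa: "r0 < sa" "a \<le> sa" "sa < r1" "IA ea \<le> sa"
      using a(1) r01 A(1)[OF ea(1,2)] by (auto simp: sa_def SA_def)
    have es: "eta sa < e1" using mono1[of sa r1] sa by (simp add: e1_def)
    have "\<forall>\<^sub>F e in at_left e1. e \<in> {eta sa<..<e1}" by (rule eventually_at_left_real[OF es])
    with 1 have "\<forall>\<^sub>F e in at_left e1. c < lnJ (IB e) (v (IB e)) \<and> eta sa < e \<and> e < e1" by eventually_elim auto
    then obtain e where e: "c < lnJ (IB e) (v (IB e))" "eta sa < e" "e < e1"
      using eventually_happens[of _ "at_left e1"] by auto
    have "eta (IA ea) \<le> eta sa"
      using mono1[of "IA ea" sa] sa A(1)[OF ea(1,2)] by (cases "IA ea = sa") (auto simp: SA_def)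
    then have ea_e: "ea < e" using A(2)[OF ea(1,2)] e(2) by simp
    have "sa < IA e"
      using A(1,2)[of e] ea(1) ea_e e mono1[of "IA e" sa] sa by (cases "IA e = sa"; force simp: SA_def not_less)
    then have "lnJ (IA e) (v (IA e)) < c" using a(2)[of "IA e"] sa A(1)[of e] ea(1) ea_e e(3) by (auto simp: SA_def)
    then show thesis using that[of e] ea_e e by simp
  qed
  define wc where "wc = v (IB eb)"
  have in_eb: "e0 < e \<and> e < e1" if "ea \<le> e" "e \<le> eb" for e using that ea eb by auto
  have ebB: "e0 < eb" "eb \<le> e1" using ea eb by auto
  have wc: "wc > u0" using B(1)[OF ebB] v_gt_u0 by (simp add: wc_def SB_def)
  define wb where "wb = (u0 + wc) / 2"
  have wb: "u0 < wb" "wb < wc" using wc by (auto simp: wb_def)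
  define \<kappa> where "\<kappa> = slope wb wc - (p - 1)"
  define V1 where "V1 e = exp (lnJ (IA e) (v (IA e))) - g e" for e
  define V2 where "V2 e = exp (lnJ (IB e) (v (IB e))) - g e" for e
  have V1: "V1 e = Vt (IA e)" "V1 e > 0" if "e0 < e" "e < e1" for e
    using A(5)[OF that] bspec[OF VA A(1)[OF that]] by (simp_all add: V1_def)
  have V2: "V2 e = Vt (IB e)" "V2 e > 0" if "e0 < e" "e < e1" for e
    using B(5)[of e] bspec[OF VB B(1)[of e]] that by (simp_all add: V2_def)
  \<comment> \<open>The velocity of the second arc vanishes as \<open>e\<close> tends to
    \<open>e0\<close>, that of the first as \<open>e\<close> tends to \<open>e1\<close>. Both are
    bounded away from \<open>0\<close> on \<open>[ea, eb]\<close>, which yields the Gronwall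
    constant \<open>C\<close>.\<close>
  have "isCont (\<lambda>e. \<kappa> * e powr q * exp (lnJ (IB e) (v (IB e))) / (V1 e * V2 e)) e" if "ea \<le> e" "e \<le> eb" for e
  proof -
    have i: "e0 < e" "e < e1" "e0 < e" "e \<le> e1" using in_eb[OF that] by auto
    have 1: "isCont (\<lambda>e. lnJ (IA e) (v (IA e))) e"
      by (rule isCont_o2[OF DERIV_isCont[OF A(3)[OF i(1,2)]], of "\<lambda>t. lnJ t (v t)"])
         (use A(1)[OF i(1,2)] subA(3) in \<open>auto intro: isCont_lnJ\<close>)
    have 2: "isCont (\<lambda>e. lnJ (IB e) (v (IB e))) e"
      by (rule isCont_o2[OF DERIV_isCont[OF B(3)[OF i(3,4)]], of "\<lambda>t. lnJ t (v t)"])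
         (use B(1)[OF i(3,4)] subB(3) in \<open>auto intro: isCont_lnJ\<close>)
    show ?thesis unfolding V1_def V2_def
      using V1(2)[OF i(1,2)] V2(2)[OF i(1,2)] i e0 unfolding V1_def V2_def
      by (intro continuous_intros 1 2 isCont_g) auto
  qed
  then have "\<exists>C\<ge>0. \<forall>e\<in>{ea..eb}. \<kappa> * e powr q * exp (lnJ (IB e) (v (IB e))) / (V1 e * V2 e) \<le> C"
    by (intro continuous_bounded_above) auto
  then obtain C where C: "C \<ge> 0" "\<And>e. ea \<le> e \<Longrightarrow> e \<le> eb \<Longrightarrow> \<kappa> * e powr q * exp (lnJ (IB e) (v (IB e))) / (V1 e * V2 e) \<le> C"
    by auto
  have "lnJ (IA eb) (v (IA eb)) - lnJ (IB eb) (v (IB eb)) \<ge> - 0 * exp (C * (eb - ea))"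
  proof (rule arcs_compare[OF _ _ V1_def V2_def _ _ _ _ _ _ _ _ wb _ \<kappa>_def C(1)])
    fix e assume "ea \<le> e" "e \<le> eb"
    then have i: "e0 < e" "e < e1" "e0 < e" "e \<le> e1" using in_eb[of e] by auto
    show "(IA has_real_derivative 1 / V1 e) (at e)" "((\<lambda>e. v (IA e)) has_real_derivative - (e powr q) * v (IA e) / V1 e) (at e)"
      using A(3,4)[OF i(1,2)] V1(1)[OF i(1,2)] by auto
    show "(IB has_real_derivative 1 / V2 e) (at e)" "((\<lambda>e. v (IB e)) has_real_derivative - (e powr q) * v (IB e) / V2 e) (at e)"
      using B(3,4)[OF i(3,4)] V2(1)[OF i(1,2)] by auto
    show "0 < V1 e" "0 < V2 e" using V1(2) V2(2) i by auto
    show "IA e \<le> IB e" "v (IB e) < v (IA e)" using AB WAB i by (auto intro: less_imp_le)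
    show "wc \<le> v (IB e)" unfolding wc_def
    proof (cases "e = eb")
      case False
      then have lt: "eta (IB e) < eta (IB eb)" using B(2)[OF i(3,4)] B(2)[OF ebB] \<open>e \<le> eb\<close> by simp
      have "IB e \<le> IB eb"
      proof (rule ccontr)
        assume "\<not> IB e \<le> IB eb"
        then show False using mono2[of "IB eb" "IB e"] lt B(1)[OF i(3,4)] B(1)[OF ebB] by (auto simp: SB_def)
      qed
      then show "v (IB eb) \<le> v (IB e)" using B(1)[OF ebB] T0(1) by (intro v_decr) (auto simp: SB_def)
    qed simp
  next
    fix e assume "ea \<le> e" "e < eb"
    then show "\<kappa> * e powr q \<le> \<theta> (IB e) \<or> \<kappa> * e powr q * exp (lnJ (IB e) (v (IB e))) \<le> C * (V1 e * V2 e)"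
      using C(2)[of e] V1(2)[of e] V2(2)[of e] in_eb[of e] by (simp add: pos_divide_le_eq)
  qed (use ea eb e0 in auto)
  then show False using eb(3) by simp
qed

lemma eta_strict_mono:
  assumes "s < t" "t \<le> T0"
  shows "eta s < eta t"
proof (rule DERIV_pos_imp_increasing[OF assms(1)])
  fix x assume "s \<le> x" "x \<le> t"
  then show "\<exists>y. (eta has_real_derivative y) (at x) \<and> 0 < y"
    using eta_deriv[of x] Vt_pos[of x] assms T0(1) by (intro exI[of _ "Vt x"]) auto
qed

end

section \<open>Behaviour at the centre\<close>

lemma nondecreasing_half_open:
  fixes \<psi> :: "real \<Rightarrow> real"
  assumes "a \<le> b" "continuous_on {a..b} \<psi>"
    and "\<And>x. a \<le> x \<Longrightarrow> x < b \<Longrightarrow> \<exists>k. (\<psi> has_real_derivative k) (at x) \<and> k \<ge> 0"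
  shows "\<psi> a \<le> \<psi> b"
  using assms(1,2)
proof (rule right_minorant_mono)
  fix x assume "a \<le> x" "x < b"
  then show "\<exists>M k. (M has_real_derivative k) (at x) \<and> 0 \<le> k \<and> (\<forall>\<^sub>F y in at_right x. M y - M x \<le> \<psi> y - \<psi> x)"
    using assms(3)[of x] by (intro exI[of _ \<psi>]) auto
qed

text \<open>This replaces integration from the centre, which lies at \<open>- \<infinity>\<close> in
  the variable \<open>t\<close>.\<close>

lemma nonneg_from_at_bot:
  fixes X :: "real \<Rightarrow> real"
  assumes "\<And>s. s \<le> t \<Longrightarrow> \<exists>k. (X has_real_derivative k) (at s) \<and> k \<ge> 0"
    and "(Y \<longlongrightarrow> 0) at_bot" "\<And>s. s \<le> t \<Longrightarrow> Y s \<le> X s"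
  shows "X t \<ge> 0"
proof -
  have "\<forall>\<^sub>F s in at_bot. Y s \<le> X t"
    using eventually_le_at_bot[of t]
  proof (rule eventually_mono)
    fix s assume s: "s \<le> t"
    have "X s \<le> X t" by (rule DERIV_nonneg_imp_nondecreasing[OF s assms(1)])
    then show "Y s \<le> X t" using assms(3)[OF s] by simp
  qed
  then show ?thesis by (rule tendsto_upperbound[OF assms(2)]) simp
qed

section \<open>The weight r^n K(r) and its integral from the centre\<close>

context radial_ode
begin

definition "N t = exp (m * t + h t)"

lemma N_pos: "N t > 0" by (simp add: N_def)

lemma N_deriv: "(N has_real_derivative (m + \<theta> t) * N t) (at t)"
  unfolding N_def[abs_def] by (auto intro!: derivative_eq_intros h_deriv)

text \<open>Integrability at the centre comes from \<open>N' \<ge> m * N\<close>: the function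
  \<open>F - N / m\<close> is nonincreasing, which bounds \<open>F\<close> from below, and
  subtracting the infimum of \<open>F\<close> normalises it.\<close>

lemma antiderivative_N:
  obtains Q where "\<And>t. (Q has_real_derivative N t) (at t)" "\<And>t. Q t > 0" "(Q \<longlongrightarrow> 0) at_bot"
proof -
  have "isCont N t" for t using N_deriv by (rule DERIV_isCont)
  then obtain F where F: "\<And>t. (F has_real_derivative N t) (at t)"
    using einterval_antiderivative[of "-\<infinity>" \<infinity> N] by (auto simp: has_real_derivative_iff_has_vector_derivative)
  have mono: "F s \<le> F t" if "s \<le> t" for s t
    by (rule DERIV_nonneg_imp_nondecreasing[OF that], rule exI, rule conjI[OF F less_imp_le[OF N_pos]])
  have strict: "F s < F t" if "s < t" for s t
    by (rule DERIV_pos_imp_increasing[OF that], rule exI, rule conjI[OF F N_pos])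
  have low: "F 0 - N 0 / m \<le> F t" if "t \<le> 0" for t
  proof -
    have "F t - N t / m \<ge> F 0 - N 0 / m"
    proof (rule DERIV_nonpos_imp_nonincreasing[OF that, of "\<lambda>t. F t - N t / m"])
      fix x
      have "((\<lambda>t. F t - N t / m) has_real_derivative N x - (m + \<theta> x) * N x / m) (at x)"
        by (intro DERIV_diff F DERIV_cdivide N_deriv)
      moreover have "N x - (m + \<theta> x) * N x / m = - (\<theta> x * N x / m)" using m0 by (simp add: field_simps)
      moreover have "\<theta> x * N x / m > 0" using \<theta>_pos[of x] N_pos[of x] m0 by simp
      ultimately show "\<exists>y. ((\<lambda>t. F t - N t / m) has_real_derivative y) (at x) \<and> y \<le> 0" by force
    qed
    moreover have "N t / m > 0" using N_pos m0 by simp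
    ultimately show ?thesis by linarith
  qed
  define c where "c = Inf (range F)"
  have bb: "bdd_below (range F)"
  proof (rule bdd_belowI2)
    fix t :: real
    show "F 0 - N 0 / m \<le> F t"
    proof (cases "t \<le> 0")
      case False
      then show ?thesis using low[of 0] mono[of 0 t] by simp
    qed (rule low)
  qed
  have cle: "c \<le> F t" for t unfolding c_def using bb by (intro cInf_lower) auto
  have "(F \<longlongrightarrow> c) at_bot"
  proof (rule decreasing_tendsto)
    fix x assume "c < x"
    then obtain t where "F t < x" using cInf_lessD[of "range F" x] unfolding c_def by auto
    then have "F n < x" if "n \<le> t" for n using mono[OF that] by simp
    then show "\<forall>\<^sub>F n in at_bot. F n < x" unfolding eventually_at_bot_linorder by blast
  qed (use cle in simp)
  then have "((\<lambda>t. F t - c) \<longlongrightarrow> 0) at_bot" using tendsto_diff[of F c at_bot "\<lambda>_. c" c] by simp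
  moreover have "((\<lambda>t. F t - c) has_real_derivative N t) (at t)" for t
    by (auto intro!: derivative_eq_intros F)
  moreover have "F t - c > 0" for t using cle[of "t - 1"] strict[of "t - 1" t] by simp
  ultimately show thesis using that[of "\<lambda>t. F t - c"] by auto
qed

text \<open>The integral of \<open>r^(n-1) K(r)\<close> from the centre. The choice is harmless:
  antiderivatives differ by constants, and the limit \<open>0\<close> fixes the constant.\<close>

definition "Q = (SOME Q. (\<forall>t. (Q has_real_derivative N t) (at t)) \<and> (\<forall>t. Q t > 0) \<and> (Q \<longlongrightarrow> 0) at_bot)"

lemma Q: "(Q has_real_derivative N t) (at t)" "Q t > 0" "(Q \<longlongrightarrow> 0) at_bot"
proof -
  have "\<exists>Q. (\<forall>t. (Q has_real_derivative N t) (at t)) \<and> (\<forall>t. Q t > 0) \<and> (Q \<longlongrightarrow> 0) at_bot"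
    using antiderivative_N by metis
  from someI_ex[OF this] show "(Q has_real_derivative N t) (at t)" "Q t > 0" "(Q \<longlongrightarrow> 0) at_bot"
    unfolding Q_def by blast+
qed

text \<open>Integrated form of \<open>N' = (m + \<theta>) * N\<close>: on the way from the centre to
  \<open>t\<close>, the nonincreasing \<open>\<theta>\<close> is smallest at \<open>t\<close>. It
  makes the logarithmic derivative \<open>N / Q\<close> of \<open>Q\<close> nonincreasing.\<close>

lemma N_ge: "(m + \<theta> t) * Q t \<le> N t"
proof -
  have "N t - (m + \<theta> t) * Q t \<ge> 0"
  proof (rule nonneg_from_at_bot[of t "\<lambda>s. N s - (m + \<theta> t) * Q s"])
    fix s assume s: "s \<le> t"
    have "((\<lambda>s. N s - (m + \<theta> t) * Q s) has_real_derivative (m + \<theta> s) * N s - (m + \<theta> t) * N s) (at s)"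
      by (intro DERIV_diff DERIV_cmult N_deriv Q)
    moreover have "(m + \<theta> t) * N s \<le> (m + \<theta> s) * N s" using \<theta>_anti[OF s] N_pos[of s] by (intro mult_right_mono) auto
    ultimately show "\<exists>k. ((\<lambda>s. N s - (m + \<theta> t) * Q s) has_real_derivative k) (at s) \<and> k \<ge> 0" by force
    show "- ((m + \<theta> t) * Q s) \<le> N s - (m + \<theta> t) * Q s" using N_pos[of s] by simp
  next
    show "((\<lambda>s. - ((m + \<theta> t) * Q s)) \<longlongrightarrow> 0) at_bot"
      using tendsto_minus[OF tendsto_mult_right_zero[OF Q(3), of "m + \<theta> t"]] by simp
  qed
  then show ?thesis by simp
qed

lemma N_div_Q_antimono:
  assumes "s \<le> t"
  shows "N t / Q t \<le> N s / Q s"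
proof (rule DERIV_nonpos_imp_nonincreasing[OF assms, of "\<lambda>t. N t / Q t"])
  fix x
  have "((\<lambda>t. N t / Q t) has_real_derivative (((m + \<theta> x) * N x) * Q x - N x * N x) / (Q x * Q x)) (at x)"
    using Q(2)[of x] by (intro DERIV_divide N_deriv Q) simp
  moreover have "((m + \<theta> x) * N x) * Q x - N x * N x = N x * ((m + \<theta> x) * Q x - N x)" by (simp add: algebra_simps)
  moreover have "\<dots> \<le> 0" using N_ge[of x] N_pos[of x] by (intro mult_nonneg_nonpos) auto
  ultimately show "\<exists>y. ((\<lambda>t. N t / Q t) has_real_derivative y) (at x) \<and> y \<le> 0"
    using Q(2)[of x] by (metis divide_nonpos_pos mult_pos_pos)
qed

lemma exp_Q_mono:
  assumes "s \<le> t"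
  shows "exp (- m * s) * Q s \<le> exp (- m * t) * Q t"
proof (rule DERIV_nonneg_imp_nondecreasing[OF assms, of "\<lambda>t. exp (- m * t) * Q t"])
  fix x
  have "((\<lambda>t. exp (- m * t) * Q t) has_real_derivative exp (- m * x) * (N x - m * Q x)) (at x)"
    by (auto intro!: derivative_eq_intros Q simp: algebra_simps)
  moreover have "0 < \<theta> x * Q x" using \<theta>_pos[of x] Q(2)[of x] by (rule mult_pos_pos)
  then have "m * Q x \<le> N x" using N_ge[of x, unfolded distrib_right] by linarith
  ultimately show "\<exists>y. ((\<lambda>t. exp (- m * t) * Q t) has_real_derivative y) (at x) \<and> 0 \<le> y" by force
qed

lemma f_mono:
  assumes "u0 < b" "b \<le> c"
  shows "f b \<le> f c"
proof -
  have "ln (b - u0) \<le> ln (c - u0)" using assms by simp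
  then have "(p - 1) * ln (b - u0) \<le> (p - 1) * ln (c - u0)" using p1 by (intro mult_left_mono) auto
  then have "ln (f b) \<le> ln (f c)" using f_ratio[OF assms] by simp
  then show ?thesis using f_pos[of b] f_pos[of c] assms by simp
qed

text \<open>Strictness comes from \<open>u0 > 0\<close>; it separates profiles of different heights
  at the centre.\<close>

lemma f_ratio_strict:
  assumes "u0 < b" "b < c"
  shows "f b * b powr (1 - p) < f c * c powr (1 - p)"
proof -
  have bc: "b > 0" "c > 0" using assms u0 by auto
  have "c / b < (c - u0) / (b - u0)" using assms u0 by (simp add: field_simps)
  then have "ln (c / b) < ln ((c - u0) / (b - u0))" using assms u0 by (subst ln_less_cancel_iff) auto
  then have "(p - 1) * (ln c - ln b) < (p - 1) * (ln (c - u0) - ln (b - u0))"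
    using assms u0 p1 by (intro mult_strict_left_mono) (auto simp: ln_div)
  also have "\<dots> \<le> ln (f c) - ln (f b)" using f_ratio[of b c] assms by (simp add: algebra_simps)
  finally have "ln (f b) + (1 - p) * ln b < ln (f c) + (1 - p) * ln c" by (simp add: algebra_simps)
  moreover have "f b * b powr (1 - p) = exp (ln (f b) + (1 - p) * ln b)" "f c * c powr (1 - p) = exp (ln (f c) + (1 - p) * ln c)"
    using f_pos[of b] f_pos[of c] assms bc by (simp_all add: exp_add powr_def)
  ultimately show ?thesis by simp
qed

end

section \<open>Asymptotics at the centre and the parametrisation by slope\<close>

context radial_profile
begin

lemma omega_bot: "((\<lambda>t. exp (m * t) * y t) \<longlongrightarrow> 0) at_bot"
proof (rule tendsto_sandwich[OF _ _ tendsto_const y_bot])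
  show "\<forall>\<^sub>F t in at_bot. 0 \<le> exp (m * t) * y t"
    using eventually_gt_at_bot[of \<tau>] by (rule eventually_mono) (auto intro!: mult_nonneg_nonneg less_imp_le[OF y_pos])
  show "\<forall>\<^sub>F t in at_bot. exp (m * t) * y t \<le> y t"
    using eventually_conj[OF eventually_gt_at_bot[of \<tau>] eventually_le_at_bot[of 0]]
  proof (rule eventually_mono)
    fix t assume t: "t < \<tau> \<and> t \<le> 0"
    then have "exp (m * t) \<le> 1" using m0 by (simp add: mult_le_0_iff)
    then show "exp (m * t) * y t \<le> y t" using y_pos[of t] t by (simp add: mult_left_le_one_le)
  qed
qed

lemma omega_deriv_N:
  assumes "t < \<tau>"
  shows "((\<lambda>t. exp (m * t) * y t) has_real_derivative N t * f (v t)) (at t)"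
  using omega_deriv[OF assms] by (simp add: N_def exp_add mult.assoc)

text \<open>Close to the centre \<open>f (v t)\<close> agrees with its limit up to the factor
  \<open>1 - \<delta>\<close>; integration from the centre transfers this to the flux
  \<open>exp (m * t) * y t\<close> and \<open>f \<alpha> * Q t\<close>.\<close>

lemma near_bot:
  assumes \<delta>: "0 < \<delta>" "\<delta> < 1"
  obtains t0 where "t0 < T0"
    "\<And>t. t \<le> t0 \<Longrightarrow> (1 - \<delta>) * f \<alpha> \<le> f (v t)" "\<And>t. t \<le> t0 \<Longrightarrow> f (v t) \<le> f \<alpha>"
    "\<And>t. t \<le> t0 \<Longrightarrow> (1 - \<delta>) * f \<alpha> * Q t \<le> exp (m * t) * y t"
    "\<And>t. t \<le> t0 \<Longrightarrow> exp (m * t) * y t \<le> f \<alpha> * Q t"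
    "\<And>t. t \<le> t0 \<Longrightarrow> (1 - \<delta>) * \<alpha> \<le> v t"
proof -
  have f\<alpha>: "f \<alpha> > 0" using f_pos \<alpha> by simp
  have \<alpha>0: "\<alpha> > 0" using \<alpha> u0 by simp
  have "((\<lambda>t. f (v t)) \<longlongrightarrow> f \<alpha>) at_bot" by (rule isCont_tendsto_compose[OF isCont_f[OF \<alpha>0] v_bot])
  moreover have "(1 - \<delta>) * f \<alpha> < f \<alpha>" "(1 - \<delta>) * \<alpha> < \<alpha>" using \<delta> f\<alpha> \<alpha>0 by auto
  ultimately have "\<forall>\<^sub>F t in at_bot. (1 - \<delta>) * f \<alpha> < f (v t) \<and> (1 - \<delta>) * \<alpha> < v t \<and> t < T0"
    using order_tendstoD(1) v_bot eventually_gt_at_bot[of T0] by (intro eventually_conj) blast+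
  then obtain t0 where t0: "\<And>t. t \<le> t0 \<Longrightarrow> (1 - \<delta>) * f \<alpha> < f (v t) \<and> (1 - \<delta>) * \<alpha> < v t \<and> t < T0"
    unfolding eventually_at_bot_linorder by blast
  have low: "(1 - \<delta>) * f \<alpha> \<le> f (v t)" and T: "t < T0" "t < \<tau>" and up: "f (v t) \<le> f \<alpha>" if "t \<le> t0" for t
    using t0[OF that] f_mono[of "v t" \<alpha>] v_gt_u0[of t] v_less_\<alpha>[of t] T0(1) by auto
  have 1: "(1 - \<delta>) * f \<alpha> * Q t \<le> exp (m * t) * y t" if t: "t \<le> t0" for t
  proof -
    have "exp (m * t) * y t - (1 - \<delta>) * f \<alpha> * Q t \<ge> 0"
    proof (rule nonneg_from_at_bot[of t "\<lambda>t. exp (m * t) * y t - (1 - \<delta>) * f \<alpha> * Q t"])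
      show "((\<lambda>t. - ((1 - \<delta>) * f \<alpha> * Q t)) \<longlongrightarrow> 0) at_bot"
        using tendsto_minus[OF tendsto_mult_right_zero[OF Q(3), of "(1 - \<delta>) * f \<alpha>"]] by simp
      fix s assume s: "s \<le> t"
      then have s': "s \<le> t0" "s < \<tau>" using t T by auto
      have "((\<lambda>t. exp (m * t) * y t - (1 - \<delta>) * f \<alpha> * Q t) has_real_derivative N s * f (v s) - (1 - \<delta>) * f \<alpha> * N s) (at s)"
        by (intro DERIV_diff omega_deriv_N s' DERIV_cmult Q)
      moreover have "N s * f (v s) - (1 - \<delta>) * f \<alpha> * N s \<ge> 0"
        using mult_left_mono[OF low[OF s'(1)], of "N s"] N_pos[of s] by (simp add: mult.commute)
      ultimately show "\<exists>k. ((\<lambda>t. exp (m * t) * y t - (1 - \<delta>) * f \<alpha> * Q t) has_real_derivative k) (at s) \<and> k \<ge> 0"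
        by blast
      show "- ((1 - \<delta>) * f \<alpha> * Q s) \<le> exp (m * s) * y s - (1 - \<delta>) * f \<alpha> * Q s" using y_pos[OF s'(2)] by simp
    qed
    then show ?thesis by simp
  qed
  have 2: "exp (m * t) * y t \<le> f \<alpha> * Q t" if t: "t \<le> t0" for t
  proof -
    have "f \<alpha> * Q t - exp (m * t) * y t \<ge> 0"
    proof (rule nonneg_from_at_bot[of t "\<lambda>t. f \<alpha> * Q t - exp (m * t) * y t"])
      show "((\<lambda>t. - (exp (m * t) * y t)) \<longlongrightarrow> 0) at_bot"
        using tendsto_minus[OF omega_bot] by simp
      fix s assume s: "s \<le> t"
      then have s': "s \<le> t0" "s < \<tau>" using t T by auto
      have "((\<lambda>t. f \<alpha> * Q t - exp (m * t) * y t) has_real_derivative f \<alpha> * N s - N s * f (v s)) (at s)"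
        by (intro DERIV_diff omega_deriv_N s' DERIV_cmult Q)
      moreover have "f \<alpha> * N s - N s * f (v s) \<ge> 0"
        using mult_left_mono[OF up[OF s'(1)], of "N s"] N_pos[of s] by (simp add: mult.commute)
      ultimately show "\<exists>k. ((\<lambda>t. f \<alpha> * Q t - exp (m * t) * y t) has_real_derivative k) (at s) \<and> k \<ge> 0"
        by blast
      show "- (exp (m * s) * y s) \<le> f \<alpha> * Q s - exp (m * s) * y s" using f\<alpha> Q(2)[of s] by simp
    qed
    then show ?thesis by simp
  qed
  have 3: "(1 - \<delta>) * \<alpha> \<le> v t" if "t \<le> t0" for t using t0[OF that] by simp
  show thesis by (rule that[OF T(1)[OF order.refl] low up 1 2 3])
qed

text \<open>The numerator is the derivative of the flux \<open>exp (m * t) * y t\<close>, so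
  \<open>J / e\<close> is the logarithmic derivative of the flux, which is asymptotic to
  \<open>N / Q\<close> at the centre.\<close>

lemma lnJ_minus_ln_eta:
  assumes "t < T0"
  shows "lnJ t (v t) - ln (eta t) = ln (N t * f (v t) / (exp (m * t) * y t))"
proof -
  have pos: "f (v t) > 0" "v t > 0" "y t > 0" using f_pos v_gt_u0[OF assms] v_pos y_pos assms T0(1) by auto
  have "ln (eta t) = ln (y t) + (1 - p) * ln (v t)" using pos by (simp add: eta_def ln_mult ln_powr)
  moreover have "ln (N t * f (v t) / (exp (m * t) * y t)) = (m * t + h t) + ln (f (v t)) - (m * t + ln (y t))"
    using pos by (simp add: ln_mult ln_div N_def)
  ultimately show ?thesis by (simp add: lnJ_def algebra_simps)
qed

definition "I = the_inv_into {..<T0} eta"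

lemma I_range:
  assumes "0 < e" "e < eta T0"
  shows "e \<in> eta ` {..<T0}"
proof -
  have "\<forall>\<^sub>F t in at_bot. eta t < e \<and> t < T0"
    using order_tendstoD(2)[OF eta_bot assms(1)] eventually_gt_at_bot[of T0] by eventually_elim auto
  then obtain a where a: "eta a < e" "a < T0" using eventually_happens[of _ "at_bot :: real filter"] by auto
  have "\<exists>t\<ge>a. t \<le> T0 \<and> eta t = e"
    by (rule IVT) (use a assms T0(1) isCont_eta in auto)
  then obtain t where "t \<le> T0" "eta t = e" by blast
  then show ?thesis using assms by (cases "t = T0") auto
qed

lemma I_arc:
  assumes "0 < e" "e < eta T0"
  shows "I e < T0" "eta (I e) = e" "(I has_real_derivative 1 / Vt (I e)) (at e)"
    "((\<lambda>e. v (I e)) has_real_derivative - (e powr q) * v (I e) / Vt (I e)) (at e)"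
    "Vt (I e) = exp (lnJ (I e) (v (I e))) - g e" "Vt (I e) > 0"
proof -
  have V: "\<forall>t\<in>{..<T0}. Vt t > 0" using Vt_pos by simp
  note a = arc[of "{..<T0}" I e, OF open_lessThan convex_real_interval(4) order.refl V I_def I_range[OF assms]]
  show "I e < T0" using a(1) by simp
  then show "Vt (I e) > 0" using Vt_pos by simp
  show "eta (I e) = e" "(I has_real_derivative 1 / Vt (I e)) (at e)"
    "((\<lambda>e. v (I e)) has_real_derivative - (e powr q) * v (I e) / Vt (I e)) (at e)"
    "Vt (I e) = exp (lnJ (I e) (v (I e))) - g e" by (fact a(2-5))+
qed

lemma eta_less_iff: "s \<le> T0 \<Longrightarrow> t \<le> T0 \<Longrightarrow> eta s < eta t \<longleftrightarrow> s < t"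
  using eta_strict_mono[of s t] eta_strict_mono[of t s] by (cases s t rule: linorder_cases) auto

lemma I_eta: "t < T0 \<Longrightarrow> I (eta t) = t"
  unfolding I_def
proof (rule the_inv_into_f_f)
  show "inj_on eta {..<T0}"
  proof (rule inj_onI)
    fix a b assume "a \<in> {..<T0}" "b \<in> {..<T0}" "eta a = eta b"
    then show "a = b" using eta_less_iff[of a b] eta_less_iff[of b a] by auto
  qed
qed simp

lemma I_less: "0 < e \<Longrightarrow> e < eta T0 \<Longrightarrow> t \<le> T0 \<Longrightarrow> e < eta t \<Longrightarrow> I e < t"
  using I_arc(1,2)[of e] eta_less_iff[of "I e" t] by auto

lemma I_mono: "0 < e \<Longrightarrow> e < e' \<Longrightarrow> e' < eta T0 \<Longrightarrow> I e < I e'"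
  using I_arc(1,2)[of e] I_arc(1,2)[of e'] eta_less_iff[of "I e" "I e'"] by auto

end

section \<open>Two profiles of different heights\<close>

locale two_profiles = radial_ode f h \<theta> u0 m p +
  P1: radial_profile f h \<theta> u0 m p v1 y1 \<tau> \<alpha>1 +
  P2: radial_profile f h \<theta> u0 m p v2 y2 \<tau> \<alpha>2
  for f h \<theta> u0 m p v1 y1 v2 y2 \<tau> \<alpha>1 \<alpha>2 +
  assumes \<alpha>12: "\<alpha>2 < \<alpha>1"
begin

text \<open>Positive slopes below \<open>E\<close> are attained by both profiles before the level
  \<open>u0\<close>, so both inverse functions are available there.\<close>

definition "E = min (P1.eta P1.T0) (P2.eta P2.T0)"
definition "L e = lnJ (P1.I e) (v1 (P1.I e)) - lnJ (P2.I e) (v2 (P2.I e))"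
definition "V1 e = exp (lnJ (P1.I e) (v1 (P1.I e))) - g e"
definition "V2 e = exp (lnJ (P2.I e) (v2 (P2.I e))) - g e"

lemma E_pos: "E > 0"
  using P1.eta_pos P2.eta_pos P1.T0 P2.T0 by (simp add: E_def)

lemma E_le: "e < E \<Longrightarrow> e < P1.eta P1.T0" "e < E \<Longrightarrow> e < P2.eta P2.T0"
  by (auto simp: E_def)

lemma near_bot_both:
  assumes \<delta>: "0 < \<delta>" "\<delta> < 1"
  obtains t0 where "t0 < P1.T0" "t0 < P2.T0"
    "\<And>t. t \<le> t0 \<Longrightarrow> (1 - \<delta>) * f \<alpha>1 \<le> f (v1 t)" "\<And>t. t \<le> t0 \<Longrightarrow> f (v1 t) \<le> f \<alpha>1"
    "\<And>t. t \<le> t0 \<Longrightarrow> (1 - \<delta>) * f \<alpha>1 * Q t \<le> exp (m * t) * y1 t"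
    "\<And>t. t \<le> t0 \<Longrightarrow> exp (m * t) * y1 t \<le> f \<alpha>1 * Q t"
    "\<And>t. t \<le> t0 \<Longrightarrow> (1 - \<delta>) * f \<alpha>2 \<le> f (v2 t)" "\<And>t. t \<le> t0 \<Longrightarrow> f (v2 t) \<le> f \<alpha>2"
    "\<And>t. t \<le> t0 \<Longrightarrow> (1 - \<delta>) * f \<alpha>2 * Q t \<le> exp (m * t) * y2 t"
    "\<And>t. t \<le> t0 \<Longrightarrow> exp (m * t) * y2 t \<le> f \<alpha>2 * Q t"
    "\<And>t. t \<le> t0 \<Longrightarrow> (1 - \<delta>) * \<alpha>2 \<le> v2 t"
proof -
  obtain a where a: "a < P1.T0"
    "\<And>t. t \<le> a \<Longrightarrow> (1 - \<delta>) * f \<alpha>1 \<le> f (v1 t)" "\<And>t. t \<le> a \<Longrightarrow> f (v1 t) \<le> f \<alpha>1"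
    "\<And>t. t \<le> a \<Longrightarrow> (1 - \<delta>) * f \<alpha>1 * Q t \<le> exp (m * t) * y1 t"
    "\<And>t. t \<le> a \<Longrightarrow> exp (m * t) * y1 t \<le> f \<alpha>1 * Q t"
    using P1.near_bot[OF \<delta>] by metis
  obtain b where b: "b < P2.T0"
    "\<And>t. t \<le> b \<Longrightarrow> (1 - \<delta>) * f \<alpha>2 \<le> f (v2 t)" "\<And>t. t \<le> b \<Longrightarrow> f (v2 t) \<le> f \<alpha>2"
    "\<And>t. t \<le> b \<Longrightarrow> (1 - \<delta>) * f \<alpha>2 * Q t \<le> exp (m * t) * y2 t"
    "\<And>t. t \<le> b \<Longrightarrow> exp (m * t) * y2 t \<le> f \<alpha>2 * Q t"
    "\<And>t. t \<le> b \<Longrightarrow> (1 - \<delta>) * \<alpha>2 \<le> v2 t"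
    using P2.near_bot[OF \<delta>] by metis
  show thesis by (rule that[of "min a b"]) (use a b in auto)
qed

lemma small_e:
  assumes "t0 < P1.T0" "t0 < P2.T0"
  obtains d where "d > 0" "d \<le> E" "\<And>e. 0 < e \<Longrightarrow> e < d \<Longrightarrow> P1.I e < t0 \<and> P2.I e < t0"
proof (rule that[of "min E (min (P1.eta t0) (P2.eta t0))"])
  have "t0 < \<tau>" using assms P1.T0(1) by simp
  then show "0 < min E (min (P1.eta t0) (P2.eta t0))" using E_pos P1.eta_pos P2.eta_pos by simp
  fix e assume "0 < e" "e < min E (min (P1.eta t0) (P2.eta t0))"
  then show "P1.I e < t0 \<and> P2.I e < t0"
    using P1.I_less[of e t0] P2.I_less[of e t0] E_le[of e] assms by auto
qed simp

text \<open>For small \<open>e\<close> the relation \<open>e = y * v powr (1 - p)\<close> is nearly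
  \<open>e = f(\<alpha>) \<alpha>^(1-p) exp(-m t) Q(t)\<close>. The coefficient is larger for the
  taller profile and the remaining factor is nondecreasing in \<open>t\<close>, so the taller
  profile attains \<open>e\<close> earlier.\<close>

lemma start_T:
  obtains d where "d > 0" "d \<le> E" "\<And>e. 0 < e \<Longrightarrow> e < d \<Longrightarrow> P1.I e < P2.I e"
proof -
  define c1 where "c1 = f \<alpha>1 * \<alpha>1 powr (1 - p)"
  define c2 where "c2 = f \<alpha>2 * \<alpha>2 powr (1 - p)"
  have c: "c2 < c1" unfolding c1_def c2_def by (rule f_ratio_strict[OF P2.\<alpha> \<alpha>12])
  have \<alpha>p: "\<alpha>1 > 0" "\<alpha>2 > 0" using P1.\<alpha> P2.\<alpha> u0 by auto
  \<comment> \<open>The exponent \<open>p\<close> collects two losses: \<open>1 - \<delta>\<close>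
    in the lower bound for \<open>y1\<close>, and \<open>(1 - \<delta>) powr (1 - p)\<close> in the
    upper bound for \<open>v2 powr (1 - p)\<close>.\<close>
  have "((\<lambda>\<delta>. (1 - \<delta>) powr p * c1) \<longlongrightarrow> (1 - 0) powr p * c1) (at_right 0)"
    by (intro tendsto_intros) auto
  then have "\<forall>\<^sub>F \<delta> in at_right 0. c2 < (1 - \<delta>) powr p * c1" using c by (intro order_tendstoD(1)) auto
  moreover have "\<forall>\<^sub>F \<delta> in at_right 0. \<delta> \<in> {0<..<1::real}" by (rule eventually_at_right_real) simp
  ultimately have "\<forall>\<^sub>F \<delta> in at_right 0. c2 < (1 - \<delta>) powr p * c1 \<and> 0 < \<delta> \<and> \<delta> < 1" by eventually_elim auto
  then obtain \<delta> where \<delta>: "0 < \<delta>" "\<delta> < 1" "c2 < (1 - \<delta>) powr p * c1"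
    using eventually_happens[of _ "at_right (0::real)"] by auto
  obtain t0 where t0: "t0 < P1.T0" "t0 < P2.T0"
    "\<And>t. t \<le> t0 \<Longrightarrow> (1 - \<delta>) * f \<alpha>1 * Q t \<le> exp (m * t) * y1 t"
    "\<And>t. t \<le> t0 \<Longrightarrow> exp (m * t) * y2 t \<le> f \<alpha>2 * Q t"
    "\<And>t. t \<le> t0 \<Longrightarrow> (1 - \<delta>) * \<alpha>2 \<le> v2 t"
    using near_bot_both[OF \<delta>(1,2)] by metis
  obtain d where d: "d > 0" "d \<le> E" "\<And>e. 0 < e \<Longrightarrow> e < d \<Longrightarrow> P1.I e < t0 \<and> P2.I e < t0"
    using small_e[OF t0(1,2)] by metis
  have "P1.I e < P2.I e" if e: "0 < e" "e < d" for e
  proof (rule ccontr)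
    assume "\<not> P1.I e < P2.I e"
    define t1 where "t1 = P1.I e"
    define t2 where "t2 = P2.I e"
    have t: "t2 \<le> t1" "t1 \<le> t0" "t2 \<le> t0" "t1 < \<tau>" "t2 < \<tau>"
      using \<open>\<not> P1.I e < P2.I e\<close> d(3)[OF e] t0(1) P1.T0(1) by (auto simp: t1_def t2_def)
    have eE: "e < P1.eta P1.T0" "e < P2.eta P2.T0" using E_le e d(2) by auto
    have e1: "e = y1 t1 * v1 t1 powr (1 - p)" using P1.I_arc(2)[OF e(1) eE(1)] by (simp add: t1_def P1.eta_def)
    have e2: "e = y2 t2 * v2 t2 powr (1 - p)" using P2.I_arc(2)[OF e(1) eE(2)] by (simp add: t2_def P2.eta_def)
    have expc: "exp (- m * t) * (exp (m * t) * x) = x" for t x :: real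
      by (simp add: exp_minus field_simps)
    have "exp (- m * t1) * ((1 - \<delta>) * f \<alpha>1 * Q t1) \<le> exp (- m * t1) * (exp (m * t1) * y1 t1)"
      by (intro mult_left_mono t0(3) t) simp
    then have y1: "(1 - \<delta>) * f \<alpha>1 * (exp (- m * t1) * Q t1) \<le> y1 t1"
      unfolding expc by (simp add: mult_ac)
    have "exp (- m * t2) * (exp (m * t2) * y2 t2) \<le> exp (- m * t2) * (f \<alpha>2 * Q t2)"
      by (intro mult_left_mono t0(4) t) simp
    then have y2: "y2 t2 \<le> f \<alpha>2 * (exp (- m * t2) * Q t2)"
      unfolding expc by (simp add: mult_ac)
    define Z where "Z = exp (- m * t1) * Q t1"
    have Z: "Z > 0" using Q(2) by (simp add: Z_def)
    have "f \<alpha>1 > 0" "f \<alpha>2 > 0" using f_pos P1.\<alpha> P2.\<alpha> by auto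
    have "(1 - \<delta>) * c1 * Z = ((1 - \<delta>) * f \<alpha>1 * Z) * \<alpha>1 powr (1 - p)" by (simp add: c1_def)
    also have "\<dots> \<le> y1 t1 * v1 t1 powr (1 - p)"
    proof (rule mult_mono)
      show "\<alpha>1 powr (1 - p) \<le> v1 t1 powr (1 - p)"
        using P1.v_less_\<alpha>[OF t(4)] P1.v_pos[OF t(4)] p1 by (intro powr_mono2') auto
    qed (use y1 P1.y_pos[OF t(4)] in \<open>auto simp: Z_def\<close>)
    also have "\<dots> = y2 t2 * v2 t2 powr (1 - p)" using e1 e2 by simp
    also have "\<dots> \<le> (f \<alpha>2 * Z) * ((1 - \<delta>) * \<alpha>2) powr (1 - p)"
    proof (rule mult_mono)
      show "v2 t2 powr (1 - p) \<le> ((1 - \<delta>) * \<alpha>2) powr (1 - p)"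
        using t0(5)[OF t(3)] \<delta> \<alpha>p p1 by (intro powr_mono2') auto
      have "f \<alpha>2 * (exp (- m * t2) * Q t2) \<le> f \<alpha>2 * Z"
        unfolding Z_def using exp_Q_mono[OF t(1)] \<open>f \<alpha>2 > 0\<close> by (intro mult_left_mono) auto
      then show "y2 t2 \<le> f \<alpha>2 * Z" using y2 by simp
    qed (use P2.y_pos[OF t(5)] Z \<open>f \<alpha>2 > 0\<close> in auto)
    also have "\<dots> = (1 - \<delta>) powr (1 - p) * c2 * Z"
      using \<delta> \<alpha>p by (simp add: c2_def powr_mult)
    finally have "(1 - \<delta>) * c1 \<le> (1 - \<delta>) powr (1 - p) * c2" using Z by simp
    then have "(1 - \<delta>) powr (p - 1) * ((1 - \<delta>) * c1) \<le> (1 - \<delta>) powr (p - 1) * ((1 - \<delta>) powr (1 - p) * c2)"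
      by (intro mult_left_mono) auto
    moreover have "(1 - \<delta>) powr (p - 1) * (1 - \<delta>) = (1 - \<delta>) powr p" "(1 - \<delta>) powr (p - 1) * (1 - \<delta>) powr (1 - p) = 1"
      using \<delta> by (simp_all add: powr_add[symmetric] powr_mult_base mult.commute)
    ultimately have "(1 - \<delta>) powr p * c1 \<le> c2" by (metis mult.assoc mult_1)
    then show False using \<delta>(3) by simp
  qed
  then show thesis using that[of d] d by blast
qed

text \<open>On each arc \<open>J / e\<close> is close to \<open>N / Q\<close> for small
  \<open>e\<close>, and \<open>N / Q\<close> is nonincreasing in time while the first arc is
  earlier. Each approximation costs \<open>\<epsilon> / 2\<close>, hence
  \<open>1 - \<delta> = exp (- \<epsilon> / 2)\<close>.\<close>

lemma start_L:
  assumes "\<epsilon> > 0" "d0 > 0" "d0 \<le> E" "\<And>e. 0 < e \<Longrightarrow> e < d0 \<Longrightarrow> P1.I e < P2.I e"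
  obtains d where "d > 0" "d \<le> d0" "\<And>e. 0 < e \<Longrightarrow> e < d \<Longrightarrow> L e \<ge> - \<epsilon>"
proof -
  define \<delta> where "\<delta> = 1 - exp (- \<epsilon> / 2)"
  have \<delta>: "0 < \<delta>" "\<delta> < 1" "1 - \<delta> = exp (- \<epsilon> / 2)" using assms(1) by (auto simp: \<delta>_def)
  obtain t0 where t0: "t0 < P1.T0" "t0 < P2.T0"
    "\<And>t. t \<le> t0 \<Longrightarrow> (1 - \<delta>) * f \<alpha>1 \<le> f (v1 t)"
    "\<And>t. t \<le> t0 \<Longrightarrow> exp (m * t) * y1 t \<le> f \<alpha>1 * Q t"
    "\<And>t. t \<le> t0 \<Longrightarrow> f (v2 t) \<le> f \<alpha>2"
    "\<And>t. t \<le> t0 \<Longrightarrow> (1 - \<delta>) * f \<alpha>2 * Q t \<le> exp (m * t) * y2 t"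
    using near_bot_both[OF \<delta>(1,2)] by metis
  obtain d where d: "d > 0" "d \<le> E" "\<And>e. 0 < e \<Longrightarrow> e < d \<Longrightarrow> P1.I e < t0 \<and> P2.I e < t0"
    using small_e[OF t0(1,2)] by metis
  have "L e \<ge> - \<epsilon>" if e: "0 < e" "e < min d d0" for e
  proof -
    define t1 where "t1 = P1.I e"
    define t2 where "t2 = P2.I e"
    have t: "t1 < t2" "t1 \<le> t0" "t2 \<le> t0" "t1 < \<tau>" "t2 < \<tau>" "t1 < P1.T0" "t2 < P2.T0"
      using assms(4)[of e] d(3)[of e] e t0(1,2) P1.T0(1) P2.T0(1) by (auto simp: t1_def t2_def)
    have eE: "e < P1.eta P1.T0" "e < P2.eta P2.T0" using E_le e d(2) by auto
    have f\<alpha>: "f \<alpha>1 > 0" "f \<alpha>2 > 0" using f_pos P1.\<alpha> P2.\<alpha> by auto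
    note y = P1.y_pos[OF t(4)] P2.y_pos[OF t(5)]
    have NQ: "N t2 / Q t2 \<le> N t1 / Q t1" using t by (intro N_div_Q_antimono) auto
    have pos: "N t / Q t > 0" for t using N_pos Q(2) by simp
    have le1: "(1 - \<delta>) * (N t1 / Q t1) \<le> N t1 * f (v1 t1) / (exp (m * t1) * y1 t1)"
    proof -
      have "((1 - \<delta>) * f \<alpha>1) * (exp (m * t1) * y1 t1) \<le> f (v1 t1) * (f \<alpha>1 * Q t1)"
        using y f_pos[OF P1.v_gt_u0[OF t(6)]] by (intro mult_mono[OF t0(3)[OF t(2)] t0(4)[OF t(2)]]) auto
      then have "f \<alpha>1 * ((1 - \<delta>) * (exp (m * t1) * y1 t1)) \<le> f \<alpha>1 * (f (v1 t1) * Q t1)" by (simp add: mult_ac)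
      then have "(1 - \<delta>) * (exp (m * t1) * y1 t1) \<le> f (v1 t1) * Q t1" using f\<alpha> by simp
      then have "N t1 * ((1 - \<delta>) * (exp (m * t1) * y1 t1)) \<le> N t1 * (f (v1 t1) * Q t1)"
        using N_pos[of t1] by (intro mult_left_mono) auto
      then show ?thesis using Q(2)[of t1] y by (simp add: field_simps)
    qed
    have lt1: "0 < (1 - \<delta>) * (N t1 / Q t1)" using \<delta>(2) pos[of t1] by (intro mult_pos_pos) auto
    have "P1.eta t1 = e" "P2.eta t2 = e"
      using P1.I_arc(2)[OF e(1) eE(1)] P2.I_arc(2)[OF e(1) eE(2)] by (simp_all add: t1_def t2_def)
    note lnJ_e = P1.lnJ_minus_ln_eta[OF t(6), unfolded this] P2.lnJ_minus_ln_eta[OF t(7), unfolded this]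
    have 1: "ln ((1 - \<delta>) * (N t1 / Q t1)) \<le> lnJ t1 (v1 t1) - ln e"
      unfolding lnJ_e by (rule iffD2[OF ln_le_cancel_iff[OF lt1 less_le_trans[OF lt1 le1]] le1])
    have le2: "N t2 * f (v2 t2) / (exp (m * t2) * y2 t2) \<le> (N t2 / Q t2) / (1 - \<delta>)"
    proof -
      have "f (v2 t2) * ((1 - \<delta>) * f \<alpha>2 * Q t2) \<le> f \<alpha>2 * (exp (m * t2) * y2 t2)"
        using \<delta>(1,2) f\<alpha> Q(2)[of t2] by (intro mult_mono[OF t0(5)[OF t(3)] t0(6)[OF t(3)]]) auto
      then have "f \<alpha>2 * (f (v2 t2) * (1 - \<delta>) * Q t2) \<le> f \<alpha>2 * (exp (m * t2) * y2 t2)" by (simp add: mult_ac)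
      then have "f (v2 t2) * (1 - \<delta>) * Q t2 \<le> exp (m * t2) * y2 t2" using f\<alpha> by simp
      then have "N t2 * (f (v2 t2) * (1 - \<delta>) * Q t2) \<le> N t2 * (exp (m * t2) * y2 t2)"
        using N_pos[of t2] by (intro mult_left_mono) auto
      then show ?thesis using Q(2)[of t2] y \<delta>(1,2) by (simp add: field_simps)
    qed
    have gt2: "N t2 * f (v2 t2) / (exp (m * t2) * y2 t2) > 0"
      using N_pos[of t2] f_pos[OF P2.v_gt_u0[OF t(7)]] y by simp
    have 2: "lnJ t2 (v2 t2) - ln e \<le> ln ((N t2 / Q t2) / (1 - \<delta>))"
      unfolding lnJ_e by (rule iffD2[OF ln_le_cancel_iff[OF gt2 less_le_trans[OF gt2 le2]] le2])
    have "ln ((1 - \<delta>) * (N t1 / Q t1)) = - \<epsilon> / 2 + ln (N t1 / Q t1)"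
      using ln_mult[of "exp (- \<epsilon> / 2)" "N t1 / Q t1"] N_pos[of t1] Q(2)[of t1] unfolding \<delta>(3) by simp
    moreover have "ln ((N t2 / Q t2) / (1 - \<delta>)) = ln (N t2 / Q t2) + \<epsilon> / 2"
      using ln_div[of "N t2 / Q t2" "exp (- \<epsilon> / 2)"] N_pos[of t2] Q(2)[of t2] unfolding \<delta>(3) by simp
    moreover have "ln (N t2 / Q t2) \<le> ln (N t1 / Q t1)" using NQ pos[of t2] pos[of t1] by (subst ln_le_cancel_iff) auto
    ultimately show ?thesis using 1 2 by (simp add: L_def t1_def t2_def)
  qed
  then show thesis using that[of "min d d0"] d(1) assms(2) by auto
qed

lemma start_W:
  obtains d where "d > 0" "d \<le> E" "\<And>e. 0 < e \<Longrightarrow> e < d \<Longrightarrow> v2 (P2.I e) < v1 (P1.I e)"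
proof -
  have "\<forall>\<^sub>F t in at_bot. \<alpha>2 < v1 t \<and> t < P1.T0 \<and> t < P2.T0"
    using order_tendstoD(1)[OF P1.v_bot \<alpha>12] eventually_gt_at_bot[of P1.T0] eventually_gt_at_bot[of P2.T0]
    by eventually_elim auto
  then obtain t0 where t0: "\<And>t. t \<le> t0 \<Longrightarrow> \<alpha>2 < v1 t \<and> t < P1.T0 \<and> t < P2.T0"
    unfolding eventually_at_bot_linorder by blast
  obtain d where d: "d > 0" "d \<le> E" "\<And>e. 0 < e \<Longrightarrow> e < d \<Longrightarrow> P1.I e < t0 \<and> P2.I e < t0"
    using small_e[of t0] t0 by blast
  have "v2 (P2.I e) < v1 (P1.I e)" if "0 < e" "e < d" for e
    using d(3)[OF that] t0[of "P1.I e"] t0[of "P2.I e"] P2.v_less_\<alpha>[of "P2.I e"] P2.T0(1) by force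
  then show thesis using that d by blast
qed

lemma V_arc:
  assumes "0 < e" "e < E"
  shows "V1 e > 0" "V2 e > 0"
    "(P1.I has_real_derivative 1 / V1 e) (at e)" "(P2.I has_real_derivative 1 / V2 e) (at e)"
    "((\<lambda>e. v1 (P1.I e)) has_real_derivative - (e powr q) * v1 (P1.I e) / V1 e) (at e)"
    "((\<lambda>e. v2 (P2.I e)) has_real_derivative - (e powr q) * v2 (P2.I e) / V2 e) (at e)"
  using P1.I_arc[OF assms(1) E_le(1)[OF assms(2)]] P2.I_arc[OF assms(1) E_le(2)[OF assms(2)]]
  by (simp_all add: V1_def V2_def)

lemma isCont_arc:
  assumes "0 < e" "e < E"
  shows "isCont P1.I e" "isCont P2.I e" "isCont (\<lambda>e. v1 (P1.I e)) e" "isCont (\<lambda>e. v2 (P2.I e)) e"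
    "isCont (\<lambda>e. lnJ (P1.I e) (v1 (P1.I e))) e" "isCont (\<lambda>e. lnJ (P2.I e) (v2 (P2.I e))) e"
    "isCont V1 e" "isCont V2 e"
proof -
  note a = V_arc[OF assms]
  show c: "isCont P1.I e" "isCont P2.I e" "isCont (\<lambda>e. v1 (P1.I e)) e" "isCont (\<lambda>e. v2 (P2.I e)) e"
    by (fact DERIV_isCont[OF a(3)] DERIV_isCont[OF a(4)] DERIV_isCont[OF a(5)] DERIV_isCont[OF a(6)])+
  have T: "P1.I e < P1.T0" "P2.I e < P2.T0"
    using P1.I_arc(1)[OF assms(1) E_le(1)[OF assms(2)]] P2.I_arc(1)[OF assms(1) E_le(2)[OF assms(2)]] by auto
  show d1: "isCont (\<lambda>e. lnJ (P1.I e) (v1 (P1.I e))) e"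
    by (rule isCont_o2[OF c(1), of "\<lambda>t. lnJ t (v1 t)"]) (rule P1.isCont_lnJ[OF T(1)])
  show d2: "isCont (\<lambda>e. lnJ (P2.I e) (v2 (P2.I e))) e"
    by (rule isCont_o2[OF c(2), of "\<lambda>t. lnJ t (v2 t)"]) (rule P2.isCont_lnJ[OF T(2)])
  show "isCont V1 e" "isCont V2 e"
    unfolding V1_def[abs_def] V2_def[abs_def] by (intro continuous_intros d1 d2 P1.isCont_g assms)+
qed

text \<open>The arcs are compared from a slope \<open>s\<close> close to \<open>0\<close> on, with
  an initial error \<open>\<epsilon>'\<close> from the asymptotics. As the velocities vanish at the
  centre, \<open>C\<close> must be fixed before \<open>s\<close>: for \<open>e < b\<close> the
  alternative with \<open>\<theta>\<close> holds at no cost, so only the compact interval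
  \<open>[s0, e1]\<close> determines \<open>C\<close>.\<close>

lemma L_nonneg:
  assumes e1: "0 < e1" "e1 < E"
    and ord: "\<And>e. 0 < e \<Longrightarrow> e \<le> e1 \<Longrightarrow> P1.I e < P2.I e \<and> v2 (P2.I e) < v1 (P1.I e)"
  shows "L e1 \<ge> 0"
proof (rule field_le_epsilon)
  define wc where "wc = v2 (P2.I e1)"
  have T2: "P2.I e1 < P2.T0" using P2.I_arc(1)[OF e1(1) E_le(2)[OF e1(2)]] .
  have wc: "wc > u0" using P2.v_gt_u0[OF T2] by (simp add: wc_def)
  define wb where "wb = (u0 + wc) / 2"
  have wb: "u0 < wb" "wb < wc" using wc by (auto simp: wb_def)
  define \<kappa> where "\<kappa> = slope wb wc - (p - 1)"
  have \<kappa>: "\<kappa> \<ge> 0" using slope_ge[OF wb] by (simp add: \<kappa>_def)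
  define \<theta>1 where "\<theta>1 = \<theta> (P2.I e1)"
  have \<theta>1: "\<theta>1 > 0" using \<theta>_pos by (simp add: \<theta>1_def)
  have "((\<lambda>e. \<kappa> * e powr q) \<longlongrightarrow> 0) (at_right 0)"
  proof -
    have "((\<lambda>e. e powr q) \<longlongrightarrow> 0) (at_right (0::real))"
    proof (rule tendsto_zero_powrI[OF tendsto_ident_at tendsto_const _ q_pos])
      show "\<forall>\<^sub>F e in at_right (0::real). 0 \<le> e"
        using eventually_at_right_less[of 0] by (rule eventually_mono) simp
    qed
    then show ?thesis by (rule tendsto_mult_right_zero)
  qed
  then have "\<forall>\<^sub>F e in at_right 0. \<kappa> * e powr q < \<theta>1" using \<theta>1 by (rule order_tendstoD(2))
  then obtain b where b: "b > 0" "\<And>e. 0 < e \<Longrightarrow> e < b \<Longrightarrow> \<kappa> * e powr q < \<theta>1"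
    unfolding eventually_at_right_field by auto
  define s0 where "s0 = min b e1 / 2"
  have s0: "0 < s0" "s0 < b" "s0 < e1" using b(1) e1(1) by (auto simp: s0_def min_def)
  have "\<exists>C\<ge>0. \<forall>e\<in>{s0..e1}. \<kappa> * e powr q * exp (lnJ (P2.I e) (v2 (P2.I e))) / (V1 e * V2 e) \<le> C"
  proof (rule continuous_bounded_above)
    fix e assume "s0 \<le> e" "e \<le> e1"
    then have e: "0 < e" "e < E" using s0 e1 by auto
    show "isCont (\<lambda>e. \<kappa> * e powr q * exp (lnJ (P2.I e) (v2 (P2.I e))) / (V1 e * V2 e)) e"
      using e V_arc(1,2)[OF e] by (intro continuous_intros isCont_arc) auto
  qed
  then obtain C where C: "C \<ge> 0" "\<And>e. s0 \<le> e \<Longrightarrow> e \<le> e1 \<Longrightarrow> \<kappa> * e powr q * exp (lnJ (P2.I e) (v2 (P2.I e))) / (V1 e * V2 e) \<le> C"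
    by auto
  fix \<epsilon> :: real assume \<epsilon>: "0 < \<epsilon>"
  \<comment> \<open>Division by \<open>exp (C * e1)\<close> compensates the Gronwall factor
    uniformly in the start \<open>s\<close>.\<close>
  define \<epsilon>' where "\<epsilon>' = \<epsilon> / exp (C * e1)"
  have \<epsilon>': "\<epsilon>' > 0" using \<epsilon> by (simp add: \<epsilon>'_def)
  obtain d where d: "d > 0" "\<And>e. 0 < e \<Longrightarrow> e < d \<Longrightarrow> L e \<ge> - \<epsilon>'"
    using start_L[OF \<epsilon>' e1(1) less_imp_le[OF e1(2)]] ord by (metis less_imp_le)
  define s where "s = min d e1 / 2"
  have s: "0 < s" "s < d" "s < e1" using d(1) e1(1) by (auto simp: s_def min_def)
  have "L e1 \<ge> - \<epsilon>' * exp (C * (e1 - s))"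
    unfolding L_def
  proof (rule arcs_compare[OF s(1) less_imp_le[OF s(3)] V1_def V2_def _ _ _ _ _ _ _ _ wb _ \<kappa>_def C(1)])
    show "- \<epsilon>' \<le> lnJ (P1.I s) (v1 (P1.I s)) - lnJ (P2.I s) (v2 (P2.I s))"
      using d(2)[OF s(1,2)] by (simp add: L_def)
    show "0 \<le> \<epsilon>'" using \<epsilon>' by simp
    fix e assume "s \<le> e" "e \<le> e1"
    then have e: "0 < e" "e < E" "e \<le> e1" using s e1 by auto
    show "(P1.I has_real_derivative 1 / V1 e) (at e)" "(P2.I has_real_derivative 1 / V2 e) (at e)"
      "((\<lambda>e. v1 (P1.I e)) has_real_derivative - (e powr q) * v1 (P1.I e) / V1 e) (at e)"
      "((\<lambda>e. v2 (P2.I e)) has_real_derivative - (e powr q) * v2 (P2.I e) / V2 e) (at e)"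
      "0 < V1 e" "0 < V2 e" using V_arc[OF e(1,2)] by auto
    show "P1.I e \<le> P2.I e" "v2 (P2.I e) < v1 (P1.I e)" using ord[OF e(1,3)] by auto
    show "wc \<le> v2 (P2.I e)" unfolding wc_def
      using P2.I_mono[OF e(1), of e1] e(3) E_le(2)[OF e1(2)] T2 P2.T0(1)
      by (cases "e = e1") (auto intro!: P2.v_decr)
  next
    fix e assume "s \<le> e" "e < e1"
    then have e: "0 < e" "e < E" "e < e1" using s e1 by auto
    show "\<kappa> * e powr q \<le> \<theta> (P2.I e) \<or> \<kappa> * e powr q * exp (lnJ (P2.I e) (v2 (P2.I e))) \<le> C * (V1 e * V2 e)"
    proof (cases "e < b")
      case True
      have "P2.I e \<le> P2.I e1" using P2.I_mono[OF e(1,3) E_le(2)[OF e1(2)]] by simp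
      then have "\<theta>1 \<le> \<theta> (P2.I e)" unfolding \<theta>1_def by (rule \<theta>_anti)
      then show ?thesis using b(2)[OF e(1) True] by simp
    next
      case False
      then have "s0 \<le> e" using s0 by simp
      then show ?thesis using C(2)[of e] e V_arc(1,2)[OF e(1,2)] by (simp add: pos_divide_le_eq)
    qed
  qed
  moreover have "\<epsilon>' * exp (C * (e1 - s)) \<le> \<epsilon>' * exp (C * e1)"
    using \<epsilon>' C(1) s(1) by (intro mult_left_mono) (auto intro!: mult_left_mono)
  moreover have "\<epsilon>' * exp (C * e1) = \<epsilon>" by (simp add: \<epsilon>'_def)
  ultimately show "0 \<le> L e1 + \<epsilon>" by simp
qed

text \<open>\<open>L \<ge> 0\<close> means \<open>V1 \<ge> V2\<close>: the first arc runs through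
  the slopes at least as fast, so its lead in time does not shrink, and since \<open>ln v\<close>
  changes at the rate \<open>- e powr q / V\<close> it loses no more logarithmic height than the
  second.\<close>

lemma gap_mono:
  assumes ab: "0 < a" "a \<le> b" "b < E" and L: "\<And>e. a \<le> e \<Longrightarrow> e < b \<Longrightarrow> L e \<ge> 0"
  shows "P1.I b - P2.I b \<le> P1.I a - P2.I a"
    "ln (v1 (P1.I a)) - ln (v2 (P2.I a)) \<le> ln (v1 (P1.I b)) - ln (v2 (P2.I b))"
proof -
  have pos: "v1 (P1.I e) > 0" "v2 (P2.I e) > 0" if "0 < e" "e < E" for e
    using P1.I_arc(1)[OF that(1) E_le(1)[OF that(2)]] P2.I_arc(1)[OF that(1) E_le(2)[OF that(2)]]
      P1.v_pos P2.v_pos P1.T0(1) P2.T0(1) by (meson less_trans)+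
  have in_range: "0 < e" "e < E" if "a \<le> e" "e \<le> b" for e using ab that by auto
  have V: "1 / V1 e \<le> 1 / V2 e" if "a \<le> e" "e < b" for e
  proof -
    have "V2 e \<le> V1 e" using L[OF that] by (simp add: V1_def V2_def L_def)
    then show ?thesis using V_arc(1,2)[of e] in_range[of e] that by (simp add: frac_le)
  qed
  have "- (P1.I a - P2.I a) \<le> - (P1.I b - P2.I b)"
  proof (rule nondecreasing_half_open[OF ab(2)])
    show "continuous_on {a..b} (\<lambda>e. - (P1.I e - P2.I e))"
      using in_range by (intro continuous_at_imp_continuous_on ballI continuous_intros isCont_arc) auto
    fix e assume e: "a \<le> e" "e < b"
    have "((\<lambda>e. - (P1.I e - P2.I e)) has_real_derivative - (1 / V1 e - 1 / V2 e)) (at e)"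
      using in_range[of e] e by (intro DERIV_minus DERIV_diff V_arc) auto
    then show "\<exists>k. ((\<lambda>e. - (P1.I e - P2.I e)) has_real_derivative k) (at e) \<and> 0 \<le> k"
      using V[OF e] by (intro exI conjI) auto
  qed
  then show "P1.I b - P2.I b \<le> P1.I a - P2.I a" by simp
  show "ln (v1 (P1.I a)) - ln (v2 (P2.I a)) \<le> ln (v1 (P1.I b)) - ln (v2 (P2.I b))"
  proof (rule nondecreasing_half_open[OF ab(2)])
    show "continuous_on {a..b} (\<lambda>e. ln (v1 (P1.I e)) - ln (v2 (P2.I e)))"
      using in_range pos by (intro continuous_at_imp_continuous_on ballI continuous_intros isCont_arc)
        (auto simp: less_imp_neq[symmetric])
    fix e assume e: "a \<le> e" "e < b"
    note i = in_range[OF e(1) less_imp_le[OF e(2)]]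
    have "((\<lambda>e. ln (v1 (P1.I e)) - ln (v2 (P2.I e))) has_real_derivative
       (1 / v1 (P1.I e)) * (- (e powr q) * v1 (P1.I e) / V1 e) - (1 / v2 (P2.I e)) * (- (e powr q) * v2 (P2.I e) / V2 e)) (at e)"
      using pos[OF i] by (intro DERIV_diff DERIV_chain2[OF DERIV_ln_divide V_arc(5)[OF i]] DERIV_chain2[OF DERIV_ln_divide V_arc(6)[OF i]])
    moreover have "(1 / v1 (P1.I e)) * (- (e powr q) * v1 (P1.I e) / V1 e) - (1 / v2 (P2.I e)) * (- (e powr q) * v2 (P2.I e) / V2 e)
        = e powr q * (1 / V2 e - 1 / V1 e)" using pos[OF i] by (simp add: field_simps)
    moreover have "\<dots> \<ge> 0" using V[OF e] by simp
    ultimately show "\<exists>k. ((\<lambda>e. ln (v1 (P1.I e)) - ln (v2 (P2.I e))) has_real_derivative k) (at e) \<and> 0 \<le> k"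
      by metis
  qed
qed

text \<open>Continuation in \<open>e\<close>. Up to the infimum \<open>e1\<close> of the bad slopes
  the order gives \<open>L \<ge> 0\<close>, which keeps both gaps at least as large as at the
  smaller slope \<open>a\<close>. So the order is still strict at \<open>e1\<close>, and by
  continuity it persists beyond.\<close>

lemma ordered_arcs:
  assumes "0 < e" "e < E"
  shows "P1.I e < P2.I e \<and> v2 (P2.I e) < v1 (P1.I e)"
proof (rule ccontr)
  define P where "P e \<longleftrightarrow> P1.I e < P2.I e \<and> v2 (P2.I e) < v1 (P1.I e)" for e
  assume "\<not> (P1.I e < P2.I e \<and> v2 (P2.I e) < v1 (P1.I e))"
  then have nP: "\<not> P e" by (simp add: P_def)
  obtain d1 where d1: "d1 > 0" "d1 \<le> E" "\<And>e. 0 < e \<Longrightarrow> e < d1 \<Longrightarrow> P1.I e < P2.I e" using start_T by metis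
  obtain d2 where d2: "d2 > 0" "d2 \<le> E" "\<And>e. 0 < e \<Longrightarrow> e < d2 \<Longrightarrow> v2 (P2.I e) < v1 (P1.I e)" using start_W by metis
  define d where "d = min d1 d2"
  have d: "d > 0" "d \<le> E" "\<And>e. 0 < e \<Longrightarrow> e < d \<Longrightarrow> P e" using d1 d2 by (auto simp: d_def P_def)
  define Bad where "Bad = {e. 0 < e \<and> e < E \<and> \<not> P e}"
  have ne: "e \<in> Bad" using assms nP by (simp add: Bad_def)
  have low: "d \<le> x" if "x \<in> Bad" for x using that d(3)[of x] by (force simp: Bad_def)
  then have bb: "bdd_below Bad" by (rule bdd_belowI)
  define e1 where "e1 = Inf Bad"
  have e1: "d \<le> e1" "e1 \<le> e" using cInf_greatest[of Bad d] cInf_lower[OF ne bb] ne low by (auto simp: e1_def)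
  then have e1E: "0 < e1" "e1 < E" using d assms by auto
  have before: "P x" if "0 < x" "x < e1" for x
    using cInf_lower[OF _ bb, of x] that e1E by (force simp: Bad_def e1_def)
  have L: "L x \<ge> 0" if "0 < x" "x < e1" for x
    using L_nonneg[of x] before that e1E by (auto simp: P_def)
  define a where "a = d / 2"
  have a: "0 < a" "a < d" "a < e1" "P a" using d e1 before[of a] by (auto simp: a_def)
  have "P1.I e1 - P2.I e1 \<le> P1.I a - P2.I a"
    "ln (v1 (P1.I a)) - ln (v2 (P2.I a)) \<le> ln (v1 (P1.I e1)) - ln (v2 (P2.I e1))"
    by (intro gap_mono; use a e1E L in force)+
  moreover have pos: "v1 (P1.I x) > 0" "v2 (P2.I x) > 0" if "0 < x" "x < E" for x
    using P1.I_arc(1)[OF that(1) E_le(1)[OF that(2)]] P2.I_arc(1)[OF that(1) E_le(2)[OF that(2)]]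
      P1.v_pos P2.v_pos P1.T0(1) P2.T0(1) by (meson less_trans)+
  moreover have "ln (v2 (P2.I a)) < ln (v1 (P1.I a))"
    using a pos[of a] e1E by (subst ln_less_cancel_iff) (auto simp: P_def)
  ultimately have "P1.I e1 < P2.I e1" "ln (v2 (P2.I e1)) < ln (v1 (P1.I e1))" using a(4) by (auto simp: P_def)
  then have Pe1: "P1.I e1 < P2.I e1" "v2 (P2.I e1) < v1 (P1.I e1)" using pos[OF e1E] by auto
  have "\<forall>\<^sub>F x in at e1. P1.I x < P2.I x" "\<forall>\<^sub>F x in at e1. v2 (P2.I x) < v1 (P1.I x)"
  proof -
    have "((\<lambda>x. P2.I x - P1.I x) \<longlongrightarrow> P2.I e1 - P1.I e1) (at e1)"
      using isCont_arc(1,2)[OF e1E] by (intro tendsto_diff) (auto simp: isCont_def)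
    from order_tendstoD(1)[OF this, of 0] show "\<forall>\<^sub>F x in at e1. P1.I x < P2.I x" using Pe1 by simp
    have "((\<lambda>x. v1 (P1.I x) - v2 (P2.I x)) \<longlongrightarrow> v1 (P1.I e1) - v2 (P2.I e1)) (at e1)"
      using isCont_arc(3,4)[OF e1E] by (intro tendsto_diff) (auto simp: isCont_def)
    from order_tendstoD(1)[OF this, of 0] show "\<forall>\<^sub>F x in at e1. v2 (P2.I x) < v1 (P1.I x)" using Pe1 by simp
  qed
  then have "\<forall>\<^sub>F x in at e1. P x" unfolding P_def by (rule eventually_conj)
  then obtain r where r: "r > 0" "\<And>x. x \<noteq> e1 \<Longrightarrow> dist x e1 < r \<Longrightarrow> P x" unfolding eventually_at by auto
  have "e1 + r \<le> x" if x: "x \<in> Bad" for x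
  proof (rule ccontr)
    assume "\<not> e1 + r \<le> x"
    moreover have "e1 \<le> x" unfolding e1_def by (rule cInf_lower[OF x bb])
    ultimately have "P x" using r(2)[of x] Pe1 by (cases "x = e1") (auto simp: P_def dist_real_def)
    then show False using x by (simp add: Bad_def)
  qed
  then have "e1 + r \<le> Inf Bad" using ne by (intro cInf_greatest) auto
  then show False using r(1) by (simp add: e1_def)
qed

text \<open>At a common level the order of \<open>y\<close> is that of \<open>eta\<close>. If the
  taller profile were not steeper at \<open>w\<close>, then at slopes \<open>e\<close> slightly
  below \<open>P1.eta t1\<close> it would be barely above \<open>w\<close> while the other one is
  above \<open>w\<close> too, against the fixed logarithmic gap \<open>c\<close>. Approaching
  \<open>t1\<close> from the left keeps \<open>e < E\<close> even for \<open>w = u0\<close>.\<close>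

lemma steeper:
  assumes w: "u0 \<le> w" "w < \<alpha>2"
  shows "y2 (P2.lev w) < y1 (P1.lev w)"
proof -
  have w0: "0 < w" "w < \<alpha>1" using w u0 \<alpha>12 by auto
  define t1 where "t1 = P1.lev w"
  define t2 where "t2 = P2.lev w"
  have t: "t1 < \<tau>" "v1 t1 = w" "t2 < \<tau>" "v2 t2 = w"
    using P1.lev[OF w0] P2.lev[OF w0(1) w(2)] by (auto simp: t1_def t2_def)
  have T: "t1 \<le> P1.T0" "t2 \<le> P2.T0"
    using P1.v_less_iff[of P1.T0 t1] P2.v_less_iff[of P2.T0 t2] P1.v_strict_decr[of P1.T0 t1] P2.v_strict_decr[of P2.T0 t2] t w P1.T0 P2.T0 by force+
  have "P2.eta t2 < P1.eta t1"
  proof (rule ccontr)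
    assume neg: "\<not> P2.eta t2 < P1.eta t1"
    define a where "a = min E (P1.eta t1) / 2"
    have a: "0 < a" "a < E" "a < P1.eta t1" using E_pos P1.eta_pos[OF t(1)] by (auto simp: a_def min_def)
    define c where "c = ln (v1 (P1.I a)) - ln (v2 (P2.I a))"
    have pos: "v1 (P1.I x) > 0" "v2 (P2.I x) > 0" if "0 < x" "x < E" for x
      using P1.I_arc(1)[OF that(1) E_le(1)[OF that(2)]] P2.I_arc(1)[OF that(1) E_le(2)[OF that(2)]]
        P1.v_pos P2.v_pos P1.T0(1) P2.T0(1) by (meson less_trans)+
    have c: "c > 0" using ordered_arcs[OF a(1,2)] pos[OF a(1,2)] by (simp add: c_def)
    have gap: "c \<le> ln (v1 (P1.I x)) - ln (v2 (P2.I x))" if "a \<le> x" "x < E" for x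
      unfolding c_def
    proof (rule gap_mono(2)[OF a(1) that])
      fix e assume "a \<le> e" "e < x"
      then show "L e \<ge> 0" using L_nonneg[of e] ordered_arcs a that by auto
    qed
    have "isCont (\<lambda>t. ln (v1 t)) t1" using P1.isCont_v[OF t(1)] t w0 by (intro continuous_intros) auto
    from isCont_at_left[OF this] have "((\<lambda>t. ln (v1 t)) \<longlongrightarrow> ln w) (at_left t1)" using t(2) by simp
    then have 1: "\<forall>\<^sub>F s in at_left t1. ln (v1 s) < ln w + c" using c by (intro order_tendstoD(2)) auto
    have "(P1.eta \<longlongrightarrow> P1.eta t1) (at_left t1)"
      by (rule isCont_at_left[OF P1.isCont_eta[OF t(1)]])
    then have 2: "\<forall>\<^sub>F s in at_left t1. a < P1.eta s" using a(3) by (rule order_tendstoD(1))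
    have "\<forall>\<^sub>F s in at_left t1. s \<in> {t1 - 1<..<t1}" by (rule eventually_at_left_real) simp
    with 1 2 have "\<forall>\<^sub>F s in at_left t1. ln (v1 s) < ln w + c \<and> a < P1.eta s \<and> s < t1" by eventually_elim auto
    then obtain s where s: "ln (v1 s) < ln w + c" "a < P1.eta s" "s < t1"
      using eventually_happens[of _ "at_left t1"] by auto
    define e where "e = P1.eta s"
    have e_lt: "e < P1.eta t1" using P1.eta_strict_mono[OF s(3) T(1)] by (simp add: e_def)
    have "P1.eta t1 \<le> P1.eta P1.T0" using P1.eta_strict_mono[of t1 P1.T0] T by (cases "t1 = P1.T0") auto
    moreover have "P2.eta t2 \<le> P2.eta P2.T0" using P2.eta_strict_mono[of t2 P2.T0] T by (cases "t2 = P2.T0") auto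
    ultimately have eE: "0 < e" "e < E" using e_lt neg a(1) s(2) by (auto simp: E_def e_def)
    have I1: "P1.I e = s" unfolding e_def using s(3) T(1) by (intro P1.I_eta) simp
    have "P2.I e < t2" using P2.I_less[OF eE(1) E_le(2)[OF eE(2)] T(2)] e_lt neg by simp
    then have "w < v2 (P2.I e)" using P2.v_strict_decr[of "P2.I e" t2] t by simp
    then have "ln w < ln (v2 (P2.I e))" using w0 by simp
    moreover have "c \<le> ln (v1 s) - ln (v2 (P2.I e))" using gap[of e] eE s(2) I1 by (simp add: e_def)
    ultimately show False using s(1) by simp
  qed
  then show ?thesis using t w0 by (simp add: P1.eta_def P2.eta_def t1_def t2_def)
qed

end

lemma powr_diff_le:
  fixes a b r :: real
  assumes "0 < a" "a \<le> b" "r \<ge> 0"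
  shows "b powr (1 + r) - a powr (1 + r) \<le> (1 + r) * b powr r * (b - a)"
proof -
  have "(1 + r) * b powr r * a - a powr (1 + r) \<le> (1 + r) * b powr r * b - b powr (1 + r)"
  proof (rule DERIV_nonneg_imp_nondecreasing[OF assms(2), of "\<lambda>x. (1 + r) * b powr r * x - x powr (1 + r)"])
    fix x assume x: "a \<le> x" "x \<le> b"
    have "((\<lambda>x. (1 + r) * b powr r * x - x powr (1 + r)) has_real_derivative
        (1 + r) * b powr r * 1 - (1 + r) * x powr (1 + r - of_nat 1) * 1) (at x)"
      using x assms by (intro DERIV_diff DERIV_cmult DERIV_ident DERIV_fun_powr) auto
    moreover have "(1 + r) * x powr r \<le> (1 + r) * b powr r"
      using x assms by (intro mult_left_mono powr_mono2) auto
    ultimately show "\<exists>y. ((\<lambda>x. (1 + r) * b powr r * x - x powr (1 + r)) has_real_derivative y) (at x) \<and> 0 \<le> y"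
      by (intro exI conjI) (assumption, simp)
  qed
  then show ?thesis by (simp add: algebra_simps)
qed

section \<open>The variable v - u0, and the level as independent variable\<close>

context radial_profile
begin

text \<open>The analogue of \<open>eta\<close> for \<open>v - u0\<close>: its power \<open>q\<close>
  is minus the logarithmic derivative of \<open>v - u0\<close>. It obeys an equation of Riccati type
  whose coefficient \<open>f(v) / (v - u0)^(p-1)\<close> is nondecreasing in
  \<open>v\<close>.\<close>

definition "zeta t = y t * (v t - u0) powr (1 - p)"

lemma zeta_powr_q:
  assumes "t < T0"
  shows "zeta t powr q = y t powr q / (v t - u0)"
proof -
  have "(1 - p) * q = -1" using p1 by (simp add: q_def field_simps)
  then show ?thesis using y_pos[of t] assms T0(1) v_gt_u0[OF assms]
    by (simp add: zeta_def powr_mult powr_powr powr_minus_divide)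
qed

lemma zeta_deriv:
  assumes "t < T0"
  shows "((\<lambda>t. exp (m * t) * zeta t) has_real_derivative
    exp (m * t) * (exp (h t) * (f (v t) * (v t - u0) powr (1 - p)) + (p - 1) * zeta t powr (1 + q))) (at t)"
proof -
  have t: "t < \<tau>" using assms T0(1) by simp
  define U where "U = v t - u0"
  have U: "U > 0" using v_gt_u0[OF assms] by (simp add: U_def)
  have y: "y t > 0" using y_pos[OF t] .
  have "((\<lambda>t. v t - u0) has_real_derivative - (y t powr q)) (at t)"
    by (auto intro!: derivative_eq_intros dv[OF t])
  then have "((\<lambda>t. (v t - u0) powr (1 - p)) has_real_derivative
      (1 - p) * (v t - u0) powr (1 - p - of_nat 1) * (- (y t powr q))) (at t)"
    by (rule DERIV_fun_powr) (use U in \<open>simp add: U_def\<close>)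
  from DERIV_mult[OF omega_deriv[OF t] this]
  have "((\<lambda>t. exp (m * t) * zeta t) has_real_derivative
      exp (m * t) * (exp (h t) * f (v t)) * U powr (1 - p)
      + ((1 - p) * U powr (1 - p - of_nat 1) * (- (y t powr q))) * (exp (m * t) * y t)) (at t)"
    by (simp add: zeta_def[abs_def] U_def mult.assoc)
  moreover have "U powr (1 - p - of_nat 1) = U powr (1 - p) / U"
    using U by (subst powr_diff) simp
  moreover have "zeta t powr (1 + q) = (y t * U powr (1 - p)) * (y t powr q / U)"
  proof -
    have "zeta t powr (1 + q) = zeta t * zeta t powr q" using y U by (simp add: powr_add zeta_def U_def)
    then show ?thesis unfolding zeta_powr_q[OF assms] by (simp add: zeta_def U_def)
  qed
  ultimately show ?thesis using U by (simp add: U_def[symmetric] algebra_simps diff_divide_distrib)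
qed

definition "mu s = ln (y (lev s))"

text \<open>A first-order system for \<open>lev\<close> and \<open>mu\<close> in the level
  \<open>s\<close>. The nonlinearity enters only through the number \<open>f s\<close>, the same for
  all profiles at that level, so comparing two profiles amounts to comparing exponentials.\<close>

lemma mu_deriv:
  assumes "0 < s" "s < \<alpha>"
  shows "(mu has_real_derivative m * exp (- q * mu s) - f s * exp (h (lev s) - (1 + q) * mu s)) (at s)"
    "(lev has_real_derivative - exp (- q * mu s)) (at s)"
proof -
  note l = lev[OF assms] and y = y_pos[OF lev(1)[OF assms]]
  have yq: "y (lev s) powr - q = exp (- q * mu s)" using y by (simp add: mu_def powr_def)
  show 1: "(lev has_real_derivative - exp (- q * mu s)) (at s)" using lev_deriv[OF assms] unfolding yq .
  have "((\<lambda>s. y (lev s)) has_real_derivative (exp (h (lev s)) * f (v (lev s)) - m * y (lev s)) * (- exp (- q * mu s))) (at s)"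
    by (rule DERIV_chain2[where f = y and g = lev, OF dy[OF l(1)] 1])
  then have "(mu has_real_derivative 1 / y (lev s) * ((exp (h (lev s)) * f s - m * y (lev s)) * (- exp (- q * mu s)))) (at s)"
    unfolding mu_def[abs_def] l(2) using y by (intro DERIV_chain2[OF DERIV_ln_divide])
  moreover have "1 / y (lev s) * ((exp (h (lev s)) * f s - m * y (lev s)) * (- exp (- q * mu s)))
      = m * exp (- q * mu s) - f s * (exp (h (lev s)) * (exp (- q * mu s) / y (lev s)))"
    using y by (simp add: field_simps)
  moreover have "exp (h (lev s)) * (exp (- q * mu s) / y (lev s)) = exp (h (lev s) - (1 + q) * mu s)"
  proof -
    have "exp (h (lev s) - (1 + q) * mu s) = exp (h (lev s)) * (exp (- q * mu s) * exp (- mu s))"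
      unfolding exp_add[symmetric] by (simp add: algebra_simps)
    moreover have "exp (- mu s) = 1 / y (lev s)" using y by (simp add: mu_def exp_minus inverse_eq_divide)
    ultimately show ?thesis by simp
  qed
  ultimately show "(mu has_real_derivative m * exp (- q * mu s) - f s * exp (h (lev s) - (1 + q) * mu s)) (at s)"
    by (simp only:)
qed

end

section \<open>Arrival times at the levels u0 and 0\<close>

context two_profiles
begin

lemma level_gap_mono:
  assumes "0 < a" "a \<le> b" "b < \<alpha>2" and le: "\<And>s. a \<le> s \<Longrightarrow> s \<le> b \<Longrightarrow> P2.mu s \<le> P1.mu s"
  shows "P1.lev a - P2.lev a \<le> P1.lev b - P2.lev b"
proof (rule DERIV_nonneg_imp_nondecreasing[OF assms(2), of "\<lambda>s. P1.lev s - P2.lev s"])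
  fix s assume s: "a \<le> s" "s \<le> b"
  then have r: "0 < s" "s < \<alpha>1" "s < \<alpha>2" using assms \<alpha>12 by auto
  have "((\<lambda>s. P1.lev s - P2.lev s) has_real_derivative - exp (- q * P1.mu s) - - exp (- q * P2.mu s)) (at s)"
    by (intro DERIV_diff P1.mu_deriv P2.mu_deriv r)
  moreover have "exp (- q * P1.mu s) \<le> exp (- q * P2.mu s)" using le[OF s] q_pos by simp
  ultimately show "\<exists>y. ((\<lambda>s. P1.lev s - P2.lev s) has_real_derivative y) (at s) \<and> 0 \<le> y"
    by (intro exI conjI) (assumption, simp)
qed

lemma mu_less_iff:
  assumes "0 < s" "s < \<alpha>2"
  shows "P2.mu s < P1.mu s \<longleftrightarrow> y2 (P2.lev s) < y1 (P1.lev s)"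
    "P2.mu s \<le> P1.mu s \<longleftrightarrow> y2 (P2.lev s) \<le> y1 (P1.lev s)"
  using P1.y_pos[OF P1.lev(1)[of s]] P2.y_pos[OF P2.lev(1)[of s]] assms \<alpha>12
  by (auto simp: P1.mu_def P2.mu_def)

text \<open>A Riccati comparison of \<open>v - u0\<close>: if the taller profile stayed above the other one down to
  the level \<open>u0\<close>, then the quotient of \<open>v1 - u0\<close> and \<open>v2 - u0\<close> would be nonincreasing, although it
  tends to infinity.\<close>

lemma crossing: "P1.T0 \<le> P2.T0"
proof (rule ccontr)
  assume neg: "\<not> P1.T0 \<le> P2.T0"
  \<comment> \<open>By \<open>steeper\<close> the difference of the arrival times is nondecreasing
    in the level. A later arrival of the taller profile at \<open>u0\<close> would mean a later
    arrival at all levels above \<open>u0\<close>, so it would stay above the other one.\<close>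
  have above: "v2 t < v1 t" if t: "t \<le> P2.T0" for t
  proof -
    have t\<tau>: "t < \<tau>" using t P2.T0(1) by simp
    define s where "s = v2 t"
    have s: "u0 \<le> s" "s < \<alpha>2" "0 < s" using P2.v_ge_u0[OF t] P2.v_less_\<alpha>[OF t\<tau>] u0 by (auto simp: s_def)
    have "P1.lev u0 - P2.lev u0 \<le> P1.lev s - P2.lev s"
    proof (rule level_gap_mono[OF u0 s(1,2)])
      fix w assume w: "u0 \<le> w" "w \<le> s"
      then show "P2.mu w \<le> P1.mu w" using steeper[of w] mu_less_iff(2)[of w] s u0 by auto
    qed
    then have "P2.lev s < P1.lev s" using neg by (simp add: P1.T0_def P2.T0_def)
    then have "t < P1.lev s" using P2.lev_v[OF t\<tau>] by (simp add: s_def)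
    then have "v1 (P1.lev s) < v1 t" using P1.v_strict_decr P1.lev(1)[of s] s \<alpha>12 by auto
    then show ?thesis using P1.lev(2)[of s] s \<alpha>12 by (simp add: s_def)
  qed
  have T: "P2.T0 < P1.T0" using neg by simp
  define D where "D t = exp (m * t) * P1.zeta t - exp (m * t) * P2.zeta t" for t
  \<comment> \<open>The power is an integrating factor with logarithmic derivative
    \<open>- p * P2.zeta powr q\<close>. Where \<open>D < 0\<close>, convexity bounds the loss from
    the terms \<open>(p - 1) * zeta powr (1 + q)\<close> by \<open>p * P2.zeta powr q\<close> times
    the deficit, because \<open>(p - 1) * (1 + q) = p\<close>. So \<open>\<psi>\<close> cannot
    decrease where it is negative.\<close>
  define \<psi> where "\<psi> t = D t * (v2 t - u0) powr p" for t
  have U: "0 < v2 t - u0" "v2 t - u0 < v1 t - u0" "0 < v1 t - u0" if "t < P2.T0" for t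
    using above[of t] P2.v_gt_u0[of t] that by auto
  have zpos: "P1.zeta t > 0" "P2.zeta t > 0" if "t < P2.T0" for t
    using U[OF that] P1.y_pos[of t] P2.y_pos[of t] that P2.T0(1) by (auto simp: P1.zeta_def P2.zeta_def)
  have pq: "(p - 1) * (1 + q) = p" using p1 by (simp add: q_def field_simps)
  have d\<psi>: "\<exists>k. (\<psi> has_real_derivative k) (at t) \<and> (\<psi> t < 0 \<longrightarrow> k \<ge> 0)" if t: "t < P2.T0" for t
  proof -
    have t1: "t < P1.T0" and t\<tau>: "t < \<tau>" using t T P2.T0(1) by auto
    define j1 where "j1 = f (v1 t) * (v1 t - u0) powr (1 - p)"
    define j2 where "j2 = f (v2 t) * (v2 t - u0) powr (1 - p)"
    define D' where "D' = exp (m * t) * (exp (h t) * j1 + (p - 1) * P1.zeta t powr (1 + q))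
       - exp (m * t) * (exp (h t) * j2 + (p - 1) * P2.zeta t powr (1 + q))"
    have dD: "(D has_real_derivative D') (at t)"
      unfolding D_def[abs_def] D'_def j1_def j2_def by (intro DERIV_diff P1.zeta_deriv P2.zeta_deriv t t1)
    have "((\<lambda>t. v2 t - u0) has_real_derivative - (y2 t powr q)) (at t)"
      by (auto intro!: derivative_eq_intros P2.dv[OF t\<tau>])
    then have dU: "((\<lambda>t. (v2 t - u0) powr p) has_real_derivative
        p * (v2 t - u0) powr (p - of_nat 1) * (- (y2 t powr q))) (at t)"
      by (rule DERIV_fun_powr) (rule U[OF t])
    define k where "k = D' * (v2 t - u0) powr p + (p * (v2 t - u0) powr (p - of_nat 1) * (- (y2 t powr q))) * D t"
    have d: "(\<psi> has_real_derivative k) (at t)"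
      unfolding \<psi>_def[abs_def] k_def by (rule DERIV_mult[OF dD dU])
    have "k \<ge> 0" if "\<psi> t < 0"
    proof -
      have Up: "(v2 t - u0) powr p > 0" using U[OF t] by simp
      then have Dneg: "D t < 0" using \<open>\<psi> t < 0\<close> by (simp add: \<psi>_def mult_less_0_iff)
      then have z12: "P1.zeta t < P2.zeta t" by (simp add: D_def)
      have "ln (f (v2 t)) - (p - 1) * ln (v2 t - u0) \<le> ln (f (v1 t)) - (p - 1) * ln (v1 t - u0)"
        using U[OF t] by (intro f_ratio) auto
      moreover have "j1 = exp (ln (f (v1 t)) - (p - 1) * ln (v1 t - u0))" "j2 = exp (ln (f (v2 t)) - (p - 1) * ln (v2 t - u0))"
        using U[OF t] f_pos[of "v1 t"] f_pos[of "v2 t"]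
        by (simp_all add: j1_def j2_def powr_def exp_diff algebra_simps exp_add)
      ultimately have j: "j2 \<le> j1" by simp
      have "(p - 1) * (P2.zeta t powr (1 + q) - P1.zeta t powr (1 + q))
          \<le> (p - 1) * ((1 + q) * P2.zeta t powr q * (P2.zeta t - P1.zeta t))"
        using z12 zpos[OF t] q_pos p1 by (intro mult_left_mono powr_diff_le) auto
      also have "\<dots> = ((p - 1) * (1 + q)) * (P2.zeta t powr q * (P2.zeta t - P1.zeta t))" by (simp only: mult.assoc)
      finally have z: "(p - 1) * (P2.zeta t powr (1 + q) - P1.zeta t powr (1 + q))
          \<le> p * (P2.zeta t powr q * (P2.zeta t - P1.zeta t))" unfolding pq .
      have "exp (h t) * j2 \<le> exp (h t) * j1" using j by simp
      then have "- (p * (P2.zeta t powr q * (P2.zeta t - P1.zeta t)))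
          \<le> (exp (h t) * j1 + (p - 1) * P1.zeta t powr (1 + q)) - (exp (h t) * j2 + (p - 1) * P2.zeta t powr (1 + q))"
        using z[unfolded right_diff_distrib[of "p - 1"]] by linarith
      then have "exp (m * t) * (- (p * (P2.zeta t powr q * (P2.zeta t - P1.zeta t)))) \<le> D'"
        unfolding D'_def right_diff_distrib[symmetric] by (rule mult_left_mono) simp
      moreover have "exp (m * t) * (- (p * (P2.zeta t powr q * (P2.zeta t - P1.zeta t)))) = p * (y2 t powr q / (v2 t - u0)) * D t"
        unfolding P2.zeta_powr_q[OF t] by (simp add: D_def algebra_simps)
      ultimately have "p * (y2 t powr q / (v2 t - u0)) * D t * (v2 t - u0) powr p \<le> D' * (v2 t - u0) powr p"
        by (intro mult_right_mono) auto
      moreover have "(v2 t - u0) powr (p - of_nat 1) = (v2 t - u0) powr p / (v2 t - u0)"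
        using U[OF t] by (subst powr_diff) simp
      ultimately show ?thesis unfolding k_def by (simp add: mult_ac)
    qed
    with d show ?thesis by blast
  qed
  have \<psi>_bot: "(\<psi> \<longlongrightarrow> 0) at_bot"
  proof -
    have "((\<lambda>t. ((exp (m * t) * y1 t) * (v1 t - u0) powr (1 - p) - (exp (m * t) * y2 t) * (v2 t - u0) powr (1 - p)) * (v2 t - u0) powr p)
       \<longlongrightarrow> (0 * (\<alpha>1 - u0) powr (1 - p) - 0 * (\<alpha>2 - u0) powr (1 - p)) * (\<alpha>2 - u0) powr p) at_bot"
      by (intro tendsto_intros P1.omega_bot P2.omega_bot P1.v_bot P2.v_bot) (use P1.\<alpha> P2.\<alpha> in auto)
    then show ?thesis by (simp add: \<psi>_def[abs_def] D_def P1.zeta_def P2.zeta_def mult.assoc)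
  qed
  have \<psi>_nonneg: "\<psi> t \<ge> 0" if t: "t < P2.T0" for t
  proof (rule field_le_epsilon)
    fix \<epsilon> :: real assume \<epsilon>: "0 < \<epsilon>"
    have "- \<epsilon> < 0" using \<epsilon> by simp
    have "\<forall>\<^sub>F s in at_bot. - \<epsilon> < \<psi> s \<and> s < t"
      using order_tendstoD(1)[OF \<psi>_bot \<open>- \<epsilon> < 0\<close>] eventually_gt_at_bot[of t] by eventually_elim auto
    then obtain s where s: "- \<epsilon> < \<psi> s" "s < t" using eventually_happens[of _ "at_bot :: real filter"] by auto
    have "\<psi> t \<ge> - \<epsilon> * exp (0 * (t - s))"
    proof (rule deriv_gronwall)
      show "continuous_on {s..t} \<psi>"
      proof (intro continuous_at_imp_continuous_on ballI)
        fix x assume "x \<in> {s..t}"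
        then show "isCont \<psi> x" using d\<psi>[of x] t by (auto intro: DERIV_isCont)
      qed
      fix x assume "s \<le> x" "x < t" "\<psi> x < 0"
      then show "\<exists>k. (\<psi> has_real_derivative k) (at x) \<and> 0 * \<psi> x \<le> k" using d\<psi>[of x] t by auto
    qed (use s \<epsilon> in auto)
    then show "0 \<le> \<psi> t + \<epsilon>" by simp
  qed
  have z21: "P2.zeta t \<le> P1.zeta t" if t: "t < P2.T0" for t
  proof -
    have "(v2 t - u0) powr p > 0" using U[OF t] by simp
    then have "D t \<ge> 0" using \<psi>_nonneg[OF t] by (simp add: \<psi>_def zero_le_mult_iff)
    then show ?thesis by (simp add: D_def)
  qed
  define t0 where "t0 = P2.T0 - 1"
  define c where "c = (v1 t0 - u0) / (v2 t0 - u0)"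
  have ratio: "v1 t - u0 \<le> c * (v2 t - u0)" if t: "t0 \<le> t" "t < P2.T0" for t
  proof -
    have "ln (v1 t0 - u0) - ln (v2 t0 - u0) \<ge> ln (v1 t - u0) - ln (v2 t - u0)"
    proof (rule DERIV_nonpos_imp_nonincreasing[OF t(1), of "\<lambda>t. ln (v1 t - u0) - ln (v2 t - u0)"])
      fix x assume x: "t0 \<le> x" "x \<le> t"
      then have xT: "x < P2.T0" "x < P1.T0" "x < \<tau>" using t T P2.T0(1) by auto
      have d1: "((\<lambda>t. v1 t - u0) has_real_derivative - (y1 x powr q)) (at x)"
        and d2: "((\<lambda>t. v2 t - u0) has_real_derivative - (y2 x powr q)) (at x)"
        by (auto intro!: derivative_eq_intros P1.dv[OF xT(3)] P2.dv[OF xT(3)])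
      have "((\<lambda>t. ln (v1 t - u0) - ln (v2 t - u0)) has_real_derivative
          1 / (v1 x - u0) * (- (y1 x powr q)) - 1 / (v2 x - u0) * (- (y2 x powr q))) (at x)"
        using U[OF xT(1)] by (intro DERIV_diff DERIV_chain2[OF DERIV_ln_divide d1] DERIV_chain2[OF DERIV_ln_divide d2])
      moreover have "P2.zeta x powr q \<le> P1.zeta x powr q"
        using z21[OF xT(1)] zpos[OF xT(1)] q_pos by (intro powr_mono2) auto
      ultimately show "\<exists>y. ((\<lambda>t. ln (v1 t - u0) - ln (v2 t - u0)) has_real_derivative y) (at x) \<and> y \<le> 0"
        unfolding P1.zeta_powr_q[OF xT(2)] P2.zeta_powr_q[OF xT(1)]
        by (intro exI conjI) (assumption, simp)
    qed
    moreover note U[OF t(2)] U[of t0]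
    ultimately have "ln ((v1 t - u0) / (v2 t - u0)) \<le> ln ((v1 t0 - u0) / (v2 t0 - u0))"
      by (simp add: ln_div t0_def)
    moreover have "0 < (v1 t - u0) / (v2 t - u0)" "0 < (v1 t0 - u0) / (v2 t0 - u0)"
      using U[OF t(2)] U[of t0] by (simp_all add: t0_def)
    ultimately have "(v1 t - u0) / (v2 t - u0) \<le> c" unfolding c_def by (subst (asm) ln_le_cancel_iff) auto
    then show ?thesis using U[OF t(2)] by (simp add: pos_divide_le_eq)
  qed
  have "((\<lambda>t. v1 t - u0) \<longlongrightarrow> v1 P2.T0 - u0) (at_left P2.T0)"
    "((\<lambda>t. c * (v2 t - u0)) \<longlongrightarrow> c * (v2 P2.T0 - u0)) (at_left P2.T0)"
    by (intro tendsto_intros isCont_at_left P1.isCont_v P2.isCont_v P2.T0(1))+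
  moreover have "\<forall>\<^sub>F t in at_left P2.T0. v1 t - u0 \<le> c * (v2 t - u0)"
    using eventually_at_left_real[of t0 P2.T0] by (auto simp: t0_def elim!: eventually_mono intro!: ratio)
  ultimately have "v1 P2.T0 - u0 \<le> c * (v2 P2.T0 - u0)" by (intro tendsto_le[where F = "at_left P2.T0"]) auto
  then show False using P2.T0(2) above[of P2.T0] by simp
qed

text \<open>The fluxes \<open>exp (m * t) * y\<close> are compared instead of \<open>y\<close>,
  because the drift cancels; \<open>Lam\<close> is the logarithm of their quotient. While the taller
  profile is ahead and at least as steep, \<open>f \<le> 0\<close> makes \<open>Lam\<close>
  nonincreasing in the level. On the way down \<open>Lam\<close> does not fall and the lead in time
  does not shrink, so the gap in \<open>mu\<close> survives.\<close>

lemma steeper_below: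
  assumes "0 < s" "s \<le> u0"
  shows "P2.mu s < P1.mu s"
proof (rule ccontr)
  assume neg: "\<not> P2.mu s < P1.mu s"
  have r: "0 < x" "x < \<alpha>1" "x < \<alpha>2" if "s \<le> x" "x \<le> u0" for x using that assms P2.\<alpha> \<alpha>12 by auto
  have u: "P2.mu u0 < P1.mu u0" using steeper[of u0] mu_less_iff(1)[of u0] P2.\<alpha> u0 by auto
  have cont: "continuous_on {s..u0} (\<lambda>x. P1.mu x - P2.mu x)"
    by (intro continuous_at_imp_continuous_on ballI continuous_intros
        DERIV_isCont[OF P1.mu_deriv(1)] DERIV_isCont[OF P2.mu_deriv(1)] r) auto
  obtain s1 where s1': "s \<le> s1" "s1 \<le> u0" "P1.mu s1 \<le> P2.mu s1" and
    ge: "\<And>x. s1 \<le> x \<Longrightarrow> x \<le> u0 \<Longrightarrow> P2.mu x \<le> P1.mu x"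
  proof -
    obtain s1 where "s \<le> s1" "s1 < u0" "P1.mu s1 - P2.mu s1 = 0" "\<And>x. s1 < x \<Longrightarrow> x \<le> u0 \<Longrightarrow> 0 < P1.mu x - P2.mu x"
      using last_crossing[OF assms(2) cont, of 0] neg u by auto
    then show thesis using that[of s1] by (force simp: le_less)
  qed
  have lev: "P1.lev x - P2.lev x \<le> P1.lev u0 - P2.lev u0" if "s1 \<le> x" "x \<le> u0" for x
    using that s1' assms P2.\<alpha> by (intro level_gap_mono ge) auto
  then have lev0: "P1.lev x \<le> P2.lev x" if "s1 \<le> x" "x \<le> u0" for x
    using lev[OF that] crossing by (simp add: P1.T0_def P2.T0_def)
  define Lam where "Lam x = (m * P1.lev x + P1.mu x) - (m * P2.lev x + P2.mu x)" for x
  have "Lam s1 \<ge> Lam u0"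
  proof (rule DERIV_nonpos_imp_nonincreasing[OF s1'(2), of Lam])
    fix x assume x: "s1 \<le> x" "x \<le> u0"
    then have r': "0 < x" "x < \<alpha>1" "x < \<alpha>2" using r[of x] s1' by auto
    define a where "a = exp (h (P1.lev x) - (1 + q) * P1.mu x)"
    define b where "b = exp (h (P2.lev x) - (1 + q) * P2.mu x)"
    have "(Lam has_real_derivative
        (m * (- exp (- q * P1.mu x)) + (m * exp (- q * P1.mu x) - f x * a))
       - (m * (- exp (- q * P2.mu x)) + (m * exp (- q * P2.mu x) - f x * b))) (at x)"
      unfolding Lam_def[abs_def] a_def b_def
      by (intro DERIV_diff DERIV_add DERIV_cmult P1.mu_deriv P2.mu_deriv r')
    moreover have "a \<le> b"
    proof -
      have "(1 + q) * P2.mu x \<le> (1 + q) * P1.mu x" using ge[OF x] q_pos by (intro mult_left_mono) auto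
      moreover have "h (P1.lev x) \<le> h (P2.lev x)" using lev0[OF x] by (rule h_mono)
      ultimately show ?thesis by (simp add: a_def b_def)
    qed
    then have "f x * (b - a) \<le> 0" using f_nonpos[of x] x r' by (intro mult_nonpos_nonneg) auto
    ultimately show "\<exists>y. (Lam has_real_derivative y) (at x) \<and> y \<le> 0"
      by (intro exI conjI) (assumption, simp add: algebra_simps)
  qed
  moreover have "m * (P1.lev s1 - P2.lev s1) \<le> m * (P1.lev u0 - P2.lev u0)"
    using lev[of s1] s1' m0 by (intro mult_left_mono) auto
  ultimately have "P1.mu u0 - P2.mu u0 \<le> P1.mu s1 - P2.mu s1" by (simp add: Lam_def algebra_simps)
  then show False using u s1'(3) by simp
qed

text \<open>The lead \<open>c\<close> of the taller profile at the level \<open>u0 / 2\<close> is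
  positive and does not shrink further down. But a level \<open>s\<close> below
  \<open>v1 (\<tau> - c)\<close> is not passed by the taller profile before
  \<open>\<tau> - c\<close>, hence not by the other one before \<open>\<tau>\<close>, where both
  vanish.\<close>

lemma heights_not_different: False
proof -
  define b where "b = u0 / 2"
  have b: "0 < b" "b < u0" using u0 by (auto simp: b_def)
  have strict: "P1.lev b - P2.lev b < P1.lev u0 - P2.lev u0"
  proof (rule DERIV_pos_imp_increasing[OF b(2), of "\<lambda>s. P1.lev s - P2.lev s"])
    fix s assume "b \<le> s" "s \<le> u0"
    then have r: "0 < s" "s < \<alpha>1" "s < \<alpha>2" "s \<le> u0" using b P2.\<alpha> \<alpha>12 by auto
    have "((\<lambda>s. P1.lev s - P2.lev s) has_real_derivative - exp (- q * P1.mu s) - - exp (- q * P2.mu s)) (at s)"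
      by (intro DERIV_diff P1.mu_deriv P2.mu_deriv r)
    moreover have "exp (- q * P1.mu s) < exp (- q * P2.mu s)" using steeper_below[OF r(1,4)] q_pos by simp
    ultimately show "\<exists>y. ((\<lambda>s. P1.lev s - P2.lev s) has_real_derivative y) (at s) \<and> 0 < y"
      by (intro exI conjI) (assumption, simp)
  qed
  define c where "c = P2.lev b - P1.lev b"
  have c: "c > 0" using strict crossing by (simp add: c_def P1.T0_def P2.T0_def)
  define s where "s = min b (v1 (\<tau> - c) / 2)"
  have v: "v1 (\<tau> - c) > 0" using c by (intro P1.v_pos) simp
  have s: "0 < s" "s \<le> b" "s < v1 (\<tau> - c)" using b v by (auto simp: s_def min_def)
  have r: "s < \<alpha>1" "s < \<alpha>2" using s b P2.\<alpha> \<alpha>12 by auto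
  have "P1.lev s - P2.lev s \<le> P1.lev b - P2.lev b"
    using s b P2.\<alpha> by (intro level_gap_mono less_imp_le[OF steeper_below]) auto
  then have "P1.lev s \<le> P2.lev s - c" by (simp add: c_def)
  moreover have "P2.lev s < \<tau>" using P2.lev(1)[of s] s r by simp
  moreover have "\<not> P1.lev s < \<tau> - c" using P1.lev_less[of s "\<tau> - c"] s r c by auto
  ultimately show False by simp
qed

end

section \<open>Two profiles of equal heights\<close>

lemma exp_diff_le:
  fixes a b c :: real
  assumes "a \<le> c" "b \<le> c"
  shows "\<bar>exp a - exp b\<bar> \<le> exp c * \<bar>a - b\<bar>"
proof -
  have *: "exp b - exp a \<le> exp c * (b - a)" if "a \<le> b" "b \<le> c" for a b
  proof -
    have "exp b * (1 + (a - b)) \<le> exp b * exp (a - b)"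
      using exp_ge_add_one_self[of "a - b"] by (intro mult_left_mono) auto
    also have "\<dots> = exp a" by (simp add: exp_diff)
    finally have "exp b - exp a \<le> exp b * (b - a)" by (simp add: algebra_simps)
    also have "\<dots> \<le> exp c * (b - a)" using that by (intro mult_right_mono) auto
    finally show ?thesis .
  qed
  show ?thesis using *[of a b] *[of b a] assms by (cases "a \<le> b") auto
qed

lemma powr_near_one:
  fixes r :: real
  obtains K where "K \<ge> 0" "\<And>x. \<bar>x - 1\<bar> \<le> 1 / 2 \<Longrightarrow> \<bar>x powr r - 1\<bar> \<le> K * \<bar>x - 1\<bar>"
proof -
  have "\<exists>K\<ge>0. \<forall>x\<in>{1/2..3/2}. \<bar>r * x powr (r - 1)\<bar> \<le> K"
    by (rule continuous_bounded_above) (auto intro!: continuous_intros)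
  then obtain K where K: "K \<ge> 0" "\<And>x. 1/2 \<le> x \<Longrightarrow> x \<le> 3/2 \<Longrightarrow> \<bar>r * x powr (r - 1)\<bar> \<le> K" by auto
  have "\<bar>x powr r - 1\<bar> \<le> K * \<bar>x - 1\<bar>" if x: "\<bar>x - 1\<bar> \<le> 1 / 2" for x
  proof -
    have "norm (x powr r - 1 powr r) \<le> K * norm (x - 1)"
    proof (rule field_differentiable_bound[where S = "{1/2..3/2}" and f' = "\<lambda>x. r * x powr (r - 1)"])
      show "((\<lambda>x. x powr r) has_field_derivative r * z powr (r - 1)) (at z within {1/2..3/2})" if "z \<in> {1/2..3/2}" for z
        by (rule has_field_derivative_at_within) (use DERIV_fun_powr[OF DERIV_ident, of z r] that in simp)
      show "norm (r * z powr (r - 1)) \<le> K" if "z \<in> {1/2..3/2}" for z using K(2)[of z] that by simp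
      have "1 / 2 \<le> x" "x \<le> 3 / 2" using x by linarith+
      then show "x \<in> {1/2..3/2}" by simp
    qed auto
    then show ?thesis by simp
  qed
  then show thesis using that K(1) by blast
qed

locale equal_profiles = radial_ode f h \<theta> u0 m p +
  P1: radial_profile f h \<theta> u0 m p v1 y1 \<tau> \<alpha> +
  P2: radial_profile f h \<theta> u0 m p v2 y2 \<tau> \<alpha>
  for f h \<theta> u0 m p v1 y1 v2 y2 \<tau> \<alpha>
begin

text \<open>Both \<open>y\<close> tend to \<open>0\<close> at the centre, where
  \<open>x powr q\<close> has no Lipschitz bound if \<open>q < 1\<close>; therefore all errors are
  relative. A bound \<open>M\<close> for \<open>|v1 - v2|\<close> gives a relative error
  \<open>c * M\<close> of the fluxes and \<open>K * c * M\<close> of the derivatives of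
  \<open>v\<close>. Integration from the centre yields \<open>K * c * M * (\<alpha> - v1 t)\<close>,
  which is at most \<open>M / 2\<close>.\<close>

lemma equal_near_bot:
  obtains ts where "ts < \<tau>" "\<And>t. t \<le> ts \<Longrightarrow> v1 t = v2 t" "\<And>t. t \<le> ts \<Longrightarrow> y1 t = y2 t"
proof -
  have \<alpha>0: "\<alpha> > 0" "\<alpha> > u0" "f \<alpha> > 0" using P1.\<alpha> u0 f_pos by auto
  obtain d Lf where d: "d > 0" "Lf-lipschitz_on (cball \<alpha> d) f" using f_lip[OF \<alpha>0(2)] by auto
  have Lf0: "Lf \<ge> 0" using lipschitz_on_nonneg[OF d(2)] .
  \<comment> \<open>A relative Lipschitz constant: the one of \<open>f\<close> near
    \<open>\<alpha>\<close>, divided by a lower bound for \<open>f\<close> there.\<close>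
  define c where "c = Lf / (f \<alpha> / 2)"
  have c: "c \<ge> 0" using Lf0 \<alpha>0 by (simp add: c_def)
  obtain K where K: "K \<ge> 0" "\<And>x. \<bar>x - 1\<bar> \<le> 1 / 2 \<Longrightarrow> \<bar>x powr q - 1\<bar> \<le> K * \<bar>x - 1\<bar>"
    using powr_near_one by metis
  \<comment> \<open>The three bounds ensure, in this order, the Lipschitz estimate for
    \<open>f\<close>, the range \<open>|x - 1| \<le> 1 / 2\<close> of the power estimate, and the
    contraction factor \<open>1 / 2\<close>.\<close>
  define r where "r = min d (min (1 / (2 * (c + 1))) (1 / (2 * (K * c + 1))))"
  have "K * c \<ge> 0" using K(1) c by simp
  then have r: "r > 0" using d(1) c by (simp add: r_def)
  have cr: "c * r \<le> 1 / 2"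
  proof -
    have "c * r \<le> c * (1 / (2 * (c + 1)))" using c by (intro mult_left_mono) (auto simp: r_def)
    also have "\<dots> \<le> 1 / 2" using c by (simp add: field_simps)
    finally show ?thesis .
  qed
  have Kcr: "K * c * r \<le> 1 / 2"
  proof -
    have "K * c * r \<le> K * c * (1 / (2 * (K * c + 1)))" using \<open>K * c \<ge> 0\<close> by (intro mult_left_mono) (auto simp: r_def)
    also have "\<dots> \<le> 1 / 2" using \<open>K * c \<ge> 0\<close> by (simp add: field_simps)
    finally show ?thesis .
  qed
  have ev: "\<forall>\<^sub>F t in at_bot. v t > \<alpha> - r \<and> f (v t) > f \<alpha> / 2" if "(v \<longlongrightarrow> \<alpha>) at_bot" for v :: "real \<Rightarrow> real"
    using order_tendstoD(1)[OF that, of "\<alpha> - r"]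
      order_tendstoD(1)[OF isCont_tendsto_compose[OF isCont_f[OF \<alpha>0(1)] that], of "f \<alpha> / 2"] r \<alpha>0
    by (auto elim: eventually_elim2)
  have "\<forall>\<^sub>F t in at_bot. (v1 t > \<alpha> - r \<and> f (v1 t) > f \<alpha> / 2) \<and> (v2 t > \<alpha> - r \<and> f (v2 t) > f \<alpha> / 2) \<and> t < \<tau>"
    using ev[OF P1.v_bot] ev[OF P2.v_bot] eventually_gt_at_bot[of \<tau>] by eventually_elim auto
  then obtain ts where ts: "\<And>t. t \<le> ts \<Longrightarrow> (v1 t > \<alpha> - r \<and> f (v1 t) > f \<alpha> / 2) \<and> (v2 t > \<alpha> - r \<and> f (v2 t) > f \<alpha> / 2) \<and> t < \<tau>"
    unfolding eventually_at_bot_linorder by blast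
  have ts\<tau>: "t < \<tau>" if "t \<le> ts" for t using ts[OF that] by simp
  have near: "\<bar>v1 t - v2 t\<bar> \<le> r" if "t \<le> ts" for t
    using ts[OF that] P1.v_less_\<alpha>[OF ts\<tau>[OF that]] P2.v_less_\<alpha>[OF ts\<tau>[OF that]] by (simp add: abs_le_iff)
  have lipf: "\<bar>f (v1 t) - f (v2 t)\<bar> \<le> Lf * \<bar>v1 t - v2 t\<bar>" if "t \<le> ts" for t
  proof -
    have "r \<le> d" by (simp add: r_def)
    then have "v1 t \<in> cball \<alpha> d" "v2 t \<in> cball \<alpha> d"
      using ts[OF that] P1.v_less_\<alpha>[OF ts\<tau>[OF that]] P2.v_less_\<alpha>[OF ts\<tau>[OF that]] by (auto simp: dist_real_def)
    then show ?thesis using lipschitz_onD[OF d(2)] by (simp add: dist_real_def)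
  qed
  have stepy: "\<bar>y1 t - y2 t\<bar> \<le> c * M * y1 t"
    if M: "\<And>t. t \<le> ts \<Longrightarrow> \<bar>v1 t - v2 t\<bar> \<le> M" and t: "t \<le> ts" for M t
  proof -
    have M0: "M \<ge> 0" using M[OF t] by simp
    have bound: "\<bar>f (v1 s) - f (v2 s)\<bar> \<le> c * M * f (v1 s)" if s: "s \<le> ts" for s
    proof -
      have "\<bar>f (v1 s) - f (v2 s)\<bar> \<le> Lf * M"
        using lipf[OF s] mult_left_mono[OF M[OF s] Lf0] by simp
      also have "Lf * M = c * M * (f \<alpha> / 2)" using \<alpha>0 by (simp add: c_def)
      also have "\<dots> \<le> c * M * f (v1 s)" using ts[OF s] c M0 by (intro mult_left_mono) auto
      finally show ?thesis .
    qed
    define w1 where "w1 s = exp (m * s) * y1 s" for s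
    define w2 where "w2 s = exp (m * s) * y2 s" for s
    have wpos: "w1 s > 0" "w2 s > 0" if "s \<le> ts" for s
      using P1.y_pos P2.y_pos ts\<tau>[OF that] by (auto simp: w1_def w2_def)
    have dw: "(w1 has_real_derivative N s * f (v1 s)) (at s)" "(w2 has_real_derivative N s * f (v2 s)) (at s)" if "s \<le> ts" for s
      unfolding w1_def[abs_def] w2_def[abs_def] by (intro P1.omega_deriv_N P2.omega_deriv_N ts\<tau>[OF that])+
    have bot: "((\<lambda>s. - w1 s) \<longlongrightarrow> 0) at_bot" "((\<lambda>s. - w2 s) \<longlongrightarrow> 0) at_bot"
      using tendsto_minus[OF P1.omega_bot] tendsto_minus[OF P2.omega_bot] by (simp_all add: w1_def w2_def)
    have 1: "c * M * w1 t - (w1 t - w2 t) \<ge> 0"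
    proof (rule nonneg_from_at_bot[OF _ bot(1), of t "\<lambda>t. c * M * w1 t - (w1 t - w2 t)"])
      fix s assume "s \<le> t"
      then have s: "s \<le> ts" using t by simp
      have "((\<lambda>t. c * M * w1 t - (w1 t - w2 t)) has_real_derivative c * M * (N s * f (v1 s)) - (N s * f (v1 s) - N s * f (v2 s))) (at s)"
        by (intro DERIV_diff DERIV_cmult dw s)
      moreover have "c * M * (N s * f (v1 s)) - (N s * f (v1 s) - N s * f (v2 s)) = N s * (c * M * f (v1 s) - (f (v1 s) - f (v2 s)))"
        by (simp add: algebra_simps)
      moreover have "\<dots> \<ge> 0" using bound[OF s] N_pos[of s] by (intro mult_nonneg_nonneg) auto
      ultimately show "\<exists>k. ((\<lambda>t. c * M * w1 t - (w1 t - w2 t)) has_real_derivative k) (at s) \<and> k \<ge> 0" by metis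
      have "c * M * w1 s \<ge> 0" using c M0 wpos[OF s] by simp
      then show "- w1 s \<le> c * M * w1 s - (w1 s - w2 s)" using wpos[OF s] by simp
    qed
    have 2: "c * M * w1 t + (w1 t - w2 t) \<ge> 0"
    proof (rule nonneg_from_at_bot[OF _ bot(2), of t "\<lambda>t. c * M * w1 t + (w1 t - w2 t)"])
      fix s assume "s \<le> t"
      then have s: "s \<le> ts" using t by simp
      have "((\<lambda>t. c * M * w1 t + (w1 t - w2 t)) has_real_derivative c * M * (N s * f (v1 s)) + (N s * f (v1 s) - N s * f (v2 s))) (at s)"
        by (intro DERIV_add DERIV_diff DERIV_cmult dw s)
      moreover have "c * M * (N s * f (v1 s)) + (N s * f (v1 s) - N s * f (v2 s)) = N s * (c * M * f (v1 s) + (f (v1 s) - f (v2 s)))"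
        by (simp add: algebra_simps)
      moreover have "\<dots> \<ge> 0" using bound[OF s] N_pos[of s] by (intro mult_nonneg_nonneg) auto
      ultimately show "\<exists>k. ((\<lambda>t. c * M * w1 t + (w1 t - w2 t)) has_real_derivative k) (at s) \<and> k \<ge> 0" by metis
      have "c * M * w1 s \<ge> 0" using c M0 wpos[OF s] by simp
      then show "- w2 s \<le> c * M * w1 s + (w1 s - w2 s)" using wpos[OF s] by simp
    qed
    have "exp (m * t) * \<bar>y1 t - y2 t\<bar> = \<bar>w1 t - w2 t\<bar>"
      by (simp add: w1_def w2_def abs_mult right_diff_distrib[symmetric])
    also have "\<dots> \<le> c * M * w1 t" using 1 2 by simp
    also have "\<dots> = exp (m * t) * (c * M * y1 t)" by (simp add: w1_def)
    finally show ?thesis by simp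
  qed
  have stepv: "\<bar>v1 t - v2 t\<bar> \<le> M / 2"
    if M: "\<And>t. t \<le> ts \<Longrightarrow> \<bar>v1 t - v2 t\<bar> \<le> M" and Mr: "M \<le> r" and t: "t \<le> ts" for M t
  proof -
    have M0: "M \<ge> 0" using M[OF t] by simp
    have yq: "\<bar>y1 s powr q - y2 s powr q\<bar> \<le> K * c * M * y1 s powr q" if s: "s \<le> ts" for s
    proof -
      have y: "y1 s > 0" "y2 s > 0" using P1.y_pos P2.y_pos ts\<tau>[OF s] by auto
      define x where "x = y2 s / y1 s"
      have "\<bar>x - 1\<bar> = \<bar>y1 s - y2 s\<bar> / y1 s" using y by (simp add: x_def field_simps abs_minus_commute)
      also have "\<dots> \<le> c * M" using stepy[OF M s] y by (simp add: pos_divide_le_eq)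
      finally have x1: "\<bar>x - 1\<bar> \<le> c * M" .
      also have "\<dots> \<le> c * r" using Mr c by (intro mult_left_mono) auto
      also note cr
      finally have "\<bar>x powr q - 1\<bar> \<le> K * \<bar>x - 1\<bar>" by (rule K(2))
      also have "\<dots> \<le> K * (c * M)" using x1 K(1) by (intro mult_left_mono) auto
      finally have "y1 s powr q * \<bar>x powr q - 1\<bar> \<le> y1 s powr q * (K * (c * M))" by (intro mult_left_mono) auto
      moreover have "y2 s powr q = y1 s powr q * x powr q" using y by (simp add: x_def powr_mult[symmetric])
      then have "y1 s powr q - y2 s powr q = y1 s powr q * (1 - x powr q)" by (simp add: right_diff_distrib)
      then have "\<bar>y1 s powr q - y2 s powr q\<bar> = y1 s powr q * \<bar>x powr q - 1\<bar>"
        by (simp only: abs_mult abs_minus_commute[of 1]) simp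
      ultimately show ?thesis by (simp add: mult_ac)
    qed
    have bot: "((\<lambda>s. K * c * M * (\<alpha> - v1 s) + (v1 s - v2 s)) \<longlongrightarrow> 0) at_bot"
         "((\<lambda>s. K * c * M * (\<alpha> - v1 s) - (v1 s - v2 s)) \<longlongrightarrow> 0) at_bot"
      by (auto intro!: tendsto_eq_intros P1.v_bot P2.v_bot)
    have 1: "K * c * M * (\<alpha> - v1 t) + (v1 t - v2 t) \<ge> 0"
    proof (rule nonneg_from_at_bot[OF _ bot(1) order.refl])
      fix s assume "s \<le> t"
      then have s: "s \<le> ts" using t by simp
      have "((\<lambda>s. K * c * M * (\<alpha> - v1 s) + (v1 s - v2 s)) has_real_derivative
         K * c * M * (0 - - (y1 s powr q)) + (- (y1 s powr q) - - (y2 s powr q))) (at s)"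
        by (intro DERIV_add DERIV_diff DERIV_cmult DERIV_const P1.dv P2.dv ts\<tau>[OF s])
      then show "\<exists>k. ((\<lambda>s. K * c * M * (\<alpha> - v1 s) + (v1 s - v2 s)) has_real_derivative k) (at s) \<and> 0 \<le> k"
        using yq[OF s] by (intro exI conjI) (assumption, simp add: abs_le_iff)
    qed
    have 2: "K * c * M * (\<alpha> - v1 t) - (v1 t - v2 t) \<ge> 0"
    proof (rule nonneg_from_at_bot[OF _ bot(2) order.refl])
      fix s assume "s \<le> t"
      then have s: "s \<le> ts" using t by simp
      have "((\<lambda>s. K * c * M * (\<alpha> - v1 s) - (v1 s - v2 s)) has_real_derivative
         K * c * M * (0 - - (y1 s powr q)) - (- (y1 s powr q) - - (y2 s powr q))) (at s)"
        by (intro DERIV_diff DERIV_cmult DERIV_const P1.dv P2.dv ts\<tau>[OF s])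
      then show "\<exists>k. ((\<lambda>s. K * c * M * (\<alpha> - v1 s) - (v1 s - v2 s)) has_real_derivative k) (at s) \<and> 0 \<le> k"
        using yq[OF s] by (intro exI conjI) (assumption, simp add: abs_le_iff)
    qed
    have "\<bar>v1 t - v2 t\<bar> \<le> K * c * M * (\<alpha> - v1 t)" using 1 2 by simp
    also have "\<dots> \<le> K * c * M * r" using ts[OF t] \<open>K * c \<ge> 0\<close> M0 by (intro mult_left_mono) auto
    also have "\<dots> = (K * c * r) * M" by simp
    also have "\<dots> \<le> 1 / 2 * M" using Kcr M0 by (intro mult_right_mono) auto
    finally show ?thesis by simp
  qed
  have iter: "\<bar>v1 t - v2 t\<bar> \<le> r / 2 ^ k" if "t \<le> ts" for t k
    using that
  proof (induction k arbitrary: t)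
    case 0
    then show ?case using near by simp
  next
    case (Suc k)
    have "r / 2 ^ k \<le> r" using r by (simp add: field_simps)
    then have "\<bar>v1 t - v2 t\<bar> \<le> r / 2 ^ k / 2" using stepv[of "r / 2 ^ k" t] Suc by blast
    then show ?case by simp
  qed
  have eqv: "v1 t = v2 t" if t: "t \<le> ts" for t
  proof -
    have "(\<lambda>k. r / 2 ^ k) \<longlonglongrightarrow> 0"
      using LIMSEQ_divide_realpow_zero[of 2 r] by simp
    then have "\<bar>v1 t - v2 t\<bar> \<le> 0"
      by (rule tendsto_lowerbound) (use iter[OF t] in auto)
    then show ?thesis by simp
  qed
  have "y1 t = y2 t" if t: "t \<le> ts" for t
    using stepy[of 0 t] eqv t by simp
  then show thesis using that[OF ts\<tau>[OF order.refl] eqv] by blast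
qed

lemma equal:
  assumes "t < \<tau>"
  shows "v1 t = v2 t"
proof -
  obtain ts where ts: "ts < \<tau>" "\<And>t. t \<le> ts \<Longrightarrow> v1 t = v2 t" "\<And>t. t \<le> ts \<Longrightarrow> y1 t = y2 t"
    using equal_near_bot by metis
  show ?thesis
  proof (cases "t \<le> ts")
    case False
    define b where "b = v1 ts"
    have b: "0 < b" "b < \<alpha>" "v2 ts = b" using P1.v_pos[OF ts(1)] P1.v_less_\<alpha>[OF ts(1)] ts(2)[of ts] by (auto simp: b_def)
    have lb: "P1.lev b = ts" "P2.lev b = ts" using P1.lev_v[OF ts(1)] P2.lev_v[OF ts(1)] b(3) by (auto simp: b_def)
    have mub: "P1.mu b = P2.mu b" using lb ts(3)[of ts] by (simp add: P1.mu_def P2.mu_def)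
    define a where "a = v1 t"
    have ab: "0 < a" "a < b" using P1.v_pos[OF assms] P1.v_strict_decr[of ts t] False assms by (auto simp: a_def b_def)
    have r: "0 < s" "s < \<alpha>" if "a \<le> s" "s \<le> b" for s using that ab b by auto
    have c: "isCont P1.mu s" "isCont P2.mu s" "isCont P1.lev s" "isCont P2.lev s" if "a \<le> s" "s \<le> b" for s
      by (rule DERIV_isCont[OF P1.mu_deriv(1)[OF r[OF that]]] DERIV_isCont[OF P2.mu_deriv(1)[OF r[OF that]]]
        DERIV_isCont[OF P1.mu_deriv(2)[OF r[OF that]]] DERIV_isCont[OF P2.mu_deriv(2)[OF r[OF that]]])+
    have "\<exists>B\<ge>0. \<forall>s\<in>{a..b}. \<bar>P1.mu s\<bar> + \<bar>P2.mu s\<bar> + \<bar>P1.lev s\<bar> + \<bar>P2.lev s\<bar> + \<bar>f s\<bar> \<le> B"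
      by (rule continuous_bounded_above) (intro continuous_intros c isCont_f r; assumption)
    then obtain B where B: "B \<ge> 0" "\<And>s. a \<le> s \<Longrightarrow> s \<le> b \<Longrightarrow> \<bar>P1.mu s\<bar> + \<bar>P2.mu s\<bar> + \<bar>P1.lev s\<bar> + \<bar>P2.lev s\<bar> + \<bar>f s\<bar> \<le> B"
      by auto
    \<comment> \<open>Constants on the compact level interval: \<open>k1\<close> is a Lipschitz
      constant of \<open>exp (- q * mu)\<close>, \<open>G\<close> bounds the exponents in the
      equation for \<open>mu\<close>, and \<open>k3\<close> and \<open>k2\<close> are Lipschitz
      constants of that equation in \<open>lev\<close> and in \<open>mu\<close>.\<close>
    define k1 where "k1 = exp (q * B) * q"
    define G where "G = h B + (1 + q) * B"
    define k3 where "k3 = B * exp G * \<theta> (- B)"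
    define k2 where "k2 = m * k1 + B * exp G * (1 + q)"
    define C where "C = k1 + k3 + 2 * k2"
    have k0: "k1 \<ge> 0" "k2 \<ge> 0" "k3 \<ge> 0" using q_pos m0 B(1) \<theta>_pos[of "- B"] by (auto simp: k1_def k2_def k3_def)
    define A where "A s = (P1.lev s - P2.lev s)\<^sup>2 + (P1.mu s - P2.mu s)\<^sup>2" for s
    have dA: "\<exists>k. (A has_real_derivative k) (at s) \<and> k \<ge> - C * A s" if s: "a \<le> s" "s \<le> b" for s
    proof -
      define x where "x = P1.lev s - P2.lev s"
      define z where "z = P1.mu s - P2.mu s"
      define x' where "x' = - exp (- q * P1.mu s) - - exp (- q * P2.mu s)"
      define e1 where "e1 = h (P1.lev s) - (1 + q) * P1.mu s"
      define e2 where "e2 = h (P2.lev s) - (1 + q) * P2.mu s"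
      define z' where "z' = (m * exp (- q * P1.mu s) - f s * exp e1) - (m * exp (- q * P2.mu s) - f s * exp e2)"
      have d: "((\<lambda>s. P1.lev s - P2.lev s) has_real_derivative x') (at s)" "((\<lambda>s. P1.mu s - P2.mu s) has_real_derivative z') (at s)"
        unfolding x'_def z'_def e1_def e2_def by (intro DERIV_diff P1.mu_deriv P2.mu_deriv r[OF s])+
      have "(A has_real_derivative 2 * x * x' + 2 * z * z') (at s)"
        unfolding A_def[abs_def] x_def z_def
        using DERIV_add[OF DERIV_power[OF d(1), of 2] DERIV_power[OF d(2), of 2]]
        by (rule DERIV_cong) (simp add: algebra_simps)
      moreover have x': "\<bar>x'\<bar> \<le> k1 * \<bar>z\<bar>"
      proof -
        have "- P1.mu s \<le> B" "- P2.mu s \<le> B" using B(2)[OF s] by linarith+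
        then have "- q * P1.mu s \<le> q * B" "- q * P2.mu s \<le> q * B"
          using mult_left_mono[of "- P1.mu s" B q] mult_left_mono[of "- P2.mu s" B q] q_pos by simp_all
        then have "\<bar>exp (- q * P1.mu s) - exp (- q * P2.mu s)\<bar> \<le> exp (q * B) * \<bar>- q * P1.mu s - - q * P2.mu s\<bar>"
          by (rule exp_diff_le)
        also have "- q * P1.mu s - - q * P2.mu s = - (q * z)" by (simp add: z_def algebra_simps)
        also have "\<bar>- (q * z)\<bar> = q * \<bar>z\<bar>" using q_pos by (simp add: abs_mult)
        finally show ?thesis unfolding x'_def k1_def by (simp add: mult.assoc abs_minus_commute)
      qed
      moreover have z': "\<bar>z'\<bar> \<le> k2 * \<bar>z\<bar> + k3 * \<bar>x\<bar>"
      proof -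
        have bd: "\<bar>P1.mu s\<bar> \<le> B" "\<bar>P2.mu s\<bar> \<le> B" "\<bar>P1.lev s\<bar> \<le> B" "\<bar>P2.lev s\<bar> \<le> B" "\<bar>f s\<bar> \<le> B"
          using B(2)[OF s] by auto
        have "e1 \<le> G" "e2 \<le> G"
        proof -
          have "h (P1.lev s) \<le> h B" "h (P2.lev s) \<le> h B" using bd by (auto intro!: h_mono)
          moreover have "(1 + q) * (- P1.mu s) \<le> (1 + q) * B" "(1 + q) * (- P2.mu s) \<le> (1 + q) * B"
            using bd q_pos by (intro mult_left_mono; simp)+
          ultimately show "e1 \<le> G" "e2 \<le> G" by (simp_all add: e1_def e2_def G_def)
        qed
        then have E: "\<bar>exp e1 - exp e2\<bar> \<le> exp G * \<bar>e1 - e2\<bar>" by (rule exp_diff_le)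
        have hl: "\<bar>h t - h t'\<bar> \<le> \<theta> (- B) * \<bar>t - t'\<bar>" if "- B \<le> t" "- B \<le> t'" for t t'
        proof -
          have *: "h t' - h t \<le> \<theta> (- B) * (t' - t)" if "- B \<le> t" "t \<le> t'" for t t'
          proof -
            have "\<theta> (- B) * t - h t \<le> \<theta> (- B) * t' - h t'"
            proof (rule DERIV_nonneg_imp_nondecreasing[OF that(2), of "\<lambda>t. \<theta> (- B) * t - h t"])
              fix w assume "t \<le> w" "w \<le> t'"
              then show "\<exists>y. ((\<lambda>t. \<theta> (- B) * t - h t) has_real_derivative y) (at w) \<and> 0 \<le> y"
                using \<theta>_anti[of "- B" w] that by (intro exI[of _ "\<theta> (- B) - \<theta> w"]) (auto intro!: derivative_eq_intros h_deriv)
            qed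
            then show ?thesis by (simp add: algebra_simps)
          qed
          show ?thesis using *[of t t'] *[of t' t] h_mono[of t t'] h_mono[of t' t] that by (cases "t \<le> t'") auto
        qed
        have "\<bar>e1 - e2\<bar> \<le> \<theta> (- B) * \<bar>x\<bar> + (1 + q) * \<bar>z\<bar>"
        proof -
          have "e1 - e2 = (h (P1.lev s) - h (P2.lev s)) - (1 + q) * z" by (simp add: e1_def e2_def z_def algebra_simps)
          then have "\<bar>e1 - e2\<bar> \<le> \<bar>h (P1.lev s) - h (P2.lev s)\<bar> + \<bar>(1 + q) * z\<bar>" by simp
          also have "\<bar>(1 + q) * z\<bar> = (1 + q) * \<bar>z\<bar>" using q_pos by (simp add: abs_mult)
          also have "\<bar>h (P1.lev s) - h (P2.lev s)\<bar> \<le> \<theta> (- B) * \<bar>x\<bar>" unfolding x_def using bd by (intro hl) auto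
          finally show ?thesis by simp
        qed
        then have "exp G * \<bar>e1 - e2\<bar> \<le> exp G * (\<theta> (- B) * \<bar>x\<bar> + (1 + q) * \<bar>z\<bar>)" by (intro mult_left_mono) auto
        with E have "\<bar>exp e1 - exp e2\<bar> \<le> exp G * (\<theta> (- B) * \<bar>x\<bar> + (1 + q) * \<bar>z\<bar>)" by (rule order.trans)
        then have "\<bar>f s\<bar> * \<bar>exp e1 - exp e2\<bar> \<le> B * (exp G * (\<theta> (- B) * \<bar>x\<bar> + (1 + q) * \<bar>z\<bar>))"
          using bd(5) B(1) by (intro mult_mono) auto
        also have "\<dots> = k3 * \<bar>x\<bar> + B * exp G * (1 + q) * \<bar>z\<bar>" by (simp add: k3_def algebra_simps)
        finally have F: "\<bar>f s * (exp e1 - exp e2)\<bar> \<le> k3 * \<bar>x\<bar> + B * exp G * (1 + q) * \<bar>z\<bar>" by (simp add: abs_mult)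
        have "m * \<bar>x'\<bar> \<le> m * (k1 * \<bar>z\<bar>)" using x' m0 by (intro mult_left_mono) auto
        then have X: "\<bar>m * x'\<bar> \<le> m * k1 * \<bar>z\<bar>" using m0 by (simp add: abs_mult)
        have "z' = - (m * x') - f s * (exp e1 - exp e2)" by (simp add: z'_def x'_def algebra_simps)
        then have "\<bar>z'\<bar> \<le> \<bar>m * x'\<bar> + \<bar>f s * (exp e1 - exp e2)\<bar>" by simp
        then show ?thesis using F X by (simp add: k2_def algebra_simps)
      qed
      moreover have "- C * A s \<le> 2 * x * x' + 2 * z * z'"
      proof -
        have "- (x * x') \<le> \<bar>x\<bar> * \<bar>x'\<bar>" "- (z * z') \<le> \<bar>z\<bar> * \<bar>z'\<bar>" by (metis abs_ge_minus_self abs_mult)+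
        moreover have "\<bar>x\<bar> * \<bar>x'\<bar> \<le> \<bar>x\<bar> * (k1 * \<bar>z\<bar>)" using x' by (intro mult_left_mono) auto
        moreover have "\<bar>z\<bar> * \<bar>z'\<bar> \<le> \<bar>z\<bar> * (k2 * \<bar>z\<bar> + k3 * \<bar>x\<bar>)" using z' by (intro mult_left_mono) auto
        ultimately have "- (2 * x * x' + 2 * z * z') \<le> 2 * (\<bar>x\<bar> * (k1 * \<bar>z\<bar>)) + 2 * (\<bar>z\<bar> * (k2 * \<bar>z\<bar> + k3 * \<bar>x\<bar>))"
          by linarith
        also have "\<dots> = (k1 + k3) * (2 * \<bar>x\<bar> * \<bar>z\<bar>) + 2 * k2 * (\<bar>z\<bar> * \<bar>z\<bar>)" by (simp add: algebra_simps)
        also have "\<dots> \<le> (k1 + k3) * (x\<^sup>2 + z\<^sup>2) + 2 * k2 * (x\<^sup>2 + z\<^sup>2)"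
        proof (intro add_mono mult_left_mono)
          show "2 * \<bar>x\<bar> * \<bar>z\<bar> \<le> x\<^sup>2 + z\<^sup>2" using sum_squares_bound[of "\<bar>x\<bar>" "\<bar>z\<bar>"] by simp
          show "\<bar>z\<bar> * \<bar>z\<bar> \<le> x\<^sup>2 + z\<^sup>2" by (simp add: power2_eq_square)
        qed (use k0 in auto)
        also have "\<dots> = C * A s" by (simp add: C_def A_def x_def z_def algebra_simps)
        finally show ?thesis by simp
      qed
      ultimately show ?thesis by blast
    qed
    \<comment> \<open>Uniqueness runs from the level \<open>b\<close> down to \<open>a\<close>. The
      two signs turn an upper bound for the squared distance \<open>A\<close> into a lower bound, as
      Gronwall's inequality is stated above.\<close>
    define \<phi> where "\<phi> w = - A (- w)" for w
    have "\<phi> (- a) \<ge> - 0 * exp (C' * (- a - - b))" if "C' = C" for C'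
      unfolding that
    proof (rule deriv_gronwall)
      have d\<phi>: "\<exists>k. (\<phi> has_real_derivative k) (at w) \<and> k \<ge> C * \<phi> w" if w: "- b \<le> w" "w \<le> - a" for w
      proof -
        obtain k where k: "(A has_real_derivative k) (at (- w))" "k \<ge> - C * A (- w)" using dA[of "- w"] w by auto
        have "((\<lambda>w. A (- w)) has_real_derivative k * (- 1)) (at w)"
          by (rule DERIV_chain2[where f = A and g = uminus, OF k(1)]) (auto intro!: derivative_eq_intros)
        then have "(\<phi> has_real_derivative - (k * (- 1))) (at w)" unfolding \<phi>_def[abs_def] by (rule DERIV_minus)
        then show ?thesis using k(2) by (auto simp: \<phi>_def)
      qed
      show "continuous_on {- b..- a} \<phi>"
      proof (intro continuous_at_imp_continuous_on ballI)
        fix w assume "w \<in> {- b..- a}"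
        then show "isCont \<phi> w" using d\<phi>[of w] by (auto intro: DERIV_isCont)
      qed
      show "- b \<le> - a" using ab by simp
      show "- 0 \<le> \<phi> (- b)" by (simp add: \<phi>_def A_def lb mub)
      fix w assume "- b \<le> w" "w < - a"
      then show "\<exists>k. (\<phi> has_real_derivative k) (at w) \<and> C * \<phi> w \<le> k" using d\<phi>[of w] by auto
    qed simp
    then have "A a \<le> 0" by (simp add: \<phi>_def)
    then have "(P1.lev a - P2.lev a)\<^sup>2 \<le> 0" using zero_le_power2[of "P1.mu a - P2.mu a"] unfolding A_def by linarith
    then have "P1.lev a = P2.lev a" by simp
    then have "t = P2.lev a" using P1.lev_v[OF assms] by (simp add: a_def)
    then have "v2 t = a" using P2.lev(2)[of a] ab b by simp
    then show ?thesis by (simp add: a_def)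
  qed (rule ts(2))
qed

end

section \<open>From solutions to profiles\<close>

text \<open>The exponent exceeds \<open>1\<close>, so the derivative exists at \<open>0\<close> too;
  the energy below is differentiated where the flux may vanish.\<close>

lemma abs_powr_deriv:
  fixes r :: real
  assumes "r > 0"
  shows "((\<lambda>x. \<bar>x\<bar> powr (1 + r)) has_real_derivative (1 + r) * sgn x * \<bar>x\<bar> powr r) (at x)"
proof (cases x "0::real" rule: linorder_cases)
  case less
  have "((\<lambda>x. (- x) powr (1 + r)) has_real_derivative (1 + r) * (- x) powr (1 + r - of_nat 1) * (- 1)) (at x)"
    by (rule DERIV_fun_powr) (use less in \<open>auto intro!: derivative_eq_intros\<close>)
  then have "((\<lambda>x. (- x) powr (1 + r)) has_real_derivative (1 + r) * sgn x * \<bar>x\<bar> powr r) (at x)"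
    by (rule DERIV_cong) (use less in \<open>simp add: algebra_simps\<close>)
  then show ?thesis
    by (rule has_field_derivative_transform_within_open[where S = "{..<0}"]) (use less in auto)
next
  case equal
  have "((\<lambda>h. (\<bar>h\<bar> powr (1 + r)) / h) \<longlongrightarrow> 0) (at 0)"
  proof (rule tendsto_rabs_zero_cancel)
    have "((\<lambda>h::real. \<bar>h\<bar> powr r) \<longlongrightarrow> 0) (at 0)"
      by (rule tendsto_zero_powrI[OF _ tendsto_const]) (use assms in \<open>auto intro!: tendsto_eq_intros\<close>)
    then show "((\<lambda>h. \<bar>(\<bar>h\<bar> powr (1 + r)) / h\<bar>) \<longlongrightarrow> 0) (at (0::real))"
    proof (rule Lim_transform_eventually)
      show "\<forall>\<^sub>F h in at (0::real). \<bar>h\<bar> powr r = \<bar>(\<bar>h\<bar> powr (1 + r)) / h\<bar>"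
        using eventually_neq_at_within[of 0 0 UNIV] by (rule eventually_mono) (simp add: powr_add abs_mult)
    qed
  qed
  then show ?thesis using equal by (simp add: DERIV_def)
next
  case greater
  have "((\<lambda>x. x powr (1 + r)) has_real_derivative (1 + r) * x powr (1 + r - of_nat 1) * 1) (at x)"
    by (rule DERIV_fun_powr) (use greater in auto)
  then have "((\<lambda>x. x powr (1 + r)) has_real_derivative (1 + r) * sgn x * \<bar>x\<bar> powr r) (at x)" using greater by simp
  then show ?thesis
    by (rule has_field_derivative_transform_within_open[where S = "{0<..}"]) (use greater in auto)
qed

text \<open>The equation before the sign of \<open>u'\<close> is known: \<open>w\<close> is the
  signed flux \<open>r^(n-1) phi p (u')\<close>, and nothing is assumed about the height
  \<open>\<alpha>\<close>.\<close>

locale raw_profile = radial_ode +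
  fixes v w :: "real \<Rightarrow> real" and \<tau> \<alpha> :: real
  assumes dv: "\<And>t. t < \<tau> \<Longrightarrow> (v has_real_derivative sgn (w t) * (exp (- m * t) * \<bar>w t\<bar>) powr q) (at t)"
    and dw: "\<And>t. t < \<tau> \<Longrightarrow> (w has_real_derivative - (N t * f (v t))) (at t)"
    and v_pos: "\<And>t. t < \<tau> \<Longrightarrow> v t > 0"
    and v_bot: "(v \<longlongrightarrow> \<alpha>) at_bot"
    and w_bot: "(w \<longlongrightarrow> 0) at_bot"
    and v_end: "(v \<longlongrightarrow> 0) (at_left \<tau>)"
begin

lemma h_bot: "filterlim h at_bot at_bot"
  unfolding filterlim_at_bot
proof
  fix Z :: real
  have le: "h t \<le> h 0 + \<theta> 0 * t" if t: "t \<le> 0" for t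
  proof -
    have "h t - \<theta> 0 * t \<le> h 0 - \<theta> 0 * 0"
    proof (rule DERIV_nonneg_imp_nondecreasing[OF t, of "\<lambda>t. h t - \<theta> 0 * t"])
      fix x :: real assume "t \<le> x" "x \<le> 0"
      then show "\<exists>y. ((\<lambda>t. h t - \<theta> 0 * t) has_real_derivative y) (at x) \<and> 0 \<le> y"
        using \<theta>_anti[of x 0] by (intro exI[of _ "\<theta> x - \<theta> 0"]) (auto intro!: derivative_eq_intros h_deriv)
    qed
    then show ?thesis by simp
  qed
  show "\<forall>\<^sub>F t in at_bot. h t \<le> Z"
    using eventually_le_at_bot[of "min 0 ((Z - h 0) / \<theta> 0)"]
  proof (rule eventually_mono)
    fix t assume t: "t \<le> min 0 ((Z - h 0) / \<theta> 0)"
    then have "\<theta> 0 * t \<le> Z - h 0" using \<theta>_pos[of 0] by (simp add: pos_le_divide_eq mult.commute)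
    then show "h t \<le> Z" using le[of t] t by simp
  qed
qed

lemma exp_h_bot: "0 < c \<Longrightarrow> ((\<lambda>t. exp (c * h t)) \<longlongrightarrow> 0) at_bot"
  by (rule filterlim_compose[OF exp_at_bot filterlim_tendsto_pos_mult_at_bot[OF tendsto_const _ h_bot]])

lemma \<alpha>_nonneg: "\<alpha> \<ge> 0"
proof -
  have "\<forall>\<^sub>F t in at_bot. 0 \<le> v t"
    using eventually_gt_at_bot[of \<tau>] by (rule eventually_mono) (auto intro: less_imp_le v_pos)
  then show ?thesis by (rule tendsto_lowerbound[OF v_bot]) simp
qed

text \<open>Near the centre \<open>|w'| \<le> M * N\<close>, and \<open>N' \<ge> m * N\<close> makes
  \<open>(M / m) * N\<close> grow at least as fast as \<open>|w|\<close>.\<close>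

lemma w_bound:
  obtains c tb where "c \<ge> 0" "tb < \<tau>" "\<And>t. t \<le> tb \<Longrightarrow> \<bar>w t\<bar> \<le> c * N t"
proof -
  have "\<exists>M\<ge>0. \<forall>u\<in>{0..\<alpha> + 1}. \<bar>f u\<bar> \<le> M"
  proof -
    have "compact (f ` {0..\<alpha> + 1})"
      by (intro compact_continuous_image continuous_on_subset[OF f_cont]) auto
    then have "bounded (f ` {0..\<alpha> + 1})" by (rule compact_imp_bounded)
    then obtain M where "\<forall>u\<in>{0..\<alpha> + 1}. \<bar>f u\<bar> \<le> M" unfolding bounded_iff by auto
    then show ?thesis by (intro exI[of _ "\<bar>M\<bar>"]) force
  qed
  then obtain M where M: "M \<ge> 0" "\<And>u. 0 \<le> u \<Longrightarrow> u \<le> \<alpha> + 1 \<Longrightarrow> \<bar>f u\<bar> \<le> M" by auto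
  have "\<forall>\<^sub>F t in at_bot. v t < \<alpha> + 1 \<and> t < \<tau>"
    using order_tendstoD(2)[OF v_bot, of "\<alpha> + 1"] eventually_gt_at_bot[of \<tau>] by (intro eventually_conj) auto
  then obtain tb where tb: "\<And>t. t \<le> tb \<Longrightarrow> v t < \<alpha> + 1 \<and> t < \<tau>" unfolding eventually_at_bot_linorder by blast
  define c where "c = M / m"
  have c: "c \<ge> 0" using M(1) m0 by (simp add: c_def)
  have bound: "N s * \<bar>f (v s)\<bar> \<le> c * ((m + \<theta> s) * N s)" if s: "s \<le> tb" for s
  proof -
    have "\<bar>f (v s)\<bar> \<le> M" using M(2)[of "v s"] tb[OF s] v_pos[of s] by simp
    moreover have "M = c * m" using m0 by (simp add: c_def)
    moreover have "c * m \<le> c * (m + \<theta> s)" using c \<theta>_pos[of s] by (intro mult_left_mono) auto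
    ultimately have "N s * \<bar>f (v s)\<bar> \<le> N s * (c * (m + \<theta> s))" using N_pos[of s] by (intro mult_left_mono) auto
    then show ?thesis by (simp add: mult_ac)
  qed
  have "\<bar>w t\<bar> \<le> c * N t" if t: "t \<le> tb" for t
  proof -
    have 1: "c * N t - w t \<ge> 0"
    proof (rule nonneg_from_at_bot[of t "\<lambda>t. c * N t - w t" "\<lambda>t. - w t"])
      fix s assume "s \<le> t"
      then have s: "s \<le> tb" "s < \<tau>" using t tb by auto
      have "((\<lambda>t. c * N t - w t) has_real_derivative c * ((m + \<theta> s) * N s) - - (N s * f (v s))) (at s)"
        by (intro DERIV_diff DERIV_cmult N_deriv dw s)
      moreover have "- (N s * f (v s)) \<le> N s * \<bar>f (v s)\<bar>" using N_pos[of s] mult_left_mono[of "- f (v s)" "\<bar>f (v s)\<bar>" "N s"] by simp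
      ultimately show "\<exists>k. ((\<lambda>t. c * N t - w t) has_real_derivative k) (at s) \<and> k \<ge> 0"
        using bound[OF s(1)] by (intro exI conjI) (assumption, linarith)
      show "- w s \<le> c * N s - w s" using c N_pos[of s] by simp
    qed (use tendsto_minus[OF w_bot] in simp)
    have 2: "c * N t + w t \<ge> 0"
    proof (rule nonneg_from_at_bot[of t "\<lambda>t. c * N t + w t" w])
      fix s assume "s \<le> t"
      then have s: "s \<le> tb" "s < \<tau>" using t tb by auto
      have "((\<lambda>t. c * N t + w t) has_real_derivative c * ((m + \<theta> s) * N s) + - (N s * f (v s))) (at s)"
        by (intro DERIV_add DERIV_cmult N_deriv dw s)
      moreover have "N s * f (v s) \<le> N s * \<bar>f (v s)\<bar>" using N_pos[of s] by (intro mult_left_mono) auto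
      ultimately show "\<exists>k. ((\<lambda>t. c * N t + w t) has_real_derivative k) (at s) \<and> k \<ge> 0"
        using bound[OF s(1)] by (intro exI conjI) (assumption, linarith)
      show "w s \<le> c * N s + w s" using c N_pos[of s] by simp
    qed (rule w_bot)
    show ?thesis using 1 2 by (simp add: abs_le_iff)
  qed
  then show thesis using that[OF c] tb by blast
qed

lemma antiderivative_f:
  obtains F where "\<And>x. (F has_real_derivative f (max 0 x)) (at x)" "F 0 = 0"
proof -
  have "continuous_on UNIV (\<lambda>x. f (max 0 x))"
    by (rule continuous_on_compose2[OF f_cont]) (auto intro!: continuous_intros)
  then have "isCont (\<lambda>x. f (max 0 x)) x" for x by (simp add: continuous_on_eq_continuous_at)
  then obtain F where F: "\<And>x. (F has_real_derivative f (max 0 x)) (at x)"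
    using einterval_antiderivative[of "-\<infinity>" \<infinity> "\<lambda>x. f (max 0 x)"] by (auto simp: has_real_derivative_iff_has_vector_derivative)
  show thesis by (rule that[of "\<lambda>x. F x - F 0"]) (auto intro!: derivative_eq_intros F)
qed

text \<open>The energy \<open>E\<close> is nonincreasing, tends to \<open>F \<alpha>\<close> at the centre and is nonnegative at the
  boundary. Hence \<open>F\<close> is positive at every critical value, which puts these above \<open>u0\<close>.\<close>

lemma critical_values:
  shows "\<alpha> > u0" and "\<And>t. t < \<tau> \<Longrightarrow> w t = 0 \<Longrightarrow> v t > u0"
proof -
  obtain F where F: "\<And>x. (F has_real_derivative f (max 0 x)) (at x)" "F 0 = 0" using antiderivative_f by metis
  have F_low: "F x \<le> 0" if x: "0 \<le> x" "x \<le> u0" for x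
  proof -
    have "F x \<le> F 0"
    proof (rule DERIV_nonpos_imp_nonincreasing[OF x(1)])
      fix z assume "0 \<le> z" "z \<le> x"
      then show "\<exists>y. (F has_real_derivative y) (at z) \<and> y \<le> 0"
        using F(1)[of z] f_nonpos[of z] x by (auto simp: max_def intro: exI[of _ "f z"])
    qed
    then show ?thesis using F(2) by simp
  qed
  \<comment> \<open>The factor is determined by the cancellation of the terms with \<open>f\<close>
    in the derivative of \<open>E\<close>. In the variable \<open>r\<close> the energy is
    \<open>(p - 1) |u'|^p / (p K(r)) + F(u)\<close>.\<close>
  define k where "k t = exp (- (m * (1 + q) * t) - h t) / (1 + q)" for t
  have q1: "1 + q > 0" using q_pos by simp
  have k_pos: "k t > 0" for t using q1 by (simp add: k_def)
  have dk: "(k has_real_derivative - (m * (1 + q) + \<theta> t) * k t) (at t)" for t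
  proof -
    have "((\<lambda>t. - (m * (1 + q) * t) - h t) has_real_derivative - (m * (1 + q)) - \<theta> t) (at t)"
      by (auto intro!: derivative_eq_intros h_deriv)
    from DERIV_cdivide[OF DERIV_chain2[OF DERIV_exp this], of "1 + q"]
    show ?thesis unfolding k_def[abs_def] by (rule DERIV_cong) (simp add: mult.commute)
  qed
  define E where "E t = \<bar>w t\<bar> powr (1 + q) * k t + F (v t)" for t
  define E' where "E' t = - (\<bar>w t\<bar> powr (1 + q) * ((m * (1 + q) + \<theta> t) * k t))" for t
  have dE: "(E has_real_derivative E' t) (at t)" if t: "t < \<tau>" for t
  proof -
    have "((\<lambda>t. \<bar>w t\<bar> powr (1 + q)) has_real_derivative ((1 + q) * sgn (w t) * \<bar>w t\<bar> powr q) * (- (N t * f (v t)))) (at t)"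
      by (rule DERIV_chain2[where f = "\<lambda>x. \<bar>x\<bar> powr (1 + q)" and g = w, OF abs_powr_deriv[OF q_pos] dw[OF t]])
    from DERIV_add[OF DERIV_mult[OF this dk] DERIV_chain2[where f = F and g = v, OF F(1) dv[OF t]]]
    have "(E has_real_derivative ((1 + q) * sgn (w t) * \<bar>w t\<bar> powr q) * (- (N t * f (v t))) * k t
        + (- (m * (1 + q) + \<theta> t) * k t) * \<bar>w t\<bar> powr (1 + q)
        + f (max 0 (v t)) * (sgn (w t) * (exp (- m * t) * \<bar>w t\<bar>) powr q)) (at t)"
      by (simp add: E_def[abs_def])
    moreover have "max 0 (v t) = v t" using v_pos[OF t] by simp
    moreover have "(exp (- m * t) * \<bar>w t\<bar>) powr q = \<bar>w t\<bar> powr q * ((1 + q) * N t * k t)"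
    proof -
      have "(1 + q) * N t * k t = N t * exp (- (m * (1 + q) * t) - h t)" using q1 by (simp add: k_def)
      also have "\<dots> = exp (- m * t * q)" unfolding N_def exp_add[symmetric] by (simp add: algebra_simps)
      also have "\<dots> = exp (- m * t) powr q" by (simp add: exp_powr_real)
      finally show ?thesis by (simp add: powr_mult mult.commute)
    qed
    ultimately show ?thesis by (simp add: E'_def algebra_simps)
  qed
  have coef: "(m * (1 + q) + \<theta> t) * k t > 0" for t
    using m0 q_pos \<theta>_pos[of t] k_pos[of t] by (intro mult_pos_pos add_pos_pos) auto
  have E'_nonpos: "E' t \<le> 0" for t using coef[of t] by (simp add: E'_def)
  have E_anti: "E t \<le> E s" if "s \<le> t" "t < \<tau>" for s t
  proof (rule DERIV_nonpos_imp_nonincreasing[OF that(1)])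
    fix x assume "s \<le> x" "x \<le> t"
    then have "x < \<tau>" using that by simp
    then show "\<exists>y. (E has_real_derivative y) (at x) \<and> y \<le> 0" using dE[of x] E'_nonpos[of x] by blast
  qed
  have isF: "isCont F x" for x using F(1) by (rule DERIV_isCont)
  have E_nonneg: "E t \<ge> 0" if t: "t < \<tau>" for t
  proof -
    have "((\<lambda>s. F (v s)) \<longlongrightarrow> F 0) (at_left \<tau>)" by (rule isCont_tendsto_compose[OF isF v_end])
    moreover have "\<forall>\<^sub>F s in at_left \<tau>. F (v s) \<le> E t"
      using eventually_at_left_real[OF t]
    proof (rule eventually_mono)
      fix s assume "s \<in> {t<..<\<tau>}"
      then have "E s \<le> E t" by (intro E_anti) auto
      moreover have "\<bar>w s\<bar> powr (1 + q) * k s \<ge> 0" using k_pos[of s] by (intro mult_nonneg_nonneg) auto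
      ultimately show "F (v s) \<le> E t" by (simp add: E_def)
    qed
    ultimately have "F 0 \<le> E t" by (rule tendsto_upperbound) simp
    then show ?thesis using F(2) by simp
  qed
  \<comment> \<open>A zero of the nonincreasing and nonnegative \<open>E\<close> would persist up to
    \<open>\<tau>\<close>, forcing \<open>w = 0\<close> there. Then \<open>v\<close> would be
    constant and could not tend to \<open>0\<close>.\<close>
  have E_pos: "E t > 0" if t: "t < \<tau>" for t
  proof (rule ccontr)
    assume "\<not> E t > 0"
    then have E0: "E s = 0" if "t \<le> s" "s < \<tau>" for s
      using E_anti[OF that] E_nonneg[OF that(2)] by simp
    have w0: "w s = 0" if s: "t < s" "s < \<tau>" for s
    proof -
      define d where "d = min (s - t) (\<tau> - s)"
      have "d > 0" using s by (simp add: d_def)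
      moreover have "\<forall>y. \<bar>s - y\<bar> < d \<longrightarrow> E s = E y"
        using E0 s by (auto simp: d_def abs_less_iff)
      ultimately have "E' s = 0" using DERIV_local_const[OF dE[OF s(2)]] by blast
      then have "\<bar>w s\<bar> powr (1 + q) * ((m * (1 + q) + \<theta> s) * k s) = 0"
        by (simp only: E'_def neg_equal_0_iff_equal)
      then have "\<bar>w s\<bar> powr (1 + q) = 0" using coef[of s] by (metis less_irrefl mult_eq_0_iff)
      then show ?thesis by simp
    qed
    define s1 where "s1 = (t + \<tau>) / 2"
    have s1: "t < s1" "s1 < \<tau>" using t by (auto simp: s1_def)
    have "v s1 \<le> v s" if s: "s1 \<le> s" "s < \<tau>" for s
    proof (rule DERIV_nonneg_imp_nondecreasing[OF s(1)])
      fix x assume x: "s1 \<le> x" "x \<le> s"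
      then have "w x = 0" "x < \<tau>" using w0[of x] s1 s by auto
      then show "\<exists>y. (v has_real_derivative y) (at x) \<and> 0 \<le> y" using dv[of x] by (intro exI conjI) (assumption, simp)
    qed
    then have "\<forall>\<^sub>F s in at_left \<tau>. v s1 \<le> v s"
      using eventually_at_left_real[OF s1(2)] by (auto elim!: eventually_mono)
    then have "v s1 \<le> 0" by (rule tendsto_lowerbound[OF v_end]) simp
    then show False using v_pos[OF s1(2)] by simp
  qed
  show "v t > u0" if "t < \<tau>" "w t = 0" for t
  proof (rule ccontr)
    assume "\<not> v t > u0"
    then have "F (v t) \<le> 0" using F_low[of "v t"] v_pos[OF that(1)] by simp
    then show False using E_pos[OF that(1)] that(2) q1 by (simp add: E_def)
  qed
  have E_bot: "(E \<longlongrightarrow> 0 + F \<alpha>) at_bot"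
    unfolding E_def[abs_def]
  proof (rule tendsto_add)
    show "((\<lambda>t. F (v t)) \<longlongrightarrow> F \<alpha>) at_bot" by (rule isCont_tendsto_compose[OF isF v_bot])
    obtain c tb where c: "c \<ge> 0" "tb < \<tau>" "\<And>t. t \<le> tb \<Longrightarrow> \<bar>w t\<bar> \<le> c * N t" using w_bound by metis
    have lim: "((\<lambda>t. c powr (1 + q) / (1 + q) * exp (q * h t)) \<longlongrightarrow> 0) at_bot"
      by (rule tendsto_mult_right_zero[OF exp_h_bot[OF q_pos]])
    show "((\<lambda>t. \<bar>w t\<bar> powr (1 + q) * k t) \<longlongrightarrow> 0) at_bot"
    proof (rule tendsto_sandwich[OF _ _ tendsto_const lim])
      show "\<forall>\<^sub>F t in at_bot. 0 \<le> \<bar>w t\<bar> powr (1 + q) * k t"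
        by (intro always_eventually allI mult_nonneg_nonneg powr_ge_zero less_imp_le[OF k_pos])
      show "\<forall>\<^sub>F t in at_bot. \<bar>w t\<bar> powr (1 + q) * k t \<le> c powr (1 + q) / (1 + q) * exp (q * h t)"
        using eventually_le_at_bot[of tb]
      proof (rule eventually_mono)
        fix t assume "t \<le> tb"
        then have "\<bar>w t\<bar> powr (1 + q) \<le> (c * N t) powr (1 + q)" using c(3)[of t] q1 by (intro powr_mono2) auto
        also have "\<dots> = c powr (1 + q) * exp ((m * t + h t) * (1 + q))" using c(1) N_pos[of t] by (simp add: powr_mult N_def exp_powr_real)
        finally have "\<bar>w t\<bar> powr (1 + q) * k t \<le> c powr (1 + q) * exp ((m * t + h t) * (1 + q)) * k t"
          using k_pos[of t] by (intro mult_right_mono) auto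
        also have "\<dots> = c powr (1 + q) / (1 + q) * (exp ((m * t + h t) * (1 + q)) * exp (- (m * (1 + q) * t) - h t))"
          by (simp add: k_def)
        also have "exp ((m * t + h t) * (1 + q)) * exp (- (m * (1 + q) * t) - h t) = exp (q * h t)"
          unfolding exp_add[symmetric] by (simp add: algebra_simps)
        finally show "\<bar>w t\<bar> powr (1 + q) * k t \<le> c powr (1 + q) / (1 + q) * exp (q * h t)" .
      qed
    qed
  qed
  define ta where "ta = \<tau> - 1"
  have "\<forall>\<^sub>F s in at_bot. E ta \<le> E s"
    using eventually_le_at_bot[of ta] by (rule eventually_mono) (auto simp: ta_def intro: E_anti)
  then have "E ta \<le> 0 + F \<alpha>" by (rule tendsto_lowerbound[OF E_bot]) simp
  then have "F \<alpha> > 0" using E_pos[of ta] by (simp add: ta_def)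
  then show "\<alpha> > u0" using F_low[of \<alpha>] \<alpha>_nonneg by (force simp: not_le[symmetric])
qed

text \<open>Near the centre \<open>f (v t) > 0\<close> drives \<open>w\<close> below
  \<open>0\<close>. At a first return to \<open>0\<close> the critical value exceeds
  \<open>u0\<close>, so \<open>w' < 0\<close> there, although \<open>w\<close> arrives from
  below.\<close>

lemma w_neg:
  assumes t: "t < \<tau>"
  shows "w t < 0"
proof (rule ccontr)
  assume neg: "\<not> w t < 0"
  have "\<forall>\<^sub>F s in at_bot. v s > u0 \<and> s < t"
    using order_tendstoD(1)[OF v_bot critical_values(1)] eventually_gt_at_bot[of t] by (rule eventually_conj)
  then obtain t1 where t1: "\<And>s. s \<le> t1 \<Longrightarrow> v s > u0 \<and> s < t" unfolding eventually_at_bot_linorder by blast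
  have dec: "w b < w a" if "a < b" "b \<le> t1" for a b
  proof (rule DERIV_neg_imp_decreasing[OF that(1)])
    fix x assume "a \<le> x" "x \<le> b"
    then have "v x > u0" "x < \<tau>" using t1[of x] that t by auto
    then show "\<exists>y. (w has_real_derivative y) (at x) \<and> y < 0"
      using dw[of x] N_pos[of x] f_pos[of "v x"] by (intro exI conjI) (assumption, simp)
  qed
  have w1: "w t1 < 0"
  proof -
    have "\<forall>\<^sub>F s in at_bot. w (t1 - 1) \<le> w s"
      using eventually_le_at_bot[of "t1 - 1"]
    proof (rule eventually_mono)
      fix s assume "s \<le> t1 - 1"
      then show "w (t1 - 1) \<le> w s" using dec[of s "t1 - 1"] by (cases "s = t1 - 1") auto
    qed
    then have "w (t1 - 1) \<le> 0" by (rule tendsto_lowerbound[OF w_bot]) simp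
    then show ?thesis using dec[of "t1 - 1" t1] by simp
  qed
  have cont: "isCont w x" if "x \<le> t" for x using dw[of x] that t by (auto intro: DERIV_isCont)
  have "t1 \<le> t" using t1[of t1] by simp
  moreover have cont': "continuous_on {t1..t} (\<lambda>x. - w x)"
    using cont by (auto intro!: continuous_at_imp_continuous_on continuous_intros)
  ultimately obtain ts where ts1: "t1 < ts" "ts \<le> t" and "w ts = 0" and before: "\<And>x. t1 \<le> x \<Longrightarrow> x < ts \<Longrightarrow> w x < 0"
    using first_crossing[of t1 t "\<lambda>x. - w x" 0] w1 neg by auto
  have ts\<tau>: "ts < \<tau>" using ts1 t by simp
  have "f (v ts) > 0" using critical_values(2)[OF ts\<tau> \<open>w ts = 0\<close>] by (rule f_pos)
  then have "- (N ts * f (v ts)) < 0" using N_pos[of ts] by simp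
  from DERIV_neg_dec_left[OF dw[OF ts\<tau>] this] obtain d where d: "d > 0" "\<forall>h>0. h < d \<longrightarrow> w ts < w (ts - h)" by blast
  define r where "r = min (d / 2) ((ts - t1) / 2)"
  have "r > 0" "r < d" "t1 < ts - r" using d(1) ts1 by (auto simp: r_def min_def field_simps)
  then show False using d(2)[rule_format, of r] before[of "ts - r"] \<open>w ts = 0\<close> by simp
qed

lemma radial_profile: "radial_profile f h \<theta> u0 m p v (\<lambda>t. exp (- m * t) * - w t) \<tau> \<alpha>"
proof
  fix t assume t: "t < \<tau>"
  show "(v has_real_derivative - ((exp (- m * t) * - w t) powr q)) (at t)"
    using dv[OF t] w_neg[OF t] by simp
  show "((\<lambda>t. exp (- m * t) * - w t) has_real_derivative exp (h t) * f (v t) - m * (exp (- m * t) * - w t)) (at t)"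
  proof -
    have "((\<lambda>t. exp (- m * t)) has_real_derivative - m * exp (- m * t)) (at t)"
      by (auto intro!: derivative_eq_intros)
    from DERIV_mult[OF this DERIV_minus[OF dw[OF t]]]
    have d: "((\<lambda>t. exp (- m * t) * - w t) has_real_derivative
        - m * exp (- m * t) * - w t + (- (- (N t * f (v t)))) * exp (- m * t)) (at t)" .
    have "N t * exp (- m * t) = exp (h t)" unfolding N_def exp_add[symmetric] by simp
    then have e: "(- (- (N t * f (v t)))) * exp (- m * t) = exp (h t) * f (v t)" by (metis minus_minus mult.assoc mult.commute)
    show ?thesis using d unfolding e by (rule DERIV_cong) simp
  qed
  show "0 < exp (- m * t) * - w t" using w_neg[OF t] by (intro mult_pos_pos) auto
  show "0 < v t" by (rule v_pos[OF t])
next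
  show "(v \<longlongrightarrow> \<alpha>) at_bot" "(v \<longlongrightarrow> 0) (at_left \<tau>)" "u0 < \<alpha>" by (fact v_bot v_end critical_values(1))+
  obtain c tb where c: "c \<ge> 0" "tb < \<tau>" "\<And>t. t \<le> tb \<Longrightarrow> \<bar>w t\<bar> \<le> c * N t" using w_bound by metis
  have lim: "((\<lambda>t. c * exp (1 * h t)) \<longlongrightarrow> 0) at_bot" by (rule tendsto_mult_right_zero[OF exp_h_bot]) simp
  show "((\<lambda>t. exp (- m * t) * - w t) \<longlongrightarrow> 0) at_bot"
  proof (rule tendsto_sandwich[OF _ _ tendsto_const lim])
    show "\<forall>\<^sub>F t in at_bot. 0 \<le> exp (- m * t) * - w t"
      using eventually_gt_at_bot[of \<tau>]
    proof (rule eventually_mono)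
      fix t assume "t < \<tau>"
      then show "0 \<le> exp (- m * t) * - w t" using w_neg[of t] by (intro mult_nonneg_nonneg) auto
    qed
    show "\<forall>\<^sub>F t in at_bot. exp (- m * t) * - w t \<le> c * exp (1 * h t)"
      using eventually_le_at_bot[of tb]
    proof (rule eventually_mono)
      fix t assume "t \<le> tb"
      then have "- w t \<le> c * N t" using c(3)[of t] by linarith
      then have "exp (- m * t) * - w t \<le> exp (- m * t) * (c * N t)" by (rule mult_left_mono) simp
      also have "\<dots> = c * (exp (- m * t) * N t)" by simp
      also have "exp (- m * t) * N t = exp (1 * h t)" unfolding N_def exp_add[symmetric] by simp
      finally show "exp (- m * t) * - w t \<le> c * exp (1 * h t)" .
    qed
  qed
qed

end

section \<open>Passage from the radial variable to its logarithm\<close>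

lemma abs_phi: "p > 1 \<Longrightarrow> \<bar>phi p s\<bar> = \<bar>s\<bar> powr (p - 1)"
  using powr_add[of "\<bar>s\<bar>" "p - 2" 1] by (auto simp: phi_def abs_mult)

lemma sgn_phi: "sgn (phi p s) = sgn s"
  by (auto simp: phi_def sgn_mult)

lemma solution_raw_profile:
  fixes n :: nat
  assumes ode: "radial_ode f h \<theta> u0 (real n - p) p" and n: "n > 0" and R: "R > 0"
    and h: "\<And>t. h t = p * t + ln (K (exp t))" and K: "\<And>r. r > 0 \<Longrightarrow> K r > 0"
    and sol: "is_solution n p R K f u"
  shows "\<exists>w. raw_profile f h \<theta> u0 (real n - p) p (\<lambda>t. u (exp t)) w (ln R) (u 0)"
proof -
  interpret radial_ode f h \<theta> u0 "real n - p" p by (rule ode)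
  obtain u' w' where *:
    "\<forall>r\<in>{0..R}. (u has_real_derivative u' r) (at r within {0..R})"
    "\<forall>r\<in>{0..R}. ((\<lambda>r. r ^ (n - 1) * phi p (u' r)) has_real_derivative w' r) (at r within {0..R})"
    "\<forall>r\<in>{0<..<R}. - w' r = r ^ (n - 1) * K r * f (u r)"
    "u' 0 = 0" "u R = 0" "\<forall>r\<in>{0<..<R}. u r > 0"
    using sol unfolding is_solution_def C1_with_deriv_def by blast
  note u' = bspec[OF *(1)] and w' = bspec[OF *(2)] and bc = *(4,5)
  have eq: "- w' r = r ^ (n - 1) * K r * f (u r)" and pos: "u r > 0" if "0 < r" "r < R" for r
    using *(3,6) that by auto
  define w where "w t = exp t ^ (n - 1) * phi p (u' (exp t))" for t
  have exp_R: "exp t < R" if "t < ln R" for t using that R by (metis exp_less_cancel_iff exp_ln)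
  have exp_bot: "filterlim exp (at_right 0) (at_bot :: real filter)"
    by (rule tendsto_imp_filterlim_at_right[OF exp_at_bot]) simp
  have "raw_profile_axioms f h (real n - p) p (\<lambda>t. u (exp t)) w (ln R) (u 0)"
  proof
    fix t assume t: "t < ln R"
    define r where "r = exp t"
    have r: "0 < r" "r < R" using exp_R[OF t] by (auto simp: r_def)
    have at_r: "at r within {0..R} = at r" using r by (rule at_within_Icc_at)
    show "0 < u (exp t)" using pos[OF r] by (simp add: r_def)
    have "((\<lambda>t. u (exp t)) has_real_derivative u' r * exp t) (at t)"
      using u'[of r] r unfolding at_r by (intro DERIV_chain2[where f = u and g = exp, OF _ DERIV_exp]) (simp add: r_def)
    moreover have "u' r * exp t = sgn (w t) * (exp (- (real n - p) * t) * \<bar>w t\<bar>) powr q"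
    proof (cases "u' r = 0")
      case False
      define s where "s = \<bar>u' r\<bar>"
      have s: "s > 0" using False by (simp add: s_def)
      \<comment> \<open>\<open>n > 0\<close> makes the truncated \<open>n - 1\<close> the true
        difference; the exponents then add up as \<open>(p - n) + (n - 1) = p - 1\<close>.\<close>
      have "r ^ (n - 1) = r powr (real n - 1)" using r n by (simp add: powr_realpow[symmetric] of_nat_diff)
      then have "\<bar>w t\<bar> = r powr (real n - 1) * s powr (p - 1)"
        using r p1 by (simp add: w_def r_def[symmetric] abs_mult abs_phi s_def)
      moreover have "exp (- (real n - p) * t) = r powr (p - real n)" by (simp add: r_def powr_def algebra_simps)
      ultimately have "exp (- (real n - p) * t) * \<bar>w t\<bar> = (r powr (p - real n) * r powr (real n - 1)) * s powr (p - 1)"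
        by simp
      also have "\<dots> = (r * s) powr (p - 1)" using r s by (simp add: powr_add[symmetric] powr_mult)
      finally have "(exp (- (real n - p) * t) * \<bar>w t\<bar>) powr q = (r * s) powr ((p - 1) * q)" by (simp add: powr_powr)
      also have "(p - 1) * q = 1" using p1 by (simp add: q_def)
      finally have "(exp (- (real n - p) * t) * \<bar>w t\<bar>) powr q = r * s" using r s by simp
      moreover have "sgn (w t) = sgn (u' r)" using r by (simp add: w_def r_def[symmetric] sgn_mult sgn_phi)
      ultimately have "sgn (w t) * (exp (- (real n - p) * t) * \<bar>w t\<bar>) powr q = sgn (u' r) * \<bar>u' r\<bar> * r" by (simp add: s_def)
      then show ?thesis by (simp add: sgn_mult_abs r_def)
    qed (simp add: w_def r_def[symmetric] phi_def)
    ultimately show "((\<lambda>t. u (exp t)) has_real_derivative sgn (w t) * (exp (- (real n - p) * t) * \<bar>w t\<bar>) powr q) (at t)" by simp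
    have "(w has_real_derivative w' r * exp t) (at t)"
      unfolding w_def[abs_def]
      using w'[of r] r unfolding at_r
      by (intro DERIV_chain2[where f = "\<lambda>r. r ^ (n - 1) * phi p (u' r)" and g = exp, OF _ DERIV_exp]) (simp add: r_def)
    moreover have "w' r * exp t = - (N t * f (u (exp t)))"
    proof -
      have "(real n - p) * t + h t = real n * t + ln (K r)" by (simp add: h r_def algebra_simps)
      then have "N t = exp (real n * t) * K r" using K[OF r(1)] by (simp add: N_def exp_add)
      also have "exp (real n * t) = r ^ n" by (simp add: r_def exp_of_nat_mult)
      also have "r ^ n = r ^ (n - 1) * r" using power_minus_mult[OF n, of r] by simp
      finally have "N t = r ^ (n - 1) * r * K r" .
      moreover have "w' r = - (r ^ (n - 1) * K r * f (u r))" using eq[OF r] by linarith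
      ultimately show ?thesis by (simp add: r_def[symmetric])
    qed
    ultimately show "(w has_real_derivative - (N t * f (u (exp t)))) (at t)" by simp
  next
    have "(u \<longlongrightarrow> u 0) (at 0 within {0..R})"
      using u'[of 0] R by (auto dest: DERIV_continuous simp: continuous_within)
    then have "(u \<longlongrightarrow> u 0) (at_right 0)" using R by (simp add: at_within_Icc_at_right)
    then show "((\<lambda>t. u (exp t)) \<longlongrightarrow> u 0) at_bot" by (rule filterlim_compose[OF _ exp_bot])
    have "((\<lambda>r. r ^ (n - 1) * phi p (u' r)) \<longlongrightarrow> 0 ^ (n - 1) * phi p (u' 0)) (at 0 within {0..R})"
      using w'[of 0] R by (auto dest: DERIV_continuous simp: continuous_within)
    then have "((\<lambda>r. r ^ (n - 1) * phi p (u' r)) \<longlongrightarrow> 0) (at_right 0)"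
      using R bc by (simp add: at_within_Icc_at_right phi_def)
    then show "(w \<longlongrightarrow> 0) at_bot" unfolding w_def[abs_def] by (rule filterlim_compose[OF _ exp_bot])
    have "filterlim exp (at_left R) (at_left (ln R))"
    proof (rule tendsto_imp_filterlim_at_left)
      have "(exp \<longlongrightarrow> exp (ln R)) (at_left (ln R))" by (intro tendsto_intros)
      then show "(exp \<longlongrightarrow> R) (at_left (ln R))" using R by simp
      show "\<forall>\<^sub>F t in at_left (ln R). exp t < R"
        using eventually_at_left_real[of "ln R - 1" "ln R"] by (auto elim!: eventually_mono intro: exp_R)
    qed
    moreover have "(u \<longlongrightarrow> u R) (at R within {0..R})"
      using u'[of R] R by (auto dest: DERIV_continuous simp: continuous_within)
    then have "(u \<longlongrightarrow> 0) (at_left R)" using R bc by (simp add: at_within_Icc_at_left)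
    ultimately show "((\<lambda>t. u (exp t)) \<longlongrightarrow> 0) (at_left (ln R))" by (rule filterlim_compose[rotated])
  qed
  then show ?thesis using ode by (intro exI[of _ w] raw_profile.intro)
qed

theorem theorem1p2:
  fixes n :: nat and p u0 R :: real and K f :: "real \<Rightarrow> real" and D :: "real set"
  assumes "n > 0" and "real n > p" and "p > 1"
    and K_pos: "\<forall>r>0. K r > 0"
    and K_C1: "K C1_differentiable_on {0<..}"
    and K1: "\<forall>r>0. p + r * deriv K r / K r > 0"
      "antimono_on {0<..} (\<lambda>r. p + r * deriv K r / K r)"
    and f1: "f 0 = 0" "u0 > 0" "\<forall>u>u0. f u > 0"
      "\<forall>u\<in>{0<..<u0}. f u \<le> 0" "\<exists>u\<in>{0<..<u0}. f u \<noteq> 0"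
    and f2: "continuous_on {0..} f" "locally_lipschitz_on {u0..} f"
    and D_def: "D = {u. u \<ge> u0 \<and> f differentiable (at u)}"
    and f3: "\<forall>u\<in>D. (p - 1) * f u \<le> deriv f u * (u - u0)"
    and f4: "antimono_on (D - {u0}) (\<lambda>u. u * deriv f u / f u)"
    and "R > 0"
  shows "\<forall>u v.
    is_solution n p R K f u \<and> (\<exists>r\<in>{0..R}. u r \<noteq> 0) \<and>
    is_solution n p R K f v \<and> (\<exists>r\<in>{0..R}. v r \<noteq> 0) \<longrightarrow>
    (\<forall>r\<in>{0..R}. u r = v r)"
proof -
  interpret nl: nonlinearity f u0
    by unfold_locales (use f1 f2 in auto)
  define h where "h t = p * t + ln (K (exp t))" for t
  define \<theta> where "\<theta> t = p + exp t * deriv K (exp t) / K (exp t)" for t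
  have ode: "radial_ode f h \<theta> u0 (real n - p) p"
  proof
    show "1 < p" "0 < real n - p" "0 < u0" using assms by auto
    show "continuous_on {0..} f" by (rule f2)
    show "0 < f u" if "u0 < u" for u using f1 that by auto
    show "f u \<le> 0" if u: "0 \<le> u" "u \<le> u0" for u
    proof -
      have "f u0 \<le> 0"
      proof -
        have "isCont f u0" using continuous_on_interior[OF f2(1), of u0] f1(2) by simp
        from isCont_at_left[OF this] have "(f \<longlongrightarrow> f u0) (at_left u0)" .
        moreover have "\<forall>\<^sub>F u in at_left u0. f u \<le> 0"
          using eventually_at_left_real[OF f1(2)] by (rule eventually_mono) (use f1(4) in auto)
        ultimately show ?thesis by (rule tendsto_upperbound) simp
      qed
      then show ?thesis using f1(1,4) u by (cases "u = 0"; cases "u = u0") auto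
    qed
    show "\<exists>e>0. \<exists>L. L-lipschitz_on (cball u e) f" if "u0 < u" for u
      using nl.f_lipschitz_cball[OF that] by metis
    show "ln (f b) - (p - 1) * ln (b - u0) \<le> ln (f c) - (p - 1) * ln (c - u0)" if "u0 < b" "b \<le> c" for b c
      using nl.ln_ratio_mono[OF that order.refl, of 1 "p - 1"] f3 that by (auto simp: D_def)
    show "(ln (f d) - ln (f c)) / (ln d - ln c) \<le> (ln (f b) - ln (f a)) / (ln b - ln a)"
      if "u0 < a" "a < b" "b \<le> c" "c < d" for a b c d
    proof (rule nl.ln_f_chord[OF _ that])
      fix u w assume "u0 < u" "u \<le> w" "f differentiable (at u)" "f differentiable (at w)"
      then show "w * deriv f w / f w \<le> u * deriv f u / f u"
        by (intro monotone_onD[OF f4]) (auto simp: D_def)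
    qed
    show "(h has_real_derivative \<theta> t) (at t)" for t
    proof -
      obtain K' where "(K has_vector_derivative K') (at (exp t))"
        using K_C1 unfolding C1_differentiable_on_def by (meson exp_gt_zero greaterThan_iff)
      then have dK: "(K has_real_derivative deriv K (exp t)) (at (exp t))"
        by (metis DERIV_imp_deriv has_real_derivative_iff_has_vector_derivative)
      have "((\<lambda>t. K (exp t)) has_real_derivative deriv K (exp t) * exp t) (at t)"
        by (rule DERIV_chain2[where f = K and g = exp, OF dK DERIV_exp])
      moreover have "K (exp t) > 0" using K_pos by simp
      ultimately have "((\<lambda>t. ln (K (exp t))) has_real_derivative 1 / K (exp t) * (deriv K (exp t) * exp t)) (at t)"
        by (intro DERIV_chain2[where f = ln and g = "\<lambda>t. K (exp t)", OF DERIV_ln_divide])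
      from DERIV_add[OF DERIV_cmult[OF DERIV_ident, of p] this]
      show ?thesis unfolding h_def[abs_def] \<theta>_def by (rule DERIV_cong) (simp add: mult.commute)
    qed
    show "0 < \<theta> t" for t using K1(1) by (simp add: \<theta>_def)
    show "\<theta> t \<le> \<theta> s" if "s \<le> t" for s t
      unfolding \<theta>_def by (rule monotone_onD[OF K1(2)]) (use that in auto)
  qed
  have profile: "\<exists>y. radial_profile f h \<theta> u0 (real n - p) p (\<lambda>t. u (exp t)) y (ln R) (u 0)"
    if sol: "is_solution n p R K f u" for u
  proof -
    obtain w where "raw_profile f h \<theta> u0 (real n - p) p (\<lambda>t. u (exp t)) w (ln R) (u 0)"
      using solution_raw_profile[OF ode assms(1) \<open>R > 0\<close> h_def _ sol] K_pos by auto
    then show ?thesis by (blast intro: raw_profile.radial_profile)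
  qed
  \<comment> \<open>The comparison is asymmetric, with the taller solution as first profile; applied
    in both orders it leaves only equal heights.\<close>
  have not_less: "\<not> v 0 < u 0" if sol: "is_solution n p R K f u" "is_solution n p R K f v" for u v
  proof
    assume "v 0 < u 0"
    obtain y1 y2 where
      "radial_profile f h \<theta> u0 (real n - p) p (\<lambda>t. u (exp t)) y1 (ln R) (u 0)"
      "radial_profile f h \<theta> u0 (real n - p) p (\<lambda>t. v (exp t)) y2 (ln R) (v 0)"
      using profile[OF sol(1)] profile[OF sol(2)] by blast
    then interpret two_profiles f h \<theta> u0 "real n - p" p "\<lambda>t. u (exp t)" y1 "\<lambda>t. v (exp t)" y2 "ln R" "u 0" "v 0"
      using ode \<open>v 0 < u 0\<close> by (intro two_profiles.intro two_profiles_axioms.intro)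
    show False by (rule heights_not_different)
  qed
  show ?thesis
  proof (intro allI impI ballI)
    fix u v r
    assume uv: "is_solution n p R K f u \<and> (\<exists>r\<in>{0..R}. u r \<noteq> 0) \<and> is_solution n p R K f v \<and> (\<exists>r\<in>{0..R}. v r \<noteq> 0)"
      and r: "r \<in> {0..R}"
    then have 0: "u 0 = v 0" using not_less[of u v] not_less[of v u] by auto
    obtain y1 y2 where
      "radial_profile f h \<theta> u0 (real n - p) p (\<lambda>t. u (exp t)) y1 (ln R) (u 0)"
      "radial_profile f h \<theta> u0 (real n - p) p (\<lambda>t. v (exp t)) y2 (ln R) (u 0)"
      using profile uv 0 by metis
    then interpret equal_profiles f h \<theta> u0 "real n - p" p "\<lambda>t. u (exp t)" y1 "\<lambda>t. v (exp t)" y2 "ln R" "u 0"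
      using ode by (intro equal_profiles.intro)
    consider "r = 0" | "r = R" | "0 < r" "r < R" using r by force
    then show "u r = v r"
    proof cases
      case 2
      then show ?thesis using uv by (auto simp: is_solution_def)
    next
      case 3
      then have "ln r < ln R" by simp
      from equal[OF this] show ?thesis using 3 by simp
    qed (use 0 in simp)
  qed
qed

end
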